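(* Let $t>0$. For every $s>0$, the generalised heat kernel transform $T_t^s: W_H^{s,2}(\mathbb{R}^n)\to\mathcal{H}L^2(\mathbb{C}^n,U_t)$ is an isomorphism (a bounded linear bijection with bounded inverse). Moreover, $W_H^{s,2}(\mathbb{R}^n)$ can be equipped with an equivalent norm which makes $T_t^s$ an isometry.
   Context: $H=-\Delta+|x|^2$ is the Hermite operator on $\mathbb{R}^n$, with spectral decomposition $H=\sum_{k=0}^\infty(2k+n)P_k$, where $P_k$ is the orthogonal projection of $L^2(\mathbb{R}^n)$ onto the eigenspace with eigenvalue $2k+n$ (spanned by the normalised Hermite functions $\Phi_\alpha$, $|\alpha|=k$). $T_t=e^{-tH}$ is the Hermite semigroup, $T_tf=\sum_k e^{-(2k+n)t}P_kf$; for $f\in L^2(\mathbb{R}^n)$ and $t>0$ the function $T_tf$ extends to an entire function $T_tf(z)$ on $\mathbb{C}^n$. For $z=x+iy\in\mathbb{C}^n$, $U_t(z)=2^n(\sinh 4t)^{-n/2}e^{-(\coth 2t)|y|^2+(\tanh 2t)|x|^2}$, and $\mathcal{H}L^2(\mathbb{C}^n,U_t)$ is the space of entire functions $F$ on $\mathbb{C}^n$ with $\int_{\mathbb{C}^n}|F(z)|^2U_t(z)\,dz<\infty$ ($dz$ Lebesgue measure), with the corresponding $L^2$ norm. For $s>0$, $W_H^{s,2}(\mathbb{R}^n)$ is the Hermite-Sobolev space of order $s$: the domain of $H^{s/2}$ in $L^2(\mathbb{R}^n)$, with norm squared $\|H^{s/2}f\|_2^2=\sum_k(2k+n)^s\|P_kf\|_2^2$.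 For $s>0$ let $m$ be the integer with $m-1\le s/2<m$. The generalised heat kernel transform is $$T_t^sf(z)=\frac{1}{\Gamma(m-s/2)}\int_0^t r^{m-s/2-1}\,\partial_r^m\big(T_{r+t}f\big)(z)\,dr,\qquad z\in\mathbb{C}^n.$$ *)

theory Defs
  imports "HOL-Analysis.Analysis"
begin

text \<open>The space \<open>L\<^sup>2(\<real>\<^sup>n)\<close> is represented by Borel measurable, square integrable functions;
  two of them are the same element iff they agree almost everywhere.\<close>

definition L2 :: "(real^'n \<Rightarrow> complex) set" where
  "L2 = {f \<in> borel_measurable borel. integrable lborel (\<lambda>x. (cmod (f x))\<^sup>2)}"

definition L2_inner :: "(real^'n \<Rightarrow> complex) \<Rightarrow> (real^'n \<Rightarrow> complex) \<Rightarrow> complex" where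
  "L2_inner f g = (LINT x|lborel. f x * cnj (g x))"

definition L2_norm :: "(real^'n \<Rightarrow> complex) \<Rightarrow> real" where
  "L2_norm f = sqrt (LINT x|lborel. (cmod (f x))\<^sup>2)"

definition hermite_fun :: "nat \<Rightarrow> real \<Rightarrow> real" where
  "hermite_fun k x =
     (- 1) ^ k * exp (x\<^sup>2 / 2) * (deriv ^^ k) (\<lambda>u. exp (- u\<^sup>2)) x / sqrt (2 ^ k * fact k * sqrt pi)"

definition multi_hermite_fun :: "('n \<Rightarrow> nat) \<Rightarrow> real^'n \<Rightarrow> complex" where
  "multi_hermite_fun \<alpha> x = of_real (\<Prod>i\<in>UNIV. hermite_fun (\<alpha> i) (x $ i))"

text \<open>The projection \<open>P\<^sub>k\<close>, written in the orthonormal basis of its range.\<close>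

definition hermite_proj :: "nat \<Rightarrow> (real^'n \<Rightarrow> complex) \<Rightarrow> real^'n \<Rightarrow> complex" where
  "hermite_proj k f x =
     (\<Sum>\<alpha> | (\<Sum>i\<in>UNIV. \<alpha> i) = k. L2_inner f (multi_hermite_fun \<alpha>) * multi_hermite_fun \<alpha> x)"

text \<open>\<open>is_hermite_semigroup t f g\<close>: the function \<open>g\<close> represents the element
  \<open>T\<^sub>t f = (\<Sum>k. exp (- (2 k + n) t) P\<^sub>k f)\<close> of \<open>L\<^sup>2(\<real>\<^sup>n)\<close>, the series converging in norm.\<close>

definition is_hermite_semigroup ::
    "real \<Rightarrow> (real^'n \<Rightarrow> complex) \<Rightarrow> (real^'n \<Rightarrow> complex) \<Rightarrow> bool" where
  "is_hermite_semigroup t f g \<longleftrightarrow> g \<in> L2 \<and>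
     (\<lambda>N. L2_norm (\<lambda>x. g x -
        (\<Sum>k<N. of_real (exp (- (2 * real k + real CARD('n)) * t)) * hermite_proj k f x)))
     \<longlonglongrightarrow> 0"

definition entire :: "(complex^'n \<Rightarrow> complex) \<Rightarrow> bool" where
  "entire F \<longleftrightarrow> (\<forall>z. \<exists>D. (F has_derivative D) (at z) \<and> (\<forall>c v. D (c *s v) = c * D v))"

definition complex_vec :: "real^'n \<Rightarrow> complex^'n" where
  "complex_vec x = (\<chi> i. of_real (x $ i))"

definition Re_vec :: "complex^'n \<Rightarrow> real^'n" where
  "Re_vec z = (\<chi> i. Re (z $ i))"

definition Im_vec :: "complex^'n \<Rightarrow> real^'n" where
  "Im_vec z = (\<chi> i. Im (z $ i))"

text \<open>The entire function \<open>T\<^sub>t f(z)\<close>, for \<open>f\<close> in \<open>L\<^sup>2\<close> and \<open>t > 0\<close>.\<close>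

definition hermite_semigroup :: "real \<Rightarrow> (real^'n \<Rightarrow> complex) \<Rightarrow> complex^'n \<Rightarrow> complex" where
  "hermite_semigroup t f =
     (THE F. entire F \<and> is_hermite_semigroup t f (\<lambda>x. F (complex_vec x)))"

definition U_weight :: "real \<Rightarrow> complex^'n \<Rightarrow> real" where
  "U_weight t z =
     2 ^ CARD('n) * sinh (4 * t) powr (- real CARD('n) / 2) *
     exp (- (cosh (2 * t) / sinh (2 * t)) * (norm (Im_vec z))\<^sup>2
          + tanh (2 * t) * (norm (Re_vec z))\<^sup>2)"

definition HL2 :: "real \<Rightarrow> (complex^'n \<Rightarrow> complex) set" where
  "HL2 t = {F. entire F \<and> integrable lborel (\<lambda>z. (cmod (F z))\<^sup>2 * U_weight t z)}"

definition HL2_norm :: "real \<Rightarrow> (complex^'n \<Rightarrow> complex) \<Rightarrow> real" where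
  "HL2_norm t F = sqrt (LINT z|lborel. (cmod (F z))\<^sup>2 * U_weight t z)"

definition hermite_sobolev :: "real \<Rightarrow> (real^'n \<Rightarrow> complex) set" where
  "hermite_sobolev s = {f \<in> L2.
     summable (\<lambda>k. (2 * real k + real CARD('n)) powr s * (L2_norm (hermite_proj k f))\<^sup>2)}"

definition hermite_sobolev_norm :: "real \<Rightarrow> (real^'n \<Rightarrow> complex) \<Rightarrow> real" where
  "hermite_sobolev_norm s f =
     sqrt (\<Sum>k. (2 * real k + real CARD('n)) powr s * (L2_norm (hermite_proj k f))\<^sup>2)"

text \<open>The integer \<open>m\<close> with \<open>m - 1 \<le> s / 2 < m\<close>.\<close>

definition transform_order :: "real \<Rightarrow> nat" where
  "transform_order s = nat \<lfloor>s / 2\<rfloor> + 1"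

lemma transform_order_unique:
  assumes "s > 0"
  shows "real m - 1 \<le> s / 2 \<and> s / 2 < real m \<longleftrightarrow> m = transform_order s"
  unfolding transform_order_def using assms by linarith

definition gen_heat_transform ::
    "real \<Rightarrow> real \<Rightarrow> (real^'n \<Rightarrow> complex) \<Rightarrow> complex^'n \<Rightarrow> complex" where
  "gen_heat_transform t s f z = (let m = transform_order s in
     of_real (1 / Gamma (real m - s / 2)) *
     (LINT r:{0<..<t}|lborel. of_real (r powr (real m - s / 2 - 1)) *
        ((\<lambda>g \<rho>. vector_derivative g (at \<rho>)) ^^ m) (\<lambda>\<rho>. hermite_semigroup (\<rho> + t) f z) r))"

text \<open>Here \<open>W\<close> is a set of representatives of a subspace of \<open>L\<^sup>2(\<real>\<^sup>n)\<close>, closed under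
  linear combinations. Injectivity and definiteness are to be read
  accordingly; \<open>T f = T g\<close> for almost everywhere equal \<open>f\<close>, \<open>g\<close> says that \<open>T\<close> is well defined.\<close>

definition ae_linear_bij ::
    "(real^'n \<Rightarrow> complex) set \<Rightarrow> (complex^'n \<Rightarrow> complex) set \<Rightarrow>
     ((real^'n \<Rightarrow> complex) \<Rightarrow> (complex^'n \<Rightarrow> complex)) \<Rightarrow> bool" where
  "ae_linear_bij W V T \<longleftrightarrow>
     (\<forall>f\<in>W. T f \<in> V) \<and>
     (\<forall>f\<in>W. \<forall>g\<in>W. \<forall>a b. T (\<lambda>x. a * f x + b * g x) = (\<lambda>z. a * T f z + b * T g z)) \<and>
     (\<forall>f\<in>W. \<forall>g\<in>W. T f = T g \<longleftrightarrow> (AE x in lborel. f x = g x)) \<and>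
     (\<forall>F\<in>V. \<exists>f\<in>W. T f = F)"

definition ae_norm_on :: "(real^'n \<Rightarrow> complex) set \<Rightarrow> ((real^'n \<Rightarrow> complex) \<Rightarrow> real) \<Rightarrow> bool" where
  "ae_norm_on W N \<longleftrightarrow>
     (\<forall>f\<in>W. 0 \<le> N f) \<and>
     (\<forall>f\<in>W. N f = 0 \<longleftrightarrow> (AE x in lborel. f x = 0)) \<and>
     (\<forall>f\<in>W. \<forall>c. N (\<lambda>x. c * f x) = cmod c * N f) \<and>
     (\<forall>f\<in>W. \<forall>g\<in>W. N (\<lambda>x. f x + g x) \<le> N f + N g)"

definition equivalent_norms_on ::
    "(real^'n \<Rightarrow> complex) set \<Rightarrow> ((real^'n \<Rightarrow> complex) \<Rightarrow> real) \<Rightarrow> ((real^'n \<Rightarrow> complex) \<Rightarrow> real) \<Rightarrow> bool"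
  where
  "equivalent_norms_on W M N \<longleftrightarrow> (\<exists>c>0. \<exists>C>0. \<forall>f\<in>W. c * M f \<le> N f \<and> N f \<le> C * M f)"

end

theory Submission
  imports Defs "HOL-Probability.Distributions" "HOL-Complex_Analysis.Conformal_Mappings"
    "HOL-Real_Asymp.Real_Asymp"
begin

text \<open>
  Everything is diagonal in the Hermite basis \<open>\<Phi>\<^sub>\<alpha>\<close>. Write \<open>\<lambda>\<^sub>k = 2 k + n\<close>, let \<open>m\<close> be the order of
  the derivative in the transform and \<open>a = m - s / 2\<close>, which lies in \<open>(0, 1]\<close>. Integrating the
  semigroup term by term gives
  \<open>T\<^sub>t\<^sup>s \<Phi>\<^sub>\<alpha> = (- 1)^m \<mu>\<^sub>k e^(- \<lambda>\<^sub>k t) \<Phi>\<^sub>\<alpha>(z)\<close> with \<open>k = |\<alpha>|\<close> and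
  \<open>\<mu>\<^sub>k = \<lambda>\<^sub>k^m / \<Gamma>(a) \<cdot> \<integral>\<^sub>0\<^sup>t r^(a - 1) e^(- \<lambda>\<^sub>k r) dr\<close> (lemma \<open>gen_heat_transform_eq\<close>). The integral is an
  incomplete Gamma integral; for \<open>\<lambda> \<ge> 1\<close> it is comparable with \<open>\<lambda>^(- a)\<close>, so that \<open>\<mu>\<^sub>k\<close> is comparable
  with \<open>\<lambda>\<^sub>k^(s / 2)\<close> (lemma \<open>heat_multiplier_bounds\<close>). On the other side the entire functions
  \<open>e^(- \<lambda>\<^sub>k t) \<Phi>\<^sub>\<alpha>(z)\<close> are an orthogonal basis of \<open>HL2 t\<close>, all of the same norm \<open>\<kappa>\<close>
  (lemma \<open>HL2_expansion\<close>). Hence \<open>\<parallel>T\<^sub>t\<^sup>s f\<parallel>\<^sup>2 = \<kappa>\<^sup>2 \<Sum>\<^sub>k \<mu>\<^sub>k\<^sup>2 \<parallel>P\<^sub>k f\<parallel>\<^sup>2\<close> is comparable with the squared Sobolev norm,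
  every element of \<open>HL2 t\<close> is reached, and the norm of \<open>HL2 t\<close> pulled back along the transform is the
  equivalent norm that makes the transform isometric.

  Three facts about Hermite functions carry this.

  Growth. On a bounded set the three term recurrence bounds \<open>\<Phi>\<^sub>\<alpha>\<close> by \<open>e^(\<delta> |\<alpha>|)\<close> for every \<open>\<delta> > 0\<close>. The
  factor \<open>e^(- \<lambda>\<^sub>k \<rho>)\<close> then makes every Hermite expansion converge to an entire function, with all
  derivatives in \<open>\<rho>\<close> taken term by term.

  Orthogonality. For the weight \<open>e^(- a x\<^sup>2 - b y\<^sup>2)\<close> on \<open>\<complex>\<close> with \<open>1 / a - 1 / b = 1\<close>, integration by parts in
  both real directions gives \<open>\<langle>H\<^sub>k\<^sub>+\<^sub>1, H\<^sub>l\<rangle> = 2 l q \<langle>H\<^sub>k, H\<^sub>l\<^sub>-\<^sub>1\<rangle>\<close> with \<open>q = 1 / a + 1 / b\<close>. Together with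
  the factor \<open>|e^(- z\<^sup>2 / 2)|\<^sup>2\<close> of the Hermite functions the weight \<open>U\<^sub>t\<close> is of this kind with \<open>q = e^(4 t)\<close>; this
  is the growth that \<open>e^(- 2 \<lambda>\<^sub>k t)\<close> compensates.

  Completeness. A function orthogonal to all Hermite functions is orthogonal to every polynomial times
  \<open>e^(- \<tau> z\<^sup>2)\<close> with \<open>\<tau> = 1 / 2\<close>. Expanding an exponential into its power series moves \<open>\<tau>\<close> by a small
  amount, and finitely many such steps move it far. On \<open>\<real>\<^sup>n\<close> one lets \<open>\<tau>\<close> tend to infinity, where all
  averages against narrow Gaussians vanish. On \<open>\<complex>\<^sup>n\<close> one stops at the value of \<open>\<tau>\<close> at which the weight
  becomes a function of \<open>|z|\<close>; there the mean value property of holomorphic functions shows that an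
  entire function orthogonal to all exponentials vanishes at every point.
\<close>

section \<open>Square integrable functions and orthonormal systems\<close>

text \<open>For an arbitrary measure, so that \<open>L\<^sup>2(\<real>\<^sup>n)\<close> and the weighted space on \<open>\<complex>\<^sup>n\<close> are two instances.\<close>

definition sq_int :: "'a measure \<Rightarrow> ('a \<Rightarrow> complex) \<Rightarrow> bool" where
  "sq_int M f \<longleftrightarrow> f \<in> borel_measurable M \<and> integrable M (\<lambda>x. (cmod (f x))\<^sup>2)"

definition norm_sq :: "'a measure \<Rightarrow> ('a \<Rightarrow> complex) \<Rightarrow> real" where
  "norm_sq M f = (LINT x|M. (cmod (f x))\<^sup>2)"

definition inner_prod :: "'a measure \<Rightarrow> ('a \<Rightarrow> complex) \<Rightarrow> ('a \<Rightarrow> complex) \<Rightarrow> complex" where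
  "inner_prod M f g = (LINT x|M. f x * cnj (g x))"

lemma sq_int_measurable: "sq_int M f \<Longrightarrow> f \<in> borel_measurable M"
  by (simp add: sq_int_def)

lemma norm_sq_nonneg [simp]: "0 \<le> norm_sq M f"
  unfolding norm_sq_def by (intro integral_nonneg_AE) auto

lemma sq_int_norm_mult:
  assumes "sq_int M f" "sq_int M g"
  shows "integrable M (\<lambda>x. cmod (f x) * cmod (g x))"
proof (rule Bochner_Integration.integrable_bound)
  show "integrable M (\<lambda>x. (cmod (f x))\<^sup>2 + (cmod (g x))\<^sup>2)"
    using assms by (auto simp: sq_int_def)
  show "(\<lambda>x. cmod (f x) * cmod (g x)) \<in> borel_measurable M"
    using assms by (auto simp: sq_int_def)
  have "a * b \<le> a\<^sup>2 + b\<^sup>2" if "a \<ge> 0" "b \<ge> 0" for a b :: real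
    using sum_squares_bound[of a b] mult_nonneg_nonneg[OF that] by linarith
  then show "AE x in M. norm (cmod (f x) * cmod (g x)) \<le> norm ((cmod (f x))\<^sup>2 + (cmod (g x))\<^sup>2)"
    by (intro AE_I2) auto
qed

lemma borel_measurable_cnj [measurable (raw)]:
  "f \<in> borel_measurable M \<Longrightarrow> (\<lambda>x. cnj (f x)) \<in> borel_measurable M"
  by (rule measurable_compose[OF _ borel_measurable_continuous_onI[OF continuous_on_cnj[OF continuous_on_id]]])

lemma sq_int_mult:
  assumes "sq_int M f" "sq_int M g"
  shows "integrable M (\<lambda>x. f x * cnj (g x))"
proof (rule Bochner_Integration.integrable_bound[OF sq_int_norm_mult[OF assms]])
  have [measurable]: "f \<in> borel_measurable M" "g \<in> borel_measurable M"
    using assms by (auto simp: sq_int_def)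
  show "(\<lambda>x. f x * cnj (g x)) \<in> borel_measurable M"
    by measurable
qed (auto simp: norm_mult)

lemma sq_int_cmult:
  assumes "sq_int M f" shows "sq_int M (\<lambda>x. c * f x)"
  using assms by (auto simp: sq_int_def norm_mult power_mult_distrib)

lemma cmod_add_sq_le: "(cmod (a + b))\<^sup>2 \<le> 2 * (cmod a)\<^sup>2 + 2 * (cmod b)\<^sup>2"
proof -
  have "(cmod (a + b))\<^sup>2 \<le> (cmod a + cmod b)\<^sup>2"
    by (intro power_mono norm_triangle_ineq) auto
  also have "\<dots> \<le> 2 * (cmod a)\<^sup>2 + 2 * (cmod b)\<^sup>2"
    using sum_squares_bound[of "cmod a" "cmod b"] by (simp add: power2_sum)
  finally show ?thesis .
qed

lemma sq_int_add:
  assumes "sq_int M f" "sq_int M g"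
  shows "sq_int M (\<lambda>x. f x + g x)"
  unfolding sq_int_def
proof
  show m: "(\<lambda>x. f x + g x) \<in> borel_measurable M"
    using assms by (auto simp: sq_int_def)
  show "integrable M (\<lambda>x. (cmod (f x + g x))\<^sup>2)"
  proof (rule Bochner_Integration.integrable_bound)
    show "integrable M (\<lambda>x. 2 * (cmod (f x))\<^sup>2 + 2 * (cmod (g x))\<^sup>2)"
      using assms by (auto simp: sq_int_def)
  qed (use m cmod_add_sq_le in auto)
qed

lemma sq_int_diff:
  assumes "sq_int M f" "sq_int M g"
  shows "sq_int M (\<lambda>x. f x - g x)"
  using sq_int_add[OF assms(1) sq_int_cmult[OF assms(2), of "-1"]] by simp

lemma sq_int_zero: "sq_int M (\<lambda>x. 0)"
  by (simp add: sq_int_def)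

lemma sq_int_sum:
  assumes "\<And>i. i \<in> A \<Longrightarrow> sq_int M (f i)"
  shows "sq_int M (\<lambda>x. \<Sum>i\<in>A. f i x)"
  using assms
  by (induction A rule: infinite_finite_induct) (auto intro: sq_int_add sq_int_zero)

lemma inner_prod_self: "inner_prod M f f = of_real (norm_sq M f)"
  unfolding inner_prod_def norm_sq_def by (subst integral_complex_of_real [symmetric])
    (simp add: complex_norm_square del: of_real_power)

lemma inner_prod_cnj: "inner_prod M g f = cnj (inner_prod M f g)"
  unfolding inner_prod_def by (subst Bochner_Integration.integral_cnj[symmetric]) (simp add: mult.commute)

lemma inner_prod_add_left:
  assumes "sq_int M f" "sq_int M g" "sq_int M h"
  shows "inner_prod M (\<lambda>x. f x + g x) h = inner_prod M f h + inner_prod M g h"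
  unfolding inner_prod_def distrib_right
  by (intro Bochner_Integration.integral_add sq_int_mult assms)

lemma inner_prod_cmult_left: "inner_prod M (\<lambda>x. c * f x) h = c * inner_prod M f h"
  unfolding inner_prod_def mult.assoc by simp

lemma inner_prod_diff_left:
  assumes "sq_int M f" "sq_int M g" "sq_int M h"
  shows "inner_prod M (\<lambda>x. f x - g x) h = inner_prod M f h - inner_prod M g h"
  unfolding inner_prod_def left_diff_distrib
  by (intro Bochner_Integration.integral_diff sq_int_mult assms)

lemma inner_prod_sum_left:
  assumes "\<And>i. i \<in> A \<Longrightarrow> sq_int M (f i)" "sq_int M h"
  shows "inner_prod M (\<lambda>x. \<Sum>i\<in>A. f i x) h = (\<Sum>i\<in>A. inner_prod M (f i) h)"
  unfolding inner_prod_def sum_distrib_right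
  by (intro Bochner_Integration.integral_sum sq_int_mult assms)

lemma inner_prod_sum_right:
  assumes "\<And>i. i \<in> A \<Longrightarrow> sq_int M (f i)" "sq_int M h"
  shows "inner_prod M h (\<lambda>x. \<Sum>i\<in>A. f i x) = (\<Sum>i\<in>A. inner_prod M h (f i))"
  by (subst inner_prod_cnj, subst inner_prod_sum_left[OF assms], simp_all, rule sum.cong[OF refl], simp add: inner_prod_cnj[symmetric])

lemma inner_prod_cmult_right: "inner_prod M f (\<lambda>x. c * h x) = cnj c * inner_prod M f h"
  by (subst inner_prod_cnj, subst inner_prod_cmult_left) (simp add: inner_prod_cnj[symmetric])

lemma norm_sq_cmult: "norm_sq M (\<lambda>x. c * f x) = (cmod c)\<^sup>2 * norm_sq M f"
  unfolding norm_sq_def by (simp add: norm_mult power_mult_distrib)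

text \<open>The Cauchy-Schwarz inequality, transferred from nonnegative integrals.\<close>

lemma integral_norm_mult_le:
  assumes f: "sq_int M f" and g: "sq_int M g"
  shows "(LINT x|M. cmod (f x) * cmod (g x)) \<le> sqrt (norm_sq M f) * sqrt (norm_sq M g)"
proof -
  have [measurable]: "f \<in> borel_measurable M" "g \<in> borel_measurable M"
    using assms by (auto simp: sq_int_def)
  let ?I = "LINT x|M. cmod (f x) * cmod (g x)"
  have I0: "?I \<ge> 0" by (intro integral_nonneg_AE) auto
  have 1: "(\<integral>\<^sup>+x. ennreal (cmod (f x)) * ennreal (cmod (g x)) \<partial>M) = ennreal ?I"
    by (subst nn_integral_eq_integral[OF sq_int_norm_mult[OF f g], symmetric])
       (auto simp: ennreal_mult)
  have 2: "(\<integral>\<^sup>+x. (ennreal (cmod (h x)))\<^sup>2 \<partial>M) = ennreal (norm_sq M h)" if "sq_int M h" for h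
    unfolding norm_sq_def using that
    by (subst nn_integral_eq_integral[symmetric]) (auto simp: sq_int_def ennreal_power)
  have "(ennreal ?I)\<^sup>2 \<le> ennreal (norm_sq M f) * ennreal (norm_sq M g)"
    unfolding 1[symmetric] 2[OF f, symmetric] 2[OF g, symmetric]
    by (rule Cauchy_Schwarz_nn_integral) measurable
  then have "ennreal (?I\<^sup>2) \<le> ennreal (norm_sq M f * norm_sq M g)"
    using I0 by (simp add: ennreal_power ennreal_mult)
  then have "?I\<^sup>2 \<le> norm_sq M f * norm_sq M g"
    by (subst (asm) ennreal_le_iff) auto
  then show ?thesis
    using I0 by (metis real_le_rsqrt real_sqrt_mult)
qed

lemma norm_inner_prod_le:
  assumes "sq_int M f" "sq_int M g"
  shows "cmod (inner_prod M f g) \<le> sqrt (norm_sq M f) * sqrt (norm_sq M g)"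
proof -
  have "cmod (inner_prod M f g) \<le> (LINT x|M. cmod (f x * cnj (g x)))"
    unfolding inner_prod_def by (rule integral_norm_bound)
  also have "\<dots> \<le> sqrt (norm_sq M f) * sqrt (norm_sq M g)"
    using integral_norm_mult_le[OF assms] by (simp add: norm_mult)
  finally show ?thesis .
qed

lemma minkowski:
  assumes f: "sq_int M f" and g: "sq_int M g"
  shows "sqrt (norm_sq M (\<lambda>x. f x + g x)) \<le> sqrt (norm_sq M f) + sqrt (norm_sq M g)"
proof -
  have "norm_sq M (\<lambda>x. f x + g x) \<le> (LINT x|M. (cmod (f x))\<^sup>2 + (cmod (g x))\<^sup>2 + 2 * (cmod (f x) * cmod (g x)))"
    unfolding norm_sq_def
  proof (rule integral_mono)
    show "integrable M (\<lambda>x. (cmod (f x + g x))\<^sup>2)"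
      using sq_int_add[OF f g] by (simp add: sq_int_def)
    show "integrable M (\<lambda>x. (cmod (f x))\<^sup>2 + (cmod (g x))\<^sup>2 + 2 * (cmod (f x) * cmod (g x)))"
      using f g sq_int_norm_mult[OF f g] by (auto simp: sq_int_def)
    show "(cmod (f x + g x))\<^sup>2 \<le> (cmod (f x))\<^sup>2 + (cmod (g x))\<^sup>2 + 2 * (cmod (f x) * cmod (g x))" for x
    proof -
      have "(cmod (f x + g x))\<^sup>2 \<le> (cmod (f x) + cmod (g x))\<^sup>2"
        by (intro power_mono norm_triangle_ineq) auto
      then show ?thesis by (simp add: power2_sum)
    qed
  qed
  also have "\<dots> = norm_sq M f + norm_sq M g + 2 * (LINT x|M. cmod (f x) * cmod (g x))"
    unfolding norm_sq_def using f g sq_int_norm_mult[OF f g] by (auto simp: sq_int_def)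
  also have "\<dots> \<le> norm_sq M f + norm_sq M g + 2 * (sqrt (norm_sq M f) * sqrt (norm_sq M g))"
    using integral_norm_mult_le[OF f g] by simp
  also have "\<dots> = (sqrt (norm_sq M f) + sqrt (norm_sq M g))\<^sup>2"
    by (simp add: power2_sum)
  finally show ?thesis
    by (intro real_le_lsqrt) auto
qed

lemma norm_sq_eq_0_iff:
  assumes "sq_int M f"
  shows "norm_sq M f = 0 \<longleftrightarrow> (AE x in M. f x = 0)"
  unfolding norm_sq_def using assms
  by (subst integral_nonneg_eq_0_iff_AE) (auto simp: sq_int_def)

lemma norm_sq_add_le:
  assumes f: "sq_int M f" and g: "sq_int M g"
  shows "norm_sq M (\<lambda>x. f x + g x) \<le> 2 * norm_sq M f + 2 * norm_sq M g"
proof -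
  have "sq_int M (\<lambda>x. f x + g x)" by (rule sq_int_add[OF f g])
  then have "norm_sq M (\<lambda>x. f x + g x) \<le> (LINT x|M. 2 * (cmod (f x))\<^sup>2 + 2 * (cmod (g x))\<^sup>2)"
    unfolding norm_sq_def using f g
    by (intro integral_mono cmod_add_sq_le) (auto simp: sq_int_def)
  also have "\<dots> = 2 * norm_sq M f + 2 * norm_sq M g"
    unfolding norm_sq_def using f g by (auto simp: sq_int_def)
  finally show ?thesis .
qed

text \<open>The indices of an expansion are graded, and sums run over one degree after the other: this matches
  the projections \<open>P\<^sub>k\<close> and avoids an enumeration of multi-indices.\<close>

definition shell :: "('i \<Rightarrow> nat) \<Rightarrow> ('i \<Rightarrow> complex) \<Rightarrow> nat \<Rightarrow> real" where
  "shell deg a k = (\<Sum>i | deg i = k. (cmod (a i))\<^sup>2)"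

definition expansion_upto :: "('i \<Rightarrow> nat) \<Rightarrow> ('i \<Rightarrow> 'a \<Rightarrow> complex) \<Rightarrow> ('i \<Rightarrow> complex) \<Rightarrow> nat \<Rightarrow> 'a \<Rightarrow> complex" where
  "expansion_upto deg e a N x = (\<Sum>k<N. \<Sum>i | deg i = k. a i * e i x)"

lemma shell_nonneg [simp]: "0 \<le> shell deg a k"
  by (simp add: shell_def sum_nonneg)

locale graded_ons =
  fixes M :: "'a measure" and e :: "'i \<Rightarrow> 'a \<Rightarrow> complex" and deg :: "'i \<Rightarrow> nat"
  assumes sq: "sq_int M (e i)"
    and orth: "inner_prod M (e i) (e j) = (if i = j then 1 else 0)"
    and fin: "finite {i. deg i = k}"
begin

lemma finite_deg_less: "finite {i. deg i < N}"
proof -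
  have "{i. deg i < N} = (\<Union>k<N. {i. deg i = k})" by auto
  then show ?thesis using fin by simp
qed

lemma sum_deg: "(\<Sum>k\<in>K. \<Sum>i | deg i = k. h i) = (\<Sum>i | deg i \<in> K. h i)" if "finite K"
  for h :: "'i \<Rightarrow> 'b::comm_monoid_add"
proof -
  have "{i. deg i \<in> K} = (\<Union>k\<in>K. {i. deg i = k})" by auto
  then show ?thesis
    using that fin by (simp add: sum.UNION_disjoint disjoint_iff)
qed

lemma expansion_upto_eq: "expansion_upto deg e a N x = (\<Sum>i | deg i < N. a i * e i x)"
  unfolding expansion_upto_def by (subst sum_deg) auto

lemma expansion_upto_diff:
  assumes "L \<le> N"
  shows "expansion_upto deg e a N x - expansion_upto deg e a L x = (\<Sum>i | deg i \<in> {L..<N}. a i * e i x)"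
proof -
  have "{i. deg i < N} = {i. deg i < L} \<union> {i. deg i \<in> {L..<N}}" using assms by auto
  moreover have "finite {i. deg i \<in> {L..<N}}"
    by (rule finite_subset[OF _ finite_deg_less[of N]]) auto
  ultimately show ?thesis
    unfolding expansion_upto_eq using finite_deg_less
    by (simp add: sum.union_disjoint disjoint_iff)
qed

lemma sq_int_comb: "sq_int M (\<lambda>x. \<Sum>i\<in>A. a i * e i x)"
  by (intro sq_int_sum sq_int_cmult sq)

lemma sq_int_expansion_upto: "sq_int M (expansion_upto deg e a N)"
  using sq_int_comb by (subst expansion_upto_eq[abs_def])

lemma inner_prod_comb:
  assumes "finite A"
  shows "inner_prod M (\<lambda>x. \<Sum>i\<in>A. a i * e i x) (e j) = (if j \<in> A then a j else 0)"
proof -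
  have "inner_prod M (\<lambda>x. \<Sum>i\<in>A. a i * e i x) (e j) = (\<Sum>i\<in>A. a i * inner_prod M (e i) (e j))"
    by (subst inner_prod_sum_left) (auto simp: inner_prod_cmult_left intro: sq_int_cmult sq)
  also have "\<dots> = (\<Sum>i\<in>A. if i = j then a j else 0)"
    by (intro sum.cong) (auto simp: orth)
  finally show ?thesis using assms by simp
qed

lemma norm_sq_comb:
  assumes "finite A"
  shows "norm_sq M (\<lambda>x. \<Sum>i\<in>A. a i * e i x) = (\<Sum>i\<in>A. (cmod (a i))\<^sup>2)"
proof -
  have "complex_of_real (norm_sq M (\<lambda>x. \<Sum>i\<in>A. a i * e i x)) =
      inner_prod M (\<lambda>x. \<Sum>i\<in>A. a i * e i x) (\<lambda>x. \<Sum>i\<in>A. a i * e i x)"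
    by (simp add: inner_prod_self)
  also have "\<dots> = (\<Sum>j\<in>A. cnj (a j) * inner_prod M (\<lambda>x. \<Sum>i\<in>A. a i * e i x) (e j))"
    by (subst inner_prod_sum_right) (auto simp: inner_prod_cmult_right intro: sq_int_cmult sq sq_int_comb)
  also have "\<dots> = (\<Sum>j\<in>A. cnj (a j) * a j)"
    by (intro sum.cong) (auto simp: inner_prod_comb[OF assms])
  also have "\<dots> = complex_of_real (\<Sum>i\<in>A. (cmod (a i))\<^sup>2)"
    by (simp add: complex_norm_square mult.commute del: of_real_power)
  finally show ?thesis using of_real_eq_iff by blast
qed

lemma inner_prod_expansion_upto: "inner_prod M (expansion_upto deg e a N) (e j) = (if deg j < N then a j else 0)"
  using inner_prod_comb[OF finite_deg_less[of N], of a j] by (simp add: expansion_upto_eq[abs_def])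

lemma norm_sq_expansion_upto: "norm_sq M (expansion_upto deg e a N) = (\<Sum>k<N. shell deg a k)"
proof -
  have "norm_sq M (expansion_upto deg e a N) = (\<Sum>i | deg i < N. (cmod (a i))\<^sup>2)"
    using norm_sq_comb[OF finite_deg_less[of N], of a] by (simp add: expansion_upto_eq[abs_def])
  also have "\<dots> = (\<Sum>k<N. shell deg a k)"
    unfolding shell_def by (subst sum_deg) auto
  finally show ?thesis .
qed

lemma norm_sq_expansion_upto_diff:
  assumes "L \<le> N"
  shows "norm_sq M (\<lambda>x. expansion_upto deg e a N x - expansion_upto deg e a L x) = (\<Sum>k=L..<N. shell deg a k)"
proof -
  have fin: "finite {i. deg i \<in> {L..<N}}"
    by (rule finite_subset[OF _ finite_deg_less[of N]]) auto
  have "norm_sq M (\<lambda>x. expansion_upto deg e a N x - expansion_upto deg e a L x) = (\<Sum>i | deg i \<in> {L..<N}. (cmod (a i))\<^sup>2)"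
    using norm_sq_comb[OF fin, of a] by (simp add: expansion_upto_diff[OF assms])
  also have "\<dots> = (\<Sum>k=L..<N. shell deg a k)"
    unfolding shell_def by (subst sum_deg) auto
  finally show ?thesis .
qed

lemma sq_int_minus_expansion_upto: "sq_int M f \<Longrightarrow> sq_int M (\<lambda>x. f x - expansion_upto deg e a N x)"
  by (intro sq_int_diff sq_int_expansion_upto)

text \<open>The remainder of the partial expansion is orthogonal to the partial expansion, so Pythagoras
  leaves a nonnegative difference.\<close>

lemma bessel_finite:
  assumes f: "sq_int M f"
  shows "(\<Sum>k<N. shell deg (\<lambda>i. inner_prod M f (e i)) k) \<le> norm_sq M f"
proof -
  define c where "c i = inner_prod M f (e i)" for i
  let ?p = "expansion_upto deg e c N"
  have "inner_prod M f ?p = (\<Sum>i | deg i < N. cnj (c i) * inner_prod M f (e i))"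
    unfolding expansion_upto_eq[abs_def]
    by (subst inner_prod_sum_right) (auto simp: inner_prod_cmult_right intro: sq_int_cmult sq f)
  also have "\<dots> = (\<Sum>i | deg i < N. cnj (c i) * inner_prod M ?p (e i))"
    by (intro sum.cong) (auto simp: inner_prod_expansion_upto c_def)
  also have "\<dots> = inner_prod M ?p ?p"
    unfolding expansion_upto_eq[abs_def]
    by (subst inner_prod_sum_right) (auto simp: inner_prod_cmult_right intro: sq_int_cmult sq sq_int_comb)
  finally have 0: "inner_prod M (\<lambda>x. f x - ?p x) ?p = 0"
    by (simp add: inner_prod_diff_left f sq_int_expansion_upto)
  have "inner_prod M (\<lambda>x. (f x - ?p x) + ?p x) f = inner_prod M (\<lambda>x. f x - ?p x) f + inner_prod M ?p f"
    by (intro inner_prod_add_left sq_int_minus_expansion_upto sq_int_expansion_upto f)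
  moreover have "inner_prod M ?p f = inner_prod M ?p ?p"
    using 0 by (subst inner_prod_cnj, simp add: inner_prod_diff_left f sq_int_expansion_upto) (simp add: inner_prod_self)
  moreover have "inner_prod M (\<lambda>x. f x - ?p x) (\<lambda>x. f x - ?p x) = inner_prod M (\<lambda>x. f x - ?p x) f"
  proof -
    have "inner_prod M (\<lambda>x. f x - ?p x) (\<lambda>x. f x - ?p x) =
        cnj (inner_prod M f (\<lambda>x. f x - ?p x) - inner_prod M ?p (\<lambda>x. f x - ?p x))"
      by (subst inner_prod_cnj, subst inner_prod_diff_left) (auto intro: sq_int_minus_expansion_upto sq_int_expansion_upto f)
    also have "\<dots> = inner_prod M (\<lambda>x. f x - ?p x) f - inner_prod M (\<lambda>x. f x - ?p x) ?p"
      by (simp add: inner_prod_cnj[symmetric])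
    finally show ?thesis by (simp add: 0)
  qed
  ultimately have "complex_of_real (norm_sq M f) = of_real (norm_sq M (\<lambda>x. f x - ?p x) + norm_sq M ?p)"
    by (simp add: inner_prod_self)
  then have "norm_sq M f = norm_sq M (\<lambda>x. f x - ?p x) + norm_sq M ?p"
    using of_real_eq_iff by blast
  then have "norm_sq M ?p \<le> norm_sq M f" using norm_sq_nonneg by simp
  then show ?thesis by (simp add: norm_sq_expansion_upto c_def[abs_def])
qed

lemma bessel:
  assumes "sq_int M f"
  shows "summable (shell deg (\<lambda>i. inner_prod M f (e i)))"
  by (rule summableI_nonneg_bounded[OF _ bessel_finite[OF assms]]) simp

text \<open>Fatou's lemma turns pointwise convergence of (a subsequence of) the partial sums of a series
  with square summable coefficients into convergence in norm.\<close>

lemma fatou_limit: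
  assumes a: "summable (shell deg a)" and r: "strict_mono r"
    and F: "F \<in> borel_measurable M"
    and lim: "AE x in M. (\<lambda>j. expansion_upto deg e a (r j) x) \<longlonglongrightarrow> F x"
  shows "sq_int M F" and "(\<lambda>N. norm_sq M (\<lambda>x. F x - expansion_upto deg e a N x)) \<longlonglongrightarrow> 0"
proof -
  have [measurable]: "expansion_upto deg e a N \<in> borel_measurable M" for N
    using sq_int_expansion_upto by (rule sq_int_measurable)
  have tail: "(\<integral>\<^sup>+x. ennreal ((cmod (F x - expansion_upto deg e a N x))\<^sup>2) \<partial>M) \<le> ennreal (\<Sum>k. shell deg a (k + N))" for N
  proof -
    have "(\<integral>\<^sup>+x. ennreal ((cmod (F x - expansion_upto deg e a N x))\<^sup>2) \<partial>M) =
       (\<integral>\<^sup>+x. liminf (\<lambda>j. ennreal ((cmod (expansion_upto deg e a (r j) x - expansion_upto deg e a N x))\<^sup>2)) \<partial>M)"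
    proof (rule nn_integral_cong_AE, use lim in eventually_elim)
      case (elim x)
      then have "(\<lambda>j. ennreal ((cmod (expansion_upto deg e a (r j) x - expansion_upto deg e a N x))\<^sup>2)) \<longlonglongrightarrow> ennreal ((cmod (F x - expansion_upto deg e a N x))\<^sup>2)"
        by (intro tendsto_intros)
      then show ?case
        by (intro lim_imp_Liminf[symmetric]) auto
    qed
    also have "\<dots> \<le> liminf (\<lambda>j. \<integral>\<^sup>+x. ennreal ((cmod (expansion_upto deg e a (r j) x - expansion_upto deg e a N x))\<^sup>2) \<partial>M)"
      by (rule nn_integral_liminf) measurable
    also have "\<dots> \<le> ennreal (\<Sum>k. shell deg a (k + N))"
    proof (rule Liminf_le)
      have "eventually (\<lambda>j. j \<ge> N) sequentially" by (rule eventually_ge_at_top)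
      then show "\<forall>\<^sub>F j in sequentially. (\<integral>\<^sup>+x. ennreal ((cmod (expansion_upto deg e a (r j) x - expansion_upto deg e a N x))\<^sup>2) \<partial>M)
          \<le> ennreal (\<Sum>k. shell deg a (k + N))"
      proof eventually_elim
        case (elim j)
        then have le: "N \<le> r j" using strict_mono_imp_increasing[OF r, of j] by linarith
        have "(\<integral>\<^sup>+x. ennreal ((cmod (expansion_upto deg e a (r j) x - expansion_upto deg e a N x))\<^sup>2) \<partial>M)
            = ennreal (norm_sq M (\<lambda>x. expansion_upto deg e a (r j) x - expansion_upto deg e a N x))"
          unfolding norm_sq_def using sq_int_diff[OF sq_int_expansion_upto sq_int_expansion_upto]
          by (intro nn_integral_eq_integral) (auto simp: sq_int_def)
        also have "\<dots> = ennreal (\<Sum>k=N..<r j. shell deg a k)"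
          by (simp add: norm_sq_expansion_upto_diff[OF le])
        also have "(\<Sum>k=N..<r j. shell deg a k) = (\<Sum>k=0..<r j - N. shell deg a (k + N))"
          using sum.shift_bounds_nat_ivl[of "shell deg a" 0 N "r j - N"] le by simp
        also have "\<dots> \<le> (\<Sum>k. shell deg a (k + N))"
          using a by (intro sum_le_suminf summable_ignore_initial_segment) auto
        finally show ?case by (simp add: ennreal_leI)
      qed
    qed simp
    finally show ?thesis .
  qed
  have int: "integrable M (\<lambda>x. (cmod (F x - expansion_upto deg e a N x))\<^sup>2)" for N
  proof (rule integrableI_bounded)
    show "(\<integral>\<^sup>+x. ennreal (norm ((cmod (F x - expansion_upto deg e a N x))\<^sup>2)) \<partial>M) < \<infinity>"
      using tail[of N] by (simp add: order_le_less_trans[OF _ ennreal_less_top])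
  qed (use F in measurable)
  have sqd: "sq_int M (\<lambda>x. F x - expansion_upto deg e a N x)" for N
    unfolding sq_int_def using F int by auto
  show "sq_int M F" using sqd[of 0] by (simp add: expansion_upto_def)
  have le: "norm_sq M (\<lambda>x. F x - expansion_upto deg e a N x) \<le> (\<Sum>k. shell deg a (k + N))" for N
  proof -
    have "ennreal (norm_sq M (\<lambda>x. F x - expansion_upto deg e a N x)) \<le> ennreal (\<Sum>k. shell deg a (k + N))"
      unfolding norm_sq_def using tail[of N] int by (subst (asm) nn_integral_eq_integral) auto
    then show ?thesis
      using a by (subst (asm) ennreal_le_iff) (auto intro!: suminf_nonneg summable_ignore_initial_segment)
  qed
  show "(\<lambda>N. norm_sq M (\<lambda>x. F x - expansion_upto deg e a N x)) \<longlonglongrightarrow> 0"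
    by (rule tendsto_sandwich[OF _ _ tendsto_const suminf_exist_split2[OF a]])
       (use le in auto)
qed

text \<open>Coefficients depend continuously on the function, and those of the partial sums are eventually constant.\<close>

lemma coeff_of_limit:
  assumes F: "sq_int M F" and lim: "(\<lambda>N. norm_sq M (\<lambda>x. F x - expansion_upto deg e a N x)) \<longlonglongrightarrow> 0"
  shows "inner_prod M F (e j) = a j"
proof -
  have "(\<lambda>N. inner_prod M (\<lambda>x. F x - expansion_upto deg e a N x) (e j)) \<longlonglongrightarrow> 0"
  proof (rule Lim_null_comparison)
    show "\<forall>\<^sub>F N in sequentially. cmod (inner_prod M (\<lambda>x. F x - expansion_upto deg e a N x) (e j))
        \<le> sqrt (norm_sq M (\<lambda>x. F x - expansion_upto deg e a N x)) * sqrt (norm_sq M (e j))"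
      by (intro always_eventually allI norm_inner_prod_le sq_int_minus_expansion_upto F sq)
    show "(\<lambda>N. sqrt (norm_sq M (\<lambda>x. F x - expansion_upto deg e a N x)) * sqrt (norm_sq M (e j))) \<longlonglongrightarrow> 0"
      using tendsto_mult_right[OF tendsto_real_sqrt[OF lim]] by simp
  qed
  moreover have "\<forall>\<^sub>F N in sequentially. inner_prod M (\<lambda>x. F x - expansion_upto deg e a N x) (e j) = inner_prod M F (e j) - a j"
    using eventually_gt_at_top[of "deg j"]
    by eventually_elim (simp add: inner_prod_diff_left F sq_int_expansion_upto sq inner_prod_expansion_upto)
  ultimately have "(\<lambda>N::nat. inner_prod M F (e j) - a j) \<longlonglongrightarrow> 0"
    by (rule Lim_transform_eventually)
  then show ?thesis by (simp add: LIMSEQ_const_iff)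
qed

lemma norm_sq_of_limit:
  assumes F: "sq_int M F" and lim: "(\<lambda>N. norm_sq M (\<lambda>x. F x - expansion_upto deg e a N x)) \<longlonglongrightarrow> 0"
  shows "shell deg a sums norm_sq M F"
proof -
  have "(\<lambda>N. sqrt (norm_sq M (expansion_upto deg e a N)) - sqrt (norm_sq M F)) \<longlonglongrightarrow> 0"
  proof (rule Lim_null_comparison)
    show "(\<lambda>N. sqrt (norm_sq M (\<lambda>x. F x - expansion_upto deg e a N x))) \<longlonglongrightarrow> 0"
      using tendsto_real_sqrt[OF lim] by simp
    have "\<bar>sqrt (norm_sq M (expansion_upto deg e a N)) - sqrt (norm_sq M F)\<bar> \<le> sqrt (norm_sq M (\<lambda>x. F x - expansion_upto deg e a N x))" for N
    proof -
      have "norm_sq M (\<lambda>x. expansion_upto deg e a N x - F x) = norm_sq M (\<lambda>x. F x - expansion_upto deg e a N x)"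
        unfolding norm_sq_def by (simp add: norm_minus_commute)
      then show ?thesis
        using minkowski[OF sq_int_minus_expansion_upto[OF F, of a N] sq_int_expansion_upto[of a N]]
          minkowski[OF sq_int_diff[OF sq_int_expansion_upto[of a N] F] F]
        by auto
    qed
    then show "\<forall>\<^sub>F N in sequentially. norm (sqrt (norm_sq M (expansion_upto deg e a N)) - sqrt (norm_sq M F))
      \<le> sqrt (norm_sq M (\<lambda>x. F x - expansion_upto deg e a N x))"
      by auto
  qed
  then have "(\<lambda>N. sqrt (norm_sq M (expansion_upto deg e a N))) \<longlonglongrightarrow> sqrt (norm_sq M F)"
    by (simp add: LIM_zero_iff)
  from tendsto_power[OF this, of 2] have "(\<lambda>N. norm_sq M (expansion_upto deg e a N)) \<longlonglongrightarrow> norm_sq M F"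
    by simp
  then show ?thesis by (simp add: sums_def norm_sq_expansion_upto)
qed

text \<open>Completeness of \<open>L\<^sup>2\<close> in the form in which it is needed. Along a subsequence the tails of the
  coefficients decay like \<open>4^(- j)\<close>; the successive differences \<open>d\<^sub>j\<close> then satisfy
  \<open>\<Sum>\<^sub>j 2^j |d\<^sub>j|\<^sup>2 < \<infinity>\<close> almost everywhere, which forces \<open>\<Sum>\<^sub>j |d\<^sub>j| < \<infinity>\<close>. Fatou's lemma identifies
  the pointwise limit with the limit in norm.\<close>

lemma riesz_fischer:
  assumes a: "summable (shell deg a)"
  obtains F where "sq_int M F" "(\<lambda>N. norm_sq M (\<lambda>x. F x - expansion_upto deg e a N x)) \<longlonglongrightarrow> 0"
proof -
  have [measurable]: "expansion_upto deg e a N \<in> borel_measurable M" for N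
    using sq_int_expansion_upto by (rule sq_int_measurable)
  have "\<forall>j. \<exists>N. \<forall>n\<ge>N. norm (\<Sum>k. shell deg a (k + n)) < (1/4) ^ j"
    using suminf_exist_split[OF _ a] by simp
  then obtain N0 where N0: "norm (\<Sum>k. shell deg a (k + n)) < (1/4) ^ j" if "n \<ge> N0 j" for j n
    by metis
  \<comment> \<open>A strictly increasing sequence that dominates \<open>N0\<close>.\<close>
  define r where "r j = (\<Sum>i\<le>j. N0 i + 1)" for j
  have r: "strict_mono r"
    unfolding strict_mono_Suc_iff r_def by simp
  have rN: "N0 j \<le> r j" for j
  proof -
    have "N0 j + 1 \<le> r j" unfolding r_def by (rule member_le_sum) auto
    then show ?thesis by simp
  qed
  define d where "d j x = expansion_upto deg e a (r (Suc j)) x - expansion_upto deg e a (r j) x" for j x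
  have dm [measurable]: "d j \<in> borel_measurable M" for j unfolding d_def[abs_def] by measurable
  have dn: "(\<integral>\<^sup>+x. ennreal ((cmod (d j x))\<^sup>2) \<partial>M) \<le> ennreal ((1/4)^j)" for j
  proof -
    have le: "r j \<le> r (Suc j)" using r by (simp add: strict_mono_less_eq)
    have "(\<integral>\<^sup>+x. ennreal ((cmod (d j x))\<^sup>2) \<partial>M) = ennreal (norm_sq M (d j))"
      unfolding norm_sq_def using sq_int_diff[OF sq_int_expansion_upto sq_int_expansion_upto]
      by (intro nn_integral_eq_integral) (auto simp: sq_int_def d_def[abs_def])
    also have "norm_sq M (d j) = (\<Sum>k=r j..<r (Suc j). shell deg a k)"
      unfolding d_def[abs_def] by (rule norm_sq_expansion_upto_diff[OF le])
    also have "\<dots> = (\<Sum>k=0..<r (Suc j) - r j. shell deg a (k + r j))"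
      using sum.shift_bounds_nat_ivl[of "shell deg a" 0 "r j" "r (Suc j) - r j"] le by simp
    also have "\<dots> \<le> (\<Sum>k. shell deg a (k + r j))"
      using a by (intro sum_le_suminf summable_ignore_initial_segment) auto
    also have "\<dots> \<le> (1/4)^j" using N0[OF rN, of j] by simp
    finally show ?thesis by (simp add: ennreal_leI)
  qed
  have "(\<integral>\<^sup>+x. (\<Sum>j. ennreal (2^j * (cmod (d j x))\<^sup>2)) \<partial>M) = (\<Sum>j. \<integral>\<^sup>+x. ennreal (2^j * (cmod (d j x))\<^sup>2) \<partial>M)"
    by (rule nn_integral_suminf) measurable
  also have "\<dots> \<le> (\<Sum>j. ennreal ((1/2)^j))"
  proof (rule suminf_le)
    fix j
    have "(\<integral>\<^sup>+x. ennreal (2^j * (cmod (d j x))\<^sup>2) \<partial>M) = ennreal (2^j) * (\<integral>\<^sup>+x. ennreal ((cmod (d j x))\<^sup>2) \<partial>M)"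
      by (subst nn_integral_cmult[symmetric]) (auto simp: ennreal_mult)
    also have "\<dots> \<le> ennreal (2^j) * ennreal ((1/4)^j)"
      by (intro mult_left_mono dn) auto
    also have "\<dots> = ennreal ((1/2)^j)"
      by (subst ennreal_mult[symmetric]) (auto simp: power_mult_distrib[symmetric])
    finally show "(\<integral>\<^sup>+x. ennreal (2^j * (cmod (d j x))\<^sup>2) \<partial>M) \<le> ennreal ((1/2)^j)" .
  qed auto
  also have "\<dots> < \<infinity>"
    by (subst suminf_ennreal2) (auto simp: summable_geometric)
  finally have "AE x in M. (\<Sum>j. ennreal (2^j * (cmod (d j x))\<^sup>2)) \<noteq> \<infinity>"
    by (intro nn_integral_noteq_infinite) auto
  then have conv: "AE x in M. convergent (\<lambda>j. expansion_upto deg e a (r j) x)"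
  proof eventually_elim
    case (elim x)
    then have s: "summable (\<lambda>j. 2^j * (cmod (d j x))\<^sup>2)"
      by (intro summable_suminf_not_top) (auto simp: top_ennreal_def)
    have "summable (\<lambda>j. d j x)"
    proof (rule summable_comparison_test')
      show "summable (\<lambda>j. 2^j * (cmod (d j x))\<^sup>2 + (1/2)^j)"
        by (intro summable_add s summable_geometric) auto
      fix j :: nat
      \<comment> \<open>The arithmetic-geometric mean inequality splits \<open>|d\<^sub>j|\<close> into two summable parts.\<close>
      have "2 * sqrt (2^j) * cmod (d j x) * sqrt ((1/2)^j) \<le> (sqrt (2^j) * cmod (d j x))\<^sup>2 + (sqrt ((1/2)^j))\<^sup>2"
        using sum_squares_bound[of "sqrt (2^j) * cmod (d j x)" "sqrt ((1/2)^j)"] by simp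
      moreover have "sqrt (2^j) * sqrt ((1/2)^j) = 1"
        by (simp add: real_sqrt_mult[symmetric] power_mult_distrib[symmetric])
      ultimately have "2 * cmod (d j x) \<le> 2^j * (cmod (d j x))\<^sup>2 + (1/2)^j"
        by (simp add: power_mult_distrib mult.assoc mult.left_commute mult.commute)
      then show "norm (d j x) \<le> 2^j * (cmod (d j x))\<^sup>2 + (1/2)^j"
        using norm_ge_zero[of "d j x"] by linarith
    qed
    then have "convergent (\<lambda>n. \<Sum>j<n. d j x)"
      by (simp add: summable_iff_convergent)
    then have "convergent (\<lambda>n. (\<Sum>j<n. d j x) + expansion_upto deg e a (r 0) x)"
      by (intro convergent_add convergent_const)
    moreover have "(\<Sum>j<n. d j x) + expansion_upto deg e a (r 0) x = expansion_upto deg e a (r n) x" for n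
      by (induction n) (auto simp: d_def algebra_simps)
    ultimately show ?case by simp
  qed
  define F where "F x = lim (\<lambda>j. expansion_upto deg e a (r j) x)" for x
  have F: "F \<in> borel_measurable M" unfolding F_def[abs_def] by measurable
  have "AE x in M. (\<lambda>j. expansion_upto deg e a (r j) x) \<longlonglongrightarrow> F x"
    using conv by eventually_elim (simp add: F_def convergent_LIMSEQ_iff)
  from fatou_limit[OF a r F this] show ?thesis by (rule that)
qed

end

section \<open>Lebesgue measure on products, and Gaussian integrals\<close>

lemma measurable_vec_lambda_PiM:
  "(\<lambda>f. \<chi> i. f i) \<in> measurable (\<Pi>\<^sub>M i\<in>(UNIV::'n::finite set). (lborel :: 'a::euclidean_space measure)) (borel :: ('a^'n) measure)"
proof -
  have "(\<lambda>f. (\<chi> i. f i) \<bullet> b) \<in> borel_measurable (\<Pi>\<^sub>M i\<in>(UNIV::'n::finite set). (lborel :: 'a measure))"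
    if B: "b \<in> Basis" for b :: "'a^'n"
  proof -
    obtain i and u :: 'a where b: "b = axis i u" using B unfolding Basis_vec_def by blast
    show ?thesis unfolding b inner_axis by simp
  qed
  then show ?thesis by (subst borel_measurable_euclidean_space) auto
qed

lemma prod_Basis_vec:
  "(\<Prod>b\<in>(Basis :: ('a::euclidean_space^'n) set). f b) = (\<Prod>i\<in>UNIV. \<Prod>u\<in>Basis. f (axis i u))"
proof -
  have "(Basis :: ('a^'n) set) = (\<Union>i\<in>UNIV. axis i ` Basis)"
    by (auto simp: Basis_vec_def)
  also have "prod f \<dots> = (\<Prod>i\<in>UNIV. prod f (axis i ` Basis))"
    by (rule prod.UNION_disjoint) (auto simp: axis_eq_axis)
  also have "\<dots> = (\<Prod>i\<in>UNIV. \<Prod>u\<in>Basis. f (axis i u))"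
    by (intro prod.cong refl, subst prod.reindex) (auto simp: inj_on_def axis_eq_axis)
  finally show ?thesis .
qed

text \<open>Lebesgue measure on \<open>\<real>\<^sup>n\<close> and \<open>\<complex>\<^sup>n\<close> as a product measure over the coordinates; it reduces the
  orthogonality relations to one dimension.\<close>

lemma lborel_vec:
  "(lborel :: ('a::euclidean_space^'n) measure) =
     distr (\<Pi>\<^sub>M i\<in>UNIV. (lborel :: 'a measure)) borel (\<lambda>f. \<chi> i. f i)"
proof (rule lborel_eqI)
  interpret P: product_sigma_finite "\<lambda>i::'n. lborel :: 'a measure" by standard
  fix l u :: "'a^'n" assume le: "\<And>b. b \<in> Basis \<Longrightarrow> l \<bullet> b \<le> u \<bullet> b"
  have le': "l $ i \<bullet> b \<le> u $ i \<bullet> b" if "b \<in> Basis" for i b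
    using le[of "axis i b"] that by (simp add: inner_axis)
  have "emeasure (distr (\<Pi>\<^sub>M i\<in>UNIV. lborel) borel (\<lambda>f. \<chi> i. f i)) (box l u) =
      emeasure (\<Pi>\<^sub>M i\<in>UNIV. lborel) ((\<lambda>f. \<chi> i. f i) -` box l u \<inter> space (\<Pi>\<^sub>M i\<in>(UNIV::'n set). (lborel :: 'a measure)))"
    by (rule emeasure_distr[OF measurable_vec_lambda_PiM]) auto
  also have "(\<lambda>f. \<chi> i. f i) -` box l u \<inter> space (\<Pi>\<^sub>M i\<in>(UNIV::'n set). (lborel :: 'a measure)) =
      Pi\<^sub>E UNIV (\<lambda>i. box (l $ i) (u $ i))"
    by (fastforce simp: space_PiM box_def Basis_vec_def inner_axis PiE_iff extensional_def)
  also have "emeasure (\<Pi>\<^sub>M i\<in>UNIV. lborel) \<dots> = (\<Prod>i\<in>UNIV. emeasure lborel (box (l $ i) (u $ i)))"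
    by (rule P.emeasure_PiM) auto
  also have "\<dots> = (\<Prod>i\<in>UNIV. ennreal (\<Prod>b\<in>Basis. (u $ i - l $ i) \<bullet> b))"
    using le' by (intro prod.cong refl emeasure_lborel_box) auto
  also have "\<dots> = ennreal (\<Prod>i\<in>UNIV. \<Prod>b\<in>Basis. (u $ i - l $ i) \<bullet> b)"
    using le' by (intro prod_ennreal prod_nonneg) (auto simp: inner_diff_left)
  also have "(\<Prod>i\<in>UNIV. \<Prod>b\<in>Basis. (u $ i - l $ i) \<bullet> b) = (\<Prod>b\<in>Basis. (u - l) \<bullet> b)"
    by (simp add: prod_Basis_vec inner_axis)
  finally show "emeasure (distr (\<Pi>\<^sub>M i\<in>UNIV. lborel) borel (\<lambda>f. \<chi> i. f i)) (box l u) =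
      ennreal (\<Prod>b\<in>Basis. (u - l) \<bullet> b)" .
qed simp

lemma emeasure_lborel_vec:
  fixes A :: "'n::finite \<Rightarrow> 'a::euclidean_space set"
  assumes "\<And>i. A i \<in> sets borel"
  shows "emeasure lborel {z :: 'a^'n. \<forall>i. z $ i \<in> A i} = (\<Prod>i\<in>UNIV. emeasure lborel (A i))"
proof -
  interpret P: product_sigma_finite "\<lambda>i::'n. lborel :: 'a measure" by standard
  have "(\<lambda>z::'a^'n. z $ i) \<in> borel_measurable borel" for i
    by (intro borel_measurable_continuous_onI continuous_intros)
  from measurable_sets[OF this assms] have "{z :: 'a^'n. z $ i \<in> A i} \<in> sets borel" for i
    by (auto simp: vimage_def)
  then have m: "{z :: 'a^'n. \<forall>i. z $ i \<in> A i} \<in> sets borel"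
    by (simp add: Collect_all_eq sets.countable_INT'')
  have "emeasure lborel {z :: 'a^'n. \<forall>i. z $ i \<in> A i} =
      emeasure (\<Pi>\<^sub>M i\<in>UNIV. lborel) ((\<lambda>f. \<chi> i. f i) -` {z :: 'a^'n. \<forall>i. z $ i \<in> A i} \<inter> space (\<Pi>\<^sub>M i\<in>(UNIV::'n set). (lborel :: 'a measure)))"
    by (subst lborel_vec, rule emeasure_distr[OF measurable_vec_lambda_PiM m])
  also have "(\<lambda>f. \<chi> i. f i) -` {z :: 'a^'n. \<forall>i. z $ i \<in> A i} \<inter> space (\<Pi>\<^sub>M i\<in>(UNIV::'n set). (lborel :: 'a measure))
      = Pi\<^sub>E UNIV A"
    by (auto simp: space_PiM PiE_iff)
  also have "emeasure (\<Pi>\<^sub>M i\<in>UNIV. lborel) \<dots> = (\<Prod>i\<in>UNIV. emeasure lborel (A i))"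
    using assms by (intro P.emeasure_PiM) auto
  finally show ?thesis .
qed

lemma integral_lborel_vec_prod:
  fixes f :: "'n::finite \<Rightarrow> 'a::euclidean_space \<Rightarrow> complex"
  assumes "\<And>i. integrable lborel (f i)"
  shows "(LINT x|lborel. (\<Prod>i\<in>UNIV. f i ((x :: 'a^'n) $ i))) = (\<Prod>i\<in>UNIV. LINT x|lborel. f i x)"
proof -
  interpret P: product_sigma_finite "\<lambda>i::'n. lborel :: 'a measure" by standard
  have fm: "f i \<in> borel_measurable borel" for i using borel_measurable_integrable[OF assms[of i]] by simp
  have "(\<lambda>x::'a^'n. x $ i) \<in> borel_measurable borel" for i
    by (intro borel_measurable_continuous_onI continuous_intros)
  from measurable_compose[OF this fm]
  have m: "(\<lambda>x::'a^'n. \<Prod>i\<in>UNIV. f i (x $ i)) \<in> borel_measurable borel"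
    by (intro borel_measurable_prod) auto
  have "(LINT x|lborel. (\<Prod>i\<in>UNIV. f i ((x :: 'a^'n) $ i))) =
      (LINT x|(\<Pi>\<^sub>M i\<in>UNIV. lborel). (\<Prod>i\<in>UNIV. f i ((\<chi> i. x i :: 'a^'n) $ i)))"
    by (subst lborel_vec, rule integral_distr[OF measurable_vec_lambda_PiM m])
  also have "\<dots> = (\<Prod>i\<in>UNIV. LINT x|lborel. f i x)"
    using P.product_integral_prod[of UNIV f] assms by simp
  finally show ?thesis .
qed

lemma lborel_complex_vec2:
  "(lborel :: complex measure) = distr (lborel :: (real^2) measure) borel (\<lambda>v. Complex (v $ 1) (v $ 2))"
proof (rule lborel_eqI)
  have m: "(\<lambda>v::real^2. Complex (v $ 1) (v $ 2)) \<in> borel_measurable lborel"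
    by (auto intro!: borel_measurable_continuous_onI continuous_intros)
  fix l u :: complex assume le: "\<And>b. b \<in> Basis \<Longrightarrow> l \<bullet> b \<le> u \<bullet> b"
  have le': "Re l \<le> Re u" "Im l \<le> Im u" using le[of 1] le[of \<i>] by (auto simp: Basis_complex_def)
  have "emeasure (distr (lborel :: (real^2) measure) borel (\<lambda>v. Complex (v $ 1) (v $ 2))) (box l u) =
      emeasure lborel ((\<lambda>v::real^2. Complex (v $ 1) (v $ 2)) -` box l u)"
    using emeasure_distr[OF m, of "box l u"] by simp
  also have "(\<lambda>v::real^2. Complex (v $ 1) (v $ 2)) -` box l u =
     {v. \<forall>i. v $ i \<in> (if i = 1 then box (Re l) (Re u) else box (Im l) (Im u))}"
    by (auto simp: box_def Basis_complex_def forall_2)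
  also have "emeasure lborel \<dots> = ennreal (Re u - Re l) * ennreal (Im u - Im l)"
    using le' by (subst emeasure_lborel_vec) (auto simp: UNIV_2 box_real)
  also have "\<dots> = ennreal (\<Prod>b\<in>Basis. (u - l) \<bullet> b)"
    using le' by (auto simp: Basis_complex_def ennreal_mult)
  finally show "emeasure (distr (lborel :: (real^2) measure) borel (\<lambda>v. Complex (v $ 1) (v $ 2))) (box l u) =
     ennreal (\<Prod>b\<in>Basis. (u - l) \<bullet> b)" .
qed simp

lemma lborel_complex_prod:
  "(lborel :: complex measure) = distr (lborel \<Otimes>\<^sub>M lborel) borel (\<lambda>(x, y). Complex x y)"
proof (rule lborel_eqI)
  have m: "(\<lambda>(x, y). Complex x y) \<in> borel_measurable (lborel \<Otimes>\<^sub>M lborel)"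
    unfolding lborel_prod split_beta
    by (auto intro!: borel_measurable_continuous_onI continuous_intros)
  fix l u :: complex assume le: "\<And>b. b \<in> Basis \<Longrightarrow> l \<bullet> b \<le> u \<bullet> b"
  have le': "Re l \<le> Re u" "Im l \<le> Im u" using le[of 1] le[of \<i>] by (auto simp: Basis_complex_def)
  have "emeasure (distr (lborel \<Otimes>\<^sub>M lborel) borel (\<lambda>(x, y). Complex x y)) (box l u) =
      emeasure (lborel \<Otimes>\<^sub>M lborel) ((\<lambda>(x, y). Complex x y) -` box l u)"
    using emeasure_distr[OF m, of "box l u"] by (simp add: space_pair_measure)
  also have "(\<lambda>(x, y). Complex x y) -` box l u = {Re l<..<Re u} \<times> {Im l<..<Im u}"
    by (auto simp: box_def Basis_complex_def)
  also have "emeasure (lborel \<Otimes>\<^sub>M lborel) \<dots> = ennreal (Re u - Re l) * ennreal (Im u - Im l)"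
    using le' by (subst lborel.emeasure_pair_measure_Times) auto
  also have "\<dots> = ennreal (\<Prod>b\<in>Basis. (u - l) \<bullet> b)"
    using le' by (auto simp: Basis_complex_def ennreal_mult)
  finally show "emeasure (distr (lborel \<Otimes>\<^sub>M lborel) borel (\<lambda>(x, y). Complex x y)) (box l u) =
     ennreal (\<Prod>b\<in>Basis. (u - l) \<bullet> b)" .
qed simp

text \<open>Multiplication by a unimodular number is an orthogonal map of the real plane, so it preserves area.\<close>

lemma lborel_complex_rotate:
  assumes w: "cmod w = 1"
  shows "distr lborel borel (\<lambda>z::complex. w * z) = lborel"
proof (rule lborel_eqI[symmetric])
  have m: "(\<lambda>v::real^2. Complex (v $ 1) (v $ 2)) \<in> borel_measurable lborel"
    by (auto intro!: borel_measurable_continuous_onI continuous_intros)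
  have mw: "(\<lambda>z::complex. w * z) \<in> borel_measurable lborel" by simp
  define C where "C v = Complex (v $ 1) (v $ 2)" for v :: "real^2"
  define D where "D z = (vector [Re z, Im z] :: real^2)" for z
  have CD: "C (D z) = z" for z by (simp add: C_def D_def)
  have DC: "D (C v) = v" for v by (simp add: C_def D_def vec_eq_iff forall_2)
  have nD: "norm (D z) = cmod z" for z
    by (simp add: norm_vec_def L2_set_def UNIV_2 D_def cmod_def)
  define T where "T v = D (cnj w * C v)" for v
  have ww: "w * cnj w = 1" "cnj w * w = 1"
    using w complex_norm_square[of w] by (auto simp: mult.commute)
  have "linear D" by (rule linearI) (simp_all add: D_def vec_eq_iff forall_2)
  moreover have "linear C" by (rule linearI) (simp_all add: C_def complex_eq_iff)
  moreover have "linear (\<lambda>z. cnj w * z)" by (rule linearI) (simp_all add: distrib_left)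
  ultimately have "linear (D \<circ> ((\<lambda>z. cnj w * z) \<circ> C))" by (intro linear_compose)
  then have lin: "linear T" by (simp add: o_def T_def[abs_def])
  have "norm (T v) = norm v" for v
    using w nD[of "C v"] by (simp add: T_def nD norm_mult DC)
  then have orth: "orthogonal_transformation T"
    using lin by (simp add: orthogonal_transformation)
  fix l u :: complex assume le: "\<And>b. b \<in> Basis \<Longrightarrow> l \<bullet> b \<le> u \<bullet> b"
  let ?C = "\<lambda>v::real^2. Complex (v $ 1) (v $ 2)"
  let ?B = "?C -` box l u"
  have Bm: "?B \<in> sets borel" using measurable_sets[OF m, of "box l u"] by simp
  have eB: "emeasure lborel ?B = emeasure lborel (box l u)"
    by (subst lborel_complex_vec2, subst emeasure_distr[OF m]) auto
  have wm: "(\<lambda>z. w * z) -` box l u \<in> sets borel"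
    using measurable_sets[OF mw, of "box l u"] by simp
  have im: "?C -` ((\<lambda>z. w * z) -` box l u) = T ` ?B"
  proof (intro set_eqI iffI)
    fix v :: "real^2" assume "v \<in> ?C -` ((\<lambda>z. w * z) -` box l u)"
    then have "w * C v \<in> box l u" by (simp add: C_def)
    then have "C (D (w * C v)) \<in> box l u" unfolding CD .
    then have "D (w * C v) \<in> ?B" unfolding C_def by simp
    moreover have "T (D (w * C v)) = v"
      by (simp add: T_def CD mult.assoc[symmetric] ww DC)
    ultimately show "v \<in> T ` ?B" by (metis imageI)
  next
    fix v assume "v \<in> T ` ?B"
    then obtain v' where v': "v = T v'" "C v' \<in> box l u" unfolding C_def by auto
    have "w * C v = C v'" by (simp add: v'(1) T_def CD mult.assoc[symmetric] ww)
    then have "w * C v \<in> box l u" using v'(2) by simp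
    then show "v \<in> ?C -` ((\<lambda>z. w * z) -` box l u)" by (simp add: C_def)
  qed
  have fB: "?B \<in> lmeasurable"
    using Bm eB emeasure_lborel_box_finite[of l u] by (auto simp: fmeasurable_def)
  have mB: "T ` ?B \<in> sets borel"
    unfolding im[symmetric] using measurable_sets[OF m, of "(\<lambda>z. w * z) -` box l u"] wm by simp
  have "emeasure (distr lborel borel (\<lambda>z. w * z)) (box l u) = emeasure lborel ((\<lambda>z. w * z) -` box l u)"
    using emeasure_distr[OF mw, of "box l u"] by simp
  also have "\<dots> = emeasure lborel (?C -` ((\<lambda>z. w * z) -` box l u))"
    by (subst lborel_complex_vec2, subst emeasure_distr[OF m]) (use wm in auto)
  also have "\<dots> = emeasure lebesgue (T ` ?B)"
    unfolding im using mB by simp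
  also have "\<dots> = ennreal (measure lebesgue (T ` ?B))"
    by (rule emeasure_eq_measure2) (rule measurable_orthogonal_image[OF orth fB])
  also have "\<dots> = ennreal (measure lebesgue ?B)"
    by (simp add: measure_orthogonal_image[OF orth fB])
  also have "\<dots> = emeasure lebesgue ?B"
    by (rule emeasure_eq_measure2[symmetric]) (rule fB)
  also have "\<dots> = emeasure lborel (box l u)"
    using Bm eB by simp
  also have "\<dots> = ennreal (\<Prod>b\<in>Basis. (u - l) \<bullet> b)"
    using le by (rule emeasure_lborel_box)
  finally show "emeasure (distr lborel borel (\<lambda>z. w * z)) (box l u) = ennreal (\<Prod>b\<in>Basis. (u - l) \<bullet> b)" .
qed simp

text \<open>A common rotation of all coordinates maps products of planar sets to products of rotated ones.\<close>

lemma lborel_complex_vec_rotate: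
  assumes w: "cmod w = 1"
  shows "distr lborel borel (\<lambda>z::complex^'n. w *s z) = lborel"
proof (rule lborel_eqI[symmetric])
  have cont: "continuous_on UNIV (\<lambda>z::complex^'n. w *s z)"
    unfolding vector_scalar_mult_def by (intro continuous_intros)
  then have m: "(\<lambda>z::complex^'n. w *s z) \<in> borel_measurable lborel"
    using borel_measurable_continuous_onI by auto
  have mw: "(\<lambda>z::complex. w * z) \<in> borel_measurable lborel" by simp
  fix l u :: "complex^'n" assume le: "\<And>b. b \<in> Basis \<Longrightarrow> l \<bullet> b \<le> u \<bullet> b"
  have s: "(\<lambda>z. w * z) -` box (l $ i) (u $ i) \<in> sets borel" for i
    using measurable_sets[OF mw, of "box (l $ i) (u $ i)"] by simp
  have e: "emeasure lborel ((\<lambda>z. w * z) -` box (l $ i) (u $ i)) = emeasure lborel (box (l $ i) (u $ i))" for i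
    using emeasure_distr[OF mw, of "box (l $ i) (u $ i)"] by (simp add: lborel_complex_rotate[OF w])
  have b: "z \<in> box l u \<longleftrightarrow> (\<forall>i. z $ i \<in> box (l $ i) (u $ i))" for z :: "complex^'n"
    by (fastforce simp: box_def Basis_vec_def inner_axis)
  have "emeasure (distr lborel borel (\<lambda>z. w *s z)) (box l u) = emeasure lborel ((\<lambda>z. w *s z) -` box l u)"
    using emeasure_distr[OF m, of "box l u"] by simp
  also have "(\<lambda>z. w *s z) -` box l u = {z. \<forall>i. z $ i \<in> (\<lambda>z. w * z) -` box (l $ i) (u $ i)}"
    by (auto simp: b)
  also have "emeasure lborel \<dots> = emeasure lborel {z :: complex^'n. \<forall>i. z $ i \<in> box (l $ i) (u $ i)}"
    by (subst emeasure_lborel_vec[OF s], subst emeasure_lborel_vec) (simp_all only: e, simp)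
  also have "{z. \<forall>i. z $ i \<in> box (l $ i) (u $ i)} = box l u" using b by auto
  also have "emeasure lborel (box l u) = ennreal (\<Prod>b\<in>Basis. (u - l) \<bullet> b)"
    using le by (rule emeasure_lborel_box)
  finally show "emeasure (distr lborel borel (\<lambda>z. w *s z)) (box l u) = ennreal (\<Prod>b\<in>Basis. (u - l) \<bullet> b)" .
qed simp

lemma integrable_gaussian_real:
  assumes "c > 0" shows "integrable lborel (\<lambda>x::real. exp (- (c * x\<^sup>2)))"
proof -
  have "integrable lborel (\<lambda>x. sqrt (2 * pi * (1 / sqrt (2 * c))\<^sup>2) * normal_density 0 (1 / sqrt (2 * c)) x)"
    using assms by (intro integrable_mult_right integrable_normal_density) auto
  also have "(\<lambda>x. sqrt (2 * pi * (1 / sqrt (2 * c))\<^sup>2) * normal_density 0 (1 / sqrt (2 * c)) x) = (\<lambda>x. exp (- (c * x\<^sup>2)))"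
    using assms by (auto simp: normal_density_def field_simps)
  finally show ?thesis .
qed

lemma integral_gaussian_real: "(LINT x|lborel. exp (- (x::real)\<^sup>2)) = sqrt pi"
proof -
  have "(LINT x|lborel. sqrt pi * normal_density 0 (1 / sqrt 2) x) = sqrt pi"
    by (simp add: integral_normal_density)
  also have "(\<lambda>x. sqrt pi * normal_density 0 (1 / sqrt 2) x) = (\<lambda>x. exp (- x\<^sup>2))"
    by (auto simp: normal_density_def field_simps)
  finally show ?thesis .
qed

lemma integrable_gaussian:
  assumes c: "c > 0"
  shows "integrable lborel (\<lambda>x::'a::euclidean_space. exp (- (c * (norm x)\<^sup>2)))"
proof (rule integrableI_bounded)
  have "(norm x)\<^sup>2 = (\<Sum>b\<in>Basis. (x \<bullet> b)\<^sup>2)" for x :: 'a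
    by (simp add: norm_eq_sqrt_inner euclidean_inner[of x x] power2_eq_square sum_nonneg)
  then have "nn_integral lborel (\<lambda>x::'a. ennreal (norm (exp (- (c * (norm x)\<^sup>2))))) =
      nn_integral lborel (\<lambda>x::'a. \<Prod>b\<in>Basis. ennreal (exp (- (c * (x \<bullet> b)\<^sup>2))))"
    by (simp add: sum_distrib_left sum_negf[symmetric] exp_sum prod_ennreal abs_prod)
  also have "\<dots> = (\<Prod>b\<in>(Basis::'a set). nn_integral lborel (\<lambda>x::real. ennreal (exp (- (c * x\<^sup>2)))))"
    by (rule nn_integral_lborel_prod) auto
  also have "\<dots> < \<infinity>"
  proof -
    have "nn_integral lborel (\<lambda>x::real. ennreal (exp (- (c * x\<^sup>2)))) \<noteq> \<infinity>"
      using integrable_gaussian_real[OF c] by (simp add: real_integrable_def)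
    then show ?thesis by (simp add: less_top[symmetric] power_eq_top_ennreal)
  qed
  finally show "nn_integral lborel (\<lambda>x::'a. ennreal (norm (exp (- (c * (norm x)\<^sup>2))))) < \<infinity>" .
qed simp

lemma quadratic_exponent_le:
  fixes B c r :: real assumes "c > 0"
  shows "B * r - c * r\<^sup>2 \<le> B\<^sup>2 / (2 * c) - (c / 2) * r\<^sup>2"
proof -
  have "0 \<le> (c / 2) * (r - B / c)\<^sup>2" using assms by simp
  also have "\<dots> = (c / 2) * r\<^sup>2 - B * r + B\<^sup>2 / (2 * c)"
    using assms by (simp add: power2_eq_square field_simps)
  finally show ?thesis by (simp add: field_simps)
qed

text \<open>The integrability test used throughout: a Gaussian absorbs a factor of exponential growth.\<close>

lemma integrable_gaussian_bound:
  fixes f :: "'a::euclidean_space \<Rightarrow> 'b::{banach,second_countable_topology}"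
  assumes f: "f \<in> borel_measurable borel" and c: "c > 0"
    and bd: "\<And>x. norm (f x) \<le> C * exp (B * norm x - c * (norm x)\<^sup>2)"
  shows "integrable lborel f"
proof (rule Bochner_Integration.integrable_bound)
  show "integrable lborel (\<lambda>x::'a. \<bar>C\<bar> * exp (B\<^sup>2 / (2 * c)) * exp (- ((c / 2) * (norm x)\<^sup>2)))"
    using c by (intro integrable_mult_right integrable_gaussian) auto
  show "f \<in> borel_measurable lborel" using f by simp
  have "norm (f x) \<le> \<bar>C\<bar> * exp (B\<^sup>2 / (2 * c)) * exp (- ((c / 2) * (norm x)\<^sup>2))" for x
  proof -
    have "norm (f x) \<le> \<bar>C\<bar> * exp (B * norm x - c * (norm x)\<^sup>2)"
      using bd[of x] by (meson abs_ge_self exp_ge_zero mult_right_mono order_trans)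
    also have "\<dots> \<le> \<bar>C\<bar> * exp (B\<^sup>2 / (2 * c) - (c / 2) * (norm x)\<^sup>2)"
      using quadratic_exponent_le[OF c, of B "norm x"] by (intro mult_left_mono) auto
    also have "\<dots> = \<bar>C\<bar> * exp (B\<^sup>2 / (2 * c)) * exp (- ((c / 2) * (norm x)\<^sup>2))"
      by (simp only: mult.assoc exp_add[symmetric] diff_conv_add_uminus)
    finally show ?thesis .
  qed
  then show "AE x in lborel. norm (f x) \<le> norm (\<bar>C\<bar> * exp (B\<^sup>2 / (2 * c)) * exp (- ((c / 2) * (norm x)\<^sup>2)))"
    by (intro AE_I2) auto
qed

lemma gaussian_bound_tendsto_0:
  fixes F :: "real \<Rightarrow> complex"
  assumes c: "c > 0" and bd: "\<And>x. norm (F x) \<le> C * exp (B * \<bar>x\<bar> - c * x\<^sup>2)"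
  shows "(F \<longlongrightarrow> 0) at_top" "(F \<longlongrightarrow> 0) at_bot"
proof -
  have bd': "norm (F x) \<le> \<bar>C\<bar> * exp (B\<^sup>2 / (2 * c)) * exp (- (c / 2) * x\<^sup>2)" for x
  proof -
    have "norm (F x) \<le> \<bar>C\<bar> * exp (B * \<bar>x\<bar> - c * x\<^sup>2)"
      using bd[of x] by (meson abs_ge_self exp_ge_zero mult_right_mono order_trans)
    also have "\<dots> \<le> \<bar>C\<bar> * exp (B\<^sup>2 / (2 * c) - (c / 2) * \<bar>x\<bar>\<^sup>2)"
      using quadratic_exponent_le[OF c, of B "\<bar>x\<bar>"] by (intro mult_left_mono) auto
    also have "\<dots> = \<bar>C\<bar> * exp (B\<^sup>2 / (2 * c)) * exp (- (c / 2) * x\<^sup>2)"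
      by (simp only: mult.assoc exp_add[symmetric] diff_conv_add_uminus power2_abs mult_minus_left)
    finally show ?thesis .
  qed
  have 1: "((\<lambda>x::real. exp (- (c / 2) * x\<^sup>2)) \<longlongrightarrow> 0) at_top" using c by real_asymp
  have 2: "((\<lambda>x::real. exp (- (c / 2) * x\<^sup>2)) \<longlongrightarrow> 0) at_bot" using c by real_asymp
  show "(F \<longlongrightarrow> 0) at_top"
    by (rule Lim_null_comparison[OF always_eventually[OF allI, OF bd'] tendsto_mult_right_zero[OF 1]])
  show "(F \<longlongrightarrow> 0) at_bot"
    by (rule Lim_null_comparison[OF always_eventually[OF allI, OF bd'] tendsto_mult_right_zero[OF 2]])
qed

text \<open>Integration by parts without boundary terms; the Gaussian bound makes them vanish.\<close>

lemma integral_derivative_eq_0: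
  fixes F f :: "real \<Rightarrow> complex"
  assumes c: "c > 0"
    and F: "\<And>x. norm (F x) \<le> C * exp (B * \<bar>x\<bar> - c * x\<^sup>2)"
    and f: "\<And>x. norm (f x) \<le> C' * exp (B' * \<bar>x\<bar> - c * x\<^sup>2)"
    and deriv: "\<And>x. (F has_vector_derivative f x) (at x)"
    and cont: "continuous_on UNIV f"
  shows "(LINT x|lborel. f x) = 0"
proof -
  have int: "integrable lborel f"
    using cont f c by (intro integrable_gaussian_bound[of f c C' B'] borel_measurable_continuous_onI) auto
  have "(LBINT x=-\<infinity>..\<infinity>. f x) = 0 - 0"
  proof (rule interval_integral_FTC_integrable)
    show "((F \<circ> real_of_ereal) \<longlongrightarrow> 0) (at_right (-\<infinity>))" "((F \<circ> real_of_ereal) \<longlongrightarrow> 0) (at_left \<infinity>)"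
      using gaussian_bound_tendsto_0[OF c F] by (simp_all add: ereal_tendsto_simps)
    show "set_integrable lborel (einterval (- \<infinity>) \<infinity>) f"
      using int by (simp add: set_integrable_def einterval_eq)
    show "isCont f x" for x using cont by (simp add: continuous_on_eq_continuous_at)
  qed (use deriv in auto)
  then show ?thesis
    by (simp add: interval_integral_eq_integral' interval_lebesgue_integral_def einterval_eq set_lebesgue_integral_def)
qed

lemma integral_complex_pair:
  fixes f :: "complex \<Rightarrow> complex"
  assumes f: "integrable lborel f"
  shows "(LINT z|lborel. f z) = (LINT y|lborel. LINT x|lborel. f (Complex x y))"
    and "(LINT z|lborel. f z) = (LINT x|lborel. LINT y|lborel. f (Complex x y))"
proof -
  have m: "(\<lambda>(x, y). Complex x y) \<in> measurable (lborel \<Otimes>\<^sub>M lborel) borel"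
    unfolding lborel_prod split_beta
    by (auto intro!: borel_measurable_continuous_onI continuous_intros)
  have fm: "f \<in> borel_measurable borel" using borel_measurable_integrable[OF f] by simp
  have "integrable (distr (lborel \<Otimes>\<^sub>M lborel) borel (\<lambda>(x, y). Complex x y)) f"
    using f lborel_complex_prod by simp
  then have i: "integrable (lborel \<Otimes>\<^sub>M lborel) (\<lambda>(x, y). f (Complex x y))"
    by (subst (asm) integrable_distr_eq[OF m fm]) (simp add: case_prod_unfold)
  have e: "(LINT z|lborel. f z) = (LINT p|(lborel \<Otimes>\<^sub>M lborel). (\<lambda>(x, y). f (Complex x y)) p)"
    by (subst lborel_complex_prod, subst integral_distr[OF m fm]) (simp add: case_prod_unfold)
  show "(LINT z|lborel. f z) = (LINT y|lborel. LINT x|lborel. f (Complex x y))"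
    unfolding e using lborel_pair.integral_snd[OF i] by simp
  show "(LINT z|lborel. f z) = (LINT x|lborel. LINT y|lborel. f (Complex x y))"
    unfolding e using lborel_pair.integral_fst'[OF i] by simp
qed

text \<open>The same in the plane, for the derivative in the real and in the imaginary direction: integrate
  in that direction first.\<close>

lemma integral_complex_partial_eq_0:
  fixes F f g :: "complex \<Rightarrow> complex"
  assumes c: "c > 0" and B: "B \<ge> 0" "C \<ge> 0" and B': "B' \<ge> 0" "C' \<ge> 0"
    and F: "\<And>z. norm (F z) \<le> C * exp (B * norm z - c * (norm z)\<^sup>2)"
    and f: "\<And>z. norm (f z) \<le> C' * exp (B' * norm z - c * (norm z)\<^sup>2)"
    and cont: "continuous_on UNIV f"
  shows "(\<And>x y. ((\<lambda>x. F (Complex x y)) has_vector_derivative f (Complex x y)) (at x)) \<Longrightarrow> (LINT z|lborel. f z) = 0"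
    and "(\<And>x y. ((\<lambda>y. F (Complex x y)) has_vector_derivative f (Complex x y)) (at y)) \<Longrightarrow> (LINT z|lborel. f z) = 0"
proof -
  have int: "integrable lborel f"
    using cont f c by (intro integrable_gaussian_bound[of f c C' B'] borel_measurable_continuous_onI) auto
  have aux: "D * exp (E * norm (Complex x y) - c * (norm (Complex x y))\<^sup>2) \<le> (D * exp (E * \<bar>y\<bar>)) * exp (E * \<bar>x\<bar> - c * x\<^sup>2)"
    "D * exp (E * norm (Complex x y) - c * (norm (Complex x y))\<^sup>2) \<le> (D * exp (E * \<bar>x\<bar>)) * exp (E * \<bar>y\<bar> - c * y\<^sup>2)"
    if "D \<ge> 0" "E \<ge> 0" for D E x y
  proof -
    have "E * norm (Complex x y) \<le> E * (\<bar>x\<bar> + \<bar>y\<bar>)"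
      using cmod_le[of "Complex x y"] that by (intro mult_left_mono) auto
    moreover have "c * (norm (Complex x y))\<^sup>2 \<ge> c * x\<^sup>2" "c * (norm (Complex x y))\<^sup>2 \<ge> c * y\<^sup>2"
      using c by (auto simp: cmod_power2)
    ultimately show "D * exp (E * norm (Complex x y) - c * (norm (Complex x y))\<^sup>2) \<le> (D * exp (E * \<bar>y\<bar>)) * exp (E * \<bar>x\<bar> - c * x\<^sup>2)"
      "D * exp (E * norm (Complex x y) - c * (norm (Complex x y))\<^sup>2) \<le> (D * exp (E * \<bar>x\<bar>)) * exp (E * \<bar>y\<bar> - c * y\<^sup>2)"
      using that unfolding mult.assoc exp_add[symmetric] by (intro mult_left_mono; simp add: algebra_simps)+
  qed
  have cx: "continuous_on UNIV (\<lambda>x. f (Complex x y))" "continuous_on UNIV (\<lambda>x. f (Complex y x))" for y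
    by (rule continuous_on_compose2[OF cont]; auto intro!: continuous_intros)+
  {
    assume d: "\<And>x y. ((\<lambda>x. F (Complex x y)) has_vector_derivative f (Complex x y)) (at x)"
    have "(LINT x|lborel. f (Complex x y)) = 0" for y
      by (rule integral_derivative_eq_0[OF c _ _ d cx(1)])
         (rule order_trans[OF F aux(1)[OF B(2,1)]] order_trans[OF f aux(1)[OF B'(2,1)]])+
    then show "(LINT z|lborel. f z) = 0" unfolding integral_complex_pair(1)[OF int] by simp
  }
  {
    assume d: "\<And>x y. ((\<lambda>y. F (Complex x y)) has_vector_derivative f (Complex x y)) (at y)"
    have "(LINT y|lborel. f (Complex x y)) = 0" for x
      by (rule integral_derivative_eq_0[OF c _ _ d cx(2)])
         (rule order_trans[OF F aux(2)[OF B(2,1)]] order_trans[OF f aux(2)[OF B'(2,1)]])+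
    then show "(LINT z|lborel. f z) = 0" unfolding integral_complex_pair(2)[OF int] by simp
  }
qed

section \<open>Hermite functions of complex arguments\<close>

text \<open>The physicists' Hermite polynomials \<open>H\<^sub>k\<close>, polymorphic so that real and complex arguments are covered.\<close>

fun hermite_poly :: "nat \<Rightarrow> 'a::real_normed_field \<Rightarrow> 'a" where
  "hermite_poly 0 z = 1"
| "hermite_poly (Suc 0) z = 2 * z"
| "hermite_poly (Suc (Suc k)) z = 2 * z * hermite_poly (Suc k) z - 2 * of_nat (Suc k) * hermite_poly k z"

lemma hermite_poly_Suc: "hermite_poly (Suc k) z = 2 * z * hermite_poly k z - 2 * of_nat k * hermite_poly (k - 1) z"
  by (cases k) auto

lemma hermite_poly_of_real: "hermite_poly k (of_real x :: 'a::real_normed_field) = of_real (hermite_poly k x)"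
  by (induction k x rule: hermite_poly.induct) simp_all

lemma DERIV_hermite_poly: "(hermite_poly k has_field_derivative 2 * of_nat k * hermite_poly (k - 1) z) (at z)"
proof (induction k z rule: hermite_poly.induct)
  case (1 z)
  then show ?case by simp
next
  case (2 z)
  then show ?case by (auto intro!: derivative_eq_intros)
next
  case (3 k z)
  have "((\<lambda>z. 2 * z * hermite_poly (Suc k) z - 2 * of_nat (Suc k) * hermite_poly k z) has_field_derivative
      2 * hermite_poly (Suc k) z + 2 * z * (2 * of_nat (Suc k) * hermite_poly k z) - 2 * of_nat (Suc k) * (2 * of_nat k * hermite_poly (k - 1) z)) (at z)"
    using 3 by (auto intro!: derivative_eq_intros)
  also have "2 * hermite_poly (Suc k) z + 2 * z * (2 * of_nat (Suc k) * hermite_poly k z) - 2 * of_nat (Suc k) * (2 * of_nat k * hermite_poly (k - 1) z)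
      = 2 * of_nat (Suc (Suc k)) * hermite_poly (Suc k) z"
    by (simp add: hermite_poly_Suc[of k z] algebra_simps)
  finally show ?case by (simp add: fun_eq_iff[symmetric] hermite_poly.simps(3)[abs_def])
qed

lemma continuous_on_hermite_poly [continuous_intros]:
  "continuous_on S f \<Longrightarrow> continuous_on S (\<lambda>x. hermite_poly k (f x))"
  by (rule continuous_on_compose2[of UNIV "hermite_poly k"])
     (auto intro!: DERIV_continuous_on DERIV_subset[OF DERIV_hermite_poly])

lemma rodrigues: "(deriv ^^ k) (\<lambda>u::real. exp (- u\<^sup>2)) = (\<lambda>x. (- 1) ^ k * hermite_poly k x * exp (- x\<^sup>2))"
proof (induction k)
  case (Suc k)
  have "deriv (\<lambda>x::real. (- 1) ^ k * hermite_poly k x * exp (- x\<^sup>2)) x = (- 1) ^ Suc k * hermite_poly (Suc k) x * exp (- x\<^sup>2)" for x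
  proof (rule DERIV_imp_deriv)
    show "((\<lambda>x::real. (- 1) ^ k * hermite_poly k x * exp (- x\<^sup>2)) has_real_derivative
       (- 1) ^ Suc k * hermite_poly (Suc k) x * exp (- x\<^sup>2)) (at x)"
      by (auto intro!: derivative_eq_intros DERIV_hermite_poly simp: hermite_poly_Suc[of k x] algebra_simps)
  qed
  then show ?case by (simp only: funpow.simps o_def Suc)
qed simp

definition hermite_const :: "nat \<Rightarrow> real" where
  "hermite_const k = 1 / sqrt (2 ^ k * fact k * sqrt pi)"

text \<open>The entire extension of the normalised Hermite function of degree \<open>k\<close>.\<close>

definition hermite_ext :: "nat \<Rightarrow> complex \<Rightarrow> complex" where
  "hermite_ext k z = of_real (hermite_const k) * hermite_poly k z * exp (- z\<^sup>2 / 2)"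

lemma hermite_const_pos: "hermite_const k > 0"
  by (simp add: hermite_const_def)

lemma hermite_const_Suc: "hermite_const (Suc k) = hermite_const k / sqrt (2 * real (Suc k))"
proof -
  have "2 ^ Suc k * fact (Suc k) * sqrt pi = (2 ^ k * fact k * sqrt pi) * (2 * real (Suc k))"
    by (simp add: algebra_simps)
  then show ?thesis
    unfolding hermite_const_def by (simp only: real_sqrt_mult[of "2 ^ k * fact k * sqrt pi"]) simp
qed

lemma hermite_fun_eq: "of_real (hermite_fun k x) = hermite_ext k (of_real x)"
proof -
  have "hermite_fun k x = ((- 1) ^ k * (- 1) ^ k) * (exp (x\<^sup>2 / 2) * exp (- x\<^sup>2)) * hermite_poly k x * hermite_const k"
    by (simp add: hermite_fun_def rodrigues hermite_const_def)
  also have "(- 1 :: real) ^ k * (- 1) ^ k = 1" by (simp add: power_mult_distrib[symmetric])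
  also have "exp (x\<^sup>2 / 2) * exp (- x\<^sup>2) = exp (- x\<^sup>2 / 2)" by (simp add: exp_add[symmetric])
  finally show ?thesis
    by (simp add: hermite_ext_def hermite_poly_of_real exp_of_real[symmetric])
qed

lemma hermite_ext_Suc:
  "hermite_ext (Suc k) z = of_real (sqrt (2 / real (Suc k))) * z * hermite_ext k z - of_real (sqrt (real k / real (Suc k))) * hermite_ext (k - 1) z"
proof -
  have 1: "hermite_const (Suc k) * 2 = hermite_const k * sqrt (2 / real (Suc k))"
  proof -
    have "2 = sqrt 2 * sqrt (2::real)" by simp
    then show ?thesis unfolding hermite_const_Suc real_sqrt_mult real_sqrt_divide by (simp add: field_simps)
  qed
  have 2: "hermite_const (Suc k) * (2 * real k) = hermite_const (k - 1) * sqrt (real k / real (Suc k))"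
  proof (cases k)
    case (Suc j)
    have "2 * real (Suc j) = sqrt (2 * real (Suc j)) * sqrt (2 * real (Suc j))" by simp
    then have "hermite_const (Suc (Suc j)) * (2 * real (Suc j)) = hermite_const j * sqrt (2 * real (Suc j)) / sqrt (2 * real (Suc (Suc j)))"
      unfolding hermite_const_Suc by (simp add: field_simps del: of_nat_Suc)
    moreover have "sqrt (2 * real (Suc j)) / sqrt (2 * real (Suc (Suc j))) = sqrt (real (Suc j) / real (Suc (Suc j)))"
      unfolding real_sqrt_divide[symmetric] by (rule arg_cong[where f = sqrt]) (simp add: field_simps)
    ultimately show ?thesis unfolding Suc
      by (simp only: diff_Suc_1 times_divide_eq_right[symmetric])
  qed simp
  have "hermite_ext (Suc k) z = of_real (hermite_const (Suc k) * 2) * z * hermite_poly k z * exp (- z\<^sup>2 / 2)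
     - of_real (hermite_const (Suc k) * (2 * real k)) * hermite_poly (k - 1) z * exp (- z\<^sup>2 / 2)"
    by (simp add: hermite_ext_def hermite_poly_Suc algebra_simps)
  then show ?thesis unfolding 1 2 by (simp add: hermite_ext_def algebra_simps)
qed

definition hermite_ext_deriv :: "nat \<Rightarrow> complex \<Rightarrow> complex" where
  "hermite_ext_deriv k z = of_real (sqrt (2 * real k)) * hermite_ext (k - 1) z - z * hermite_ext k z"

lemma DERIV_hermite_ext: "(hermite_ext k has_field_derivative hermite_ext_deriv k z) (at z)"
proof -
  have 1: "hermite_const k * (2 * real k) = hermite_const (k - 1) * sqrt (2 * real k)"
  proof (cases k)
    case (Suc j)
    have "2 * real (Suc j) = sqrt (2 * real (Suc j)) * sqrt (2 * real (Suc j))" by simp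
    then show ?thesis unfolding Suc hermite_const_Suc by (simp add: field_simps del: of_nat_Suc)
  qed simp
  have "(hermite_ext k has_field_derivative
      of_real (hermite_const k * (2 * real k)) * hermite_poly (k - 1) z * exp (- z\<^sup>2 / 2) - z * hermite_ext k z) (at z)"
    unfolding hermite_ext_def[abs_def]
    by (auto intro!: derivative_eq_intros DERIV_hermite_poly simp: algebra_simps)
  then show ?thesis unfolding 1 hermite_ext_deriv_def by (simp add: hermite_ext_def algebra_simps)
qed

lemma continuous_on_hermite_ext [continuous_intros]:
  "continuous_on S f \<Longrightarrow> continuous_on S (\<lambda>x. hermite_ext k (f x))"
  by (rule continuous_on_compose2[of UNIV "hermite_ext k"])
     (auto intro!: DERIV_continuous_on DERIV_subset[OF DERIV_hermite_ext])

lemma sum_inverse_sqrt_le: "(\<Sum>j<k. 1 / sqrt (real (Suc j))) \<le> 2 * sqrt (real k)"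
proof (induction k)
  case (Suc k)
  have "1 / sqrt (real (Suc k)) \<le> 2 * (sqrt (real (Suc k)) - sqrt (real k))"
  proof -
    have "(sqrt (real (Suc k)) - sqrt (real k)) * (sqrt (real (Suc k)) + sqrt (real k)) = 1"
      by (simp add: algebra_simps)
    moreover have "(sqrt (real (Suc k)) - sqrt (real k)) * (sqrt (real (Suc k)) + sqrt (real k))
        \<le> (sqrt (real (Suc k)) - sqrt (real k)) * (2 * sqrt (real (Suc k)))"
      by (intro mult_left_mono) auto
    ultimately have "1 \<le> (2 * (sqrt (real (Suc k)) - sqrt (real k))) * sqrt (real (Suc k))"
      by (simp add: algebra_simps)
    then show ?thesis by (subst pos_divide_le_eq) auto
  qed
  then show ?case using Suc by simp
qed simp

text \<open>The normalised recurrence bounds the function of degree \<open>k + 1\<close> by \<open>1 + \<surd>2 R / \<surd>(k + 1)\<close> times a bound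
  for the two preceding ones. These factors multiply to \<open>e^(O(\<surd>k))\<close>, which is weaker than any
  exponential in \<open>k\<close>.\<close>

lemma hermite_ext_bound:
  assumes z: "cmod z \<le> R"
  shows "cmod (hermite_ext k z) \<le> hermite_const 0 * exp (R\<^sup>2 / 2) * exp (2 * sqrt 2 * R * sqrt (real k))"
proof -
  have R: "0 \<le> R" using z norm_ge_zero order_trans by blast
  define A where "A = hermite_const 0 * exp (R\<^sup>2 / 2)"
  have A: "A > 0" using hermite_const_pos by (simp add: A_def)
  define b where "b k = A * (\<Prod>j<k. 1 + sqrt 2 * R / sqrt (real (Suc j)))" for k
  have b_Suc: "b (Suc k) = (1 + sqrt 2 * R / sqrt (real (Suc k))) * b k" for k
    by (simp add: b_def)
  have b0: "0 \<le> b k" for k using A R unfolding b_def by (intro mult_nonneg_nonneg prod_nonneg) auto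
  have mono: "b k \<le> b (Suc k)" for k
    unfolding b_Suc using b0[of k] R by (simp add: distrib_right)
  have "cmod (hermite_ext k z) \<le> b k \<and> cmod (hermite_ext (k - 1) z) \<le> b k"
  proof (induction k)
    case 0
    have "cmod (z\<^sup>2) \<le> R\<^sup>2" using z by (simp add: norm_power power_mono)
    then have "- Re (z\<^sup>2) \<le> R\<^sup>2" using abs_Re_le_cmod[of "z\<^sup>2"] by linarith
    then have "cmod (hermite_ext 0 z) \<le> A"
      using hermite_const_pos[of 0] by (simp add: hermite_ext_def norm_mult A_def)
    then show ?case by (simp add: b_def)
  next
    case (Suc k)
    have "cmod (hermite_ext (Suc k) z) \<le> sqrt (2 / real (Suc k)) * cmod z * cmod (hermite_ext k z) + sqrt (real k / real (Suc k)) * cmod (hermite_ext (k - 1) z)"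
      unfolding hermite_ext_Suc by (rule order_trans[OF norm_triangle_ineq4]) (simp add: norm_mult)
    also have "\<dots> \<le> sqrt (2 / real (Suc k)) * R * b k + 1 * b k"
      using Suc z R b0 by (intro add_mono mult_mono) auto
    also have "\<dots> = b (Suc k)"
      unfolding b_Suc by (simp add: real_sqrt_divide algebra_simps)
    finally show ?case using Suc mono[of k] by simp
  qed
  then have "cmod (hermite_ext k z) \<le> b k" by simp
  also have "\<dots> \<le> A * exp (2 * sqrt 2 * R * sqrt (real k))"
  proof -
    have "(\<Prod>j<k. 1 + sqrt 2 * R / sqrt (real (Suc j))) \<le> (\<Prod>j<k. exp (sqrt 2 * R / sqrt (real (Suc j))))"
      using R by (intro prod_mono) (auto intro!: exp_ge_add_one_self)
    also have "\<dots> = exp (sqrt 2 * R * (\<Sum>j<k. 1 / sqrt (real (Suc j))))"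
      by (simp add: exp_sum sum_distrib_left)
    also have "\<dots> \<le> exp (sqrt 2 * R * (2 * sqrt (real k)))"
      using R sum_inverse_sqrt_le[of k] by (auto intro!: mult_left_mono)
    finally show ?thesis unfolding b_def using A by (simp add: mult_ac)
  qed
  finally show ?thesis by (simp add: A_def)
qed

text \<open>Growth below every exponential in the degree, uniformly on a set. This class is closed under sums,
  products and polynomial factors in the degree, and its members are absorbed by \<open>e^(- \<lambda>\<^sub>k \<rho>)\<close>.\<close>

definition subexp_on :: "'b set \<Rightarrow> ('i \<Rightarrow> nat) \<Rightarrow> ('i \<Rightarrow> 'b \<Rightarrow> complex) \<Rightarrow> bool" where
  "subexp_on S deg p \<longleftrightarrow> (\<forall>\<delta>>0. \<exists>C. \<forall>k. \<forall>z\<in>S. cmod (p k z) \<le> C * exp (\<delta> * real (deg k)))"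

lemma subexp_onE:
  assumes "subexp_on S deg p" "\<delta> > 0"
  obtains C where "C > 0" "\<And>k z. z \<in> S \<Longrightarrow> cmod (p k z) \<le> C * exp (\<delta> * real (deg k))"
proof -
  obtain C where C: "\<And>k z. z \<in> S \<Longrightarrow> cmod (p k z) \<le> C * exp (\<delta> * real (deg k))"
    using assms unfolding subexp_on_def by blast
  have "cmod (p k z) \<le> (\<bar>C\<bar> + 1) * exp (\<delta> * real (deg k))" if "z \<in> S" for k z
    by (rule order_trans[OF C[OF that]]) (auto intro!: mult_right_mono)
  then show ?thesis by (intro that[of "\<bar>C\<bar> + 1"]) auto
qed

lemma subexp_on_mult:
  assumes "subexp_on S deg p" "subexp_on S deg q"
  shows "subexp_on S deg (\<lambda>k z. p k z * q k z)"
  unfolding subexp_on_def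
proof (intro allI impI)
  fix \<delta> :: real assume "\<delta> > 0"
  then have d: "\<delta> / 2 > 0" by simp
  obtain C where C: "C > 0" "\<And>k z. z \<in> S \<Longrightarrow> cmod (p k z) \<le> C * exp (\<delta> / 2 * real (deg k))"
    using subexp_onE[OF assms(1) d] by blast
  obtain D where D: "D > 0" "\<And>k z. z \<in> S \<Longrightarrow> cmod (q k z) \<le> D * exp (\<delta> / 2 * real (deg k))"
    using subexp_onE[OF assms(2) d] by blast
  have "cmod (p k z * q k z) \<le> (C * D) * exp (\<delta> * real (deg k))" if "z \<in> S" for k z
  proof -
    have "cmod (p k z * q k z) \<le> (C * exp (\<delta> / 2 * real (deg k))) * (D * exp (\<delta> / 2 * real (deg k)))"
      unfolding norm_mult using C D that by (intro mult_mono) auto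
    also have "\<dots> = (C * D) * exp (\<delta> / 2 * real (deg k) + \<delta> / 2 * real (deg k))"
      unfolding exp_add by (simp add: mult_ac)
    finally show ?thesis by simp
  qed
  then show "\<exists>C. \<forall>k. \<forall>z\<in>S. cmod (p k z * q k z) \<le> C * exp (\<delta> * real (deg k))" by blast
qed

lemma subexp_on_bounded:
  assumes "\<And>k z. z \<in> S \<Longrightarrow> cmod (p k z) \<le> C"
  shows "subexp_on S deg p"
  unfolding subexp_on_def
proof (intro allI impI exI ballI)
  fix \<delta> :: real and k z assume "\<delta> > 0" "z \<in> S"
  then have "cmod (p k z) \<le> \<bar>C\<bar> * 1" using assms[of z k] by simp
  also have "\<dots> \<le> \<bar>C\<bar> * exp (\<delta> * real (deg k))"
    using \<open>\<delta> > 0\<close> by (intro mult_left_mono) auto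
  finally show "cmod (p k z) \<le> \<bar>C\<bar> * exp (\<delta> * real (deg k))" .
qed

lemma subexp_on_add:
  assumes "subexp_on S deg p" "subexp_on S deg q"
  shows "subexp_on S deg (\<lambda>k z. p k z + q k z)"
  unfolding subexp_on_def
proof (intro allI impI)
  fix \<delta> :: real assume d: "\<delta> > 0"
  obtain C where C: "C > 0" "\<And>k z. z \<in> S \<Longrightarrow> cmod (p k z) \<le> C * exp (\<delta> * real (deg k))"
    using subexp_onE[OF assms(1) d] by blast
  obtain D where D: "D > 0" "\<And>k z. z \<in> S \<Longrightarrow> cmod (q k z) \<le> D * exp (\<delta> * real (deg k))"
    using subexp_onE[OF assms(2) d] by blast
  have "cmod (p k z + q k z) \<le> (C + D) * exp (\<delta> * real (deg k))" if "z \<in> S" for k z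
    using norm_triangle_ineq[of "p k z" "q k z"] C(2)[OF that, of k] D(2)[OF that, of k] by (simp add: distrib_right)
  then show "\<exists>C. \<forall>k. \<forall>z\<in>S. cmod (p k z + q k z) \<le> C * exp (\<delta> * real (deg k))" by blast
qed

lemma subexp_on_linear:
  "subexp_on S deg (\<lambda>k z. of_real (1 + real (deg k)))"
  unfolding subexp_on_def
proof (intro allI impI)
  fix \<delta> :: real assume d: "\<delta> > 0"
  have "1 + real (deg k) \<le> (1 + 1 / \<delta>) * exp (\<delta> * real (deg k))" for k
  proof -
    have "1 + real (deg k) \<le> (1 + 1 / \<delta>) * (1 + \<delta> * real (deg k))"
      using d by (simp add: field_simps)
    also have "\<dots> \<le> (1 + 1 / \<delta>) * exp (\<delta> * real (deg k))"
      using d by (intro mult_left_mono exp_ge_add_one_self) auto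
    finally show ?thesis .
  qed
  then have "\<forall>k. \<forall>z\<in>S. cmod (of_real (1 + real (deg k))) \<le> (1 + 1 / \<delta>) * exp (\<delta> * real (deg k))"
    by (simp add: norm_of_real del: of_real_add of_real_1)
  then show "\<exists>C. \<forall>k. \<forall>z\<in>S. cmod (of_real (1 + real (deg k))) \<le> C * exp (\<delta> * real (deg k))" by blast
qed

lemma subexp_on_power:
  assumes "subexp_on S deg p"
  shows "subexp_on S deg (\<lambda>k z. p k z ^ m)"
  by (induction m) (auto intro: subexp_on_bounded[of _ _ 1] subexp_on_mult[OF assms])

lemma subexp_on_mono:
  assumes "subexp_on S deg p" "\<And>k z. z \<in> S \<Longrightarrow> cmod (q k z) \<le> D * cmod (p k z)"
  shows "subexp_on S deg q"
  unfolding subexp_on_def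
proof (intro allI impI)
  fix \<delta> :: real assume d: "\<delta> > 0"
  obtain C where C: "C > 0" "\<And>k z. z \<in> S \<Longrightarrow> cmod (p k z) \<le> C * exp (\<delta> * real (deg k))"
    using subexp_onE[OF assms(1) d] by blast
  have "cmod (q k z) \<le> (\<bar>D\<bar> * C) * exp (\<delta> * real (deg k))" if "z \<in> S" for k z
  proof -
    have "cmod (q k z) \<le> \<bar>D\<bar> * cmod (p k z)"
      using assms(2)[OF that, of k] by (meson abs_ge_self mult_right_mono norm_ge_zero order_trans)
    also have "\<dots> \<le> \<bar>D\<bar> * (C * exp (\<delta> * real (deg k)))"
      using C that by (intro mult_left_mono) auto
    finally show ?thesis by simp
  qed
  then show "\<exists>C. \<forall>k. \<forall>z\<in>S. cmod (q k z) \<le> C * exp (\<delta> * real (deg k))" by blast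
qed

lemma subexp_on_hermite_ext: "subexp_on (cball 0 R) (\<lambda>k. k) hermite_ext"
  unfolding subexp_on_def
proof (intro allI impI)
  fix \<delta> :: real assume d: "\<delta> > 0"
  let ?c = "2 * sqrt 2 * R"
  have "cmod (hermite_ext k z) \<le> (hermite_const 0 * exp (R\<^sup>2 / 2) * exp (?c\<^sup>2 / (4 * \<delta>))) * exp (\<delta> * real k)" if "z \<in> cball 0 R" for k z
  proof -
    \<comment> \<open>Completing the square trades \<open>\<surd>k\<close> for a small multiple of \<open>k\<close>.\<close>
    have "0 \<le> \<delta> * (sqrt (real k) - ?c / (2 * \<delta>))\<^sup>2" using d by simp
    also have "\<dots> = \<delta> * real k - ?c * sqrt (real k) + ?c\<^sup>2 / (4 * \<delta>)"
      using d by (simp add: power2_diff) (simp add: field_simps power2_eq_square)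
    finally have "?c * sqrt (real k) \<le> ?c\<^sup>2 / (4 * \<delta>) + \<delta> * real k" by simp
    then have "exp (?c * sqrt (real k)) \<le> exp (?c\<^sup>2 / (4 * \<delta>)) * exp (\<delta> * real k)"
      by (simp only: exp_add[symmetric] exp_le_cancel_iff)
    then have "hermite_const 0 * exp (R\<^sup>2 / 2) * exp (?c * sqrt (real k)) \<le>
        hermite_const 0 * exp (R\<^sup>2 / 2) * (exp (?c\<^sup>2 / (4 * \<delta>)) * exp (\<delta> * real k))"
      using hermite_const_pos[of 0] by (intro mult_left_mono) auto
    then show ?thesis using hermite_ext_bound[of z R k] that by (simp add: mult.assoc)
  qed
  then show "\<exists>C. \<forall>k. \<forall>z\<in>cball 0 R. cmod (hermite_ext k z) \<le> C * exp (\<delta> * real k)" by blast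
qed

lemma subexp_on_hermite_ext_deriv: "subexp_on (cball 0 R) (\<lambda>k. k) hermite_ext_deriv"
proof -
  have pred: "subexp_on (cball 0 R) (\<lambda>k. k) (\<lambda>k. hermite_ext (k - 1))"
    unfolding subexp_on_def
  proof (intro allI impI)
    fix \<delta> :: real assume d: "\<delta> > 0"
    obtain C where C: "C > 0" "\<And>k z. z \<in> cball 0 R \<Longrightarrow> cmod (hermite_ext k z) \<le> C * exp (\<delta> * real k)"
      using subexp_onE[OF subexp_on_hermite_ext d] by blast
    have "cmod (hermite_ext (k - 1) z) \<le> C * exp (\<delta> * real k)" if "z \<in> cball 0 R" for k z
      by (rule order_trans[OF C(2)[OF that]]) (use C d in auto)
    then show "\<exists>C. \<forall>k. \<forall>z\<in>cball 0 R. cmod (hermite_ext (k - 1) z) \<le> C * exp (\<delta> * real k)" by blast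
  qed
  have s: "subexp_on (cball 0 R) (\<lambda>k. k) (\<lambda>k z. of_real (sqrt (2 * real k)))"
  proof (rule subexp_on_mono[OF subexp_on_linear[of _ "\<lambda>k. k"], of _ _ 2])
    fix k :: nat
    have "sqrt (2 * real k) \<le> sqrt ((2 * (1 + real k))\<^sup>2)"
      by (intro real_sqrt_le_mono) (simp add: power2_eq_square algebra_simps)
    also have "\<dots> = 2 * (1 + real k)" by simp
    finally show "cmod (of_real (sqrt (2 * real k))) \<le> 2 * cmod (of_real (1 + real k))"
      by (simp add: norm_of_real del: of_real_add of_real_1)
  qed
  have "subexp_on (cball 0 R) (\<lambda>k. k) (\<lambda>k z. of_real (sqrt (2 * real k)) * hermite_ext (k - 1) z + (- z) * hermite_ext k z)"
    by (intro subexp_on_add subexp_on_mult s pred subexp_on_hermite_ext subexp_on_bounded[of _ _ R]) auto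
  then show ?thesis by (simp add: hermite_ext_deriv_def[abs_def])
qed

section \<open>Hermite expansions on \<open>\<complex>\<^sup>n\<close>\<close>

definition total_deg :: "('n::finite \<Rightarrow> nat) \<Rightarrow> nat" where
  "total_deg \<alpha> = (\<Sum>i\<in>UNIV. \<alpha> i)"

definition multi_hermite_ext :: "('n::finite \<Rightarrow> nat) \<Rightarrow> complex^'n \<Rightarrow> complex" where
  "multi_hermite_ext \<alpha> z = (\<Prod>i\<in>UNIV. hermite_ext (\<alpha> i) (z $ i))"

definition multi_hermite_ext_deriv :: "'n \<Rightarrow> ('n::finite \<Rightarrow> nat) \<Rightarrow> complex^'n \<Rightarrow> complex" where
  "multi_hermite_ext_deriv i \<alpha> z = hermite_ext_deriv (\<alpha> i) (z $ i) * (\<Prod>j\<in>UNIV - {i}. hermite_ext (\<alpha> j) (z $ j))"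

lemma multi_hermite_fun_eq: "multi_hermite_fun \<alpha> x = multi_hermite_ext \<alpha> (complex_vec x)"
  by (simp add: multi_hermite_fun_def multi_hermite_ext_def complex_vec_def hermite_fun_eq)

lemma continuous_on_multi_hermite_ext [continuous_intros]:
  "continuous_on S f \<Longrightarrow> continuous_on S (\<lambda>x. multi_hermite_ext \<alpha> (f x))"
  unfolding multi_hermite_ext_def by (intro continuous_intros)

lemma has_derivative_multi_hermite_ext: "(multi_hermite_ext \<alpha> has_derivative (\<lambda>v. \<Sum>i\<in>UNIV. multi_hermite_ext_deriv i \<alpha> z * v $ i)) (at z)"
proof -
  have "((\<lambda>z. hermite_ext (\<alpha> i) (z $ i)) has_derivative (\<lambda>v. hermite_ext_deriv (\<alpha> i) (z $ i) * v $ i)) (at z)" for i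
  proof -
    have d: "(hermite_ext (\<alpha> i) has_derivative (\<lambda>v. hermite_ext_deriv (\<alpha> i) (z $ i) * v)) (at (z $ i))"
      using DERIV_hermite_ext by (simp add: has_field_derivative_def)
    have "((\<lambda>z. z $ i) has_derivative (\<lambda>v. v $ i)) (at z)"
      by (rule bounded_linear_imp_has_derivative[OF bounded_linear_vec_nth])
    from has_derivative_compose[OF this d] show ?thesis .
  qed
  from has_derivative_prod[of UNIV, OF this]
  show ?thesis unfolding multi_hermite_ext_def[abs_def] multi_hermite_ext_deriv_def
    by (simp add: mult_ac)
qed

lemma finite_total_deg: "finite {\<alpha> :: 'n::finite \<Rightarrow> nat. total_deg \<alpha> = k}"
  and card_total_deg_le: "card {\<alpha> :: 'n::finite \<Rightarrow> nat. total_deg \<alpha> = k} \<le> (k + 1) ^ CARD('n)"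
proof -
  have sub: "{\<alpha> :: 'n \<Rightarrow> nat. total_deg \<alpha> = k} \<subseteq> Pi\<^sub>E UNIV (\<lambda>_. {..k})"
    unfolding total_deg_def by (auto intro: member_le_sum)
  have fin: "finite (Pi\<^sub>E (UNIV :: 'n set) (\<lambda>_. {..k}))" by (intro finite_PiE) auto
  show "finite {\<alpha> :: 'n \<Rightarrow> nat. total_deg \<alpha> = k}" by (rule finite_subset[OF sub fin])
  have "card {\<alpha> :: 'n \<Rightarrow> nat. total_deg \<alpha> = k} \<le> card (Pi\<^sub>E (UNIV :: 'n set) (\<lambda>_. {..k}))"
    by (rule card_mono[OF fin sub])
  then show "card {\<alpha> :: 'n \<Rightarrow> nat. total_deg \<alpha> = k} \<le> (k + 1) ^ CARD('n)"
    by (simp add: card_PiE)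
qed

lemma subexp_on_prod:
  fixes h :: "'n::finite \<Rightarrow> nat \<Rightarrow> complex \<Rightarrow> complex"
  assumes h: "\<And>i. subexp_on (cball 0 R) (\<lambda>k. k) (h i)"
  shows "subexp_on (cball 0 R) total_deg (\<lambda>\<alpha> z :: complex^'n. \<Prod>i\<in>UNIV. h i (\<alpha> i) (z $ i))"
  unfolding subexp_on_def
proof (intro allI impI)
  fix \<delta> :: real assume d: "\<delta> > 0"
  have "\<forall>i. \<exists>C. \<forall>k. \<forall>z\<in>cball 0 R. cmod (h i k z) \<le> C * exp (\<delta> * real k)"
    using h d unfolding subexp_on_def by blast
  then obtain C where C: "\<And>i k z. z \<in> cball 0 R \<Longrightarrow> cmod (h i k z) \<le> C i * exp (\<delta> * real k)" by metis
  have "cmod (\<Prod>i\<in>UNIV. h i (\<alpha> i) (z $ i)) \<le> (\<Prod>i\<in>UNIV. C i) * exp (\<delta> * real (total_deg \<alpha>))"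
    if "z \<in> cball 0 R" for \<alpha> and z :: "complex^'n"
  proof -
    have "norm (z $ i) \<le> R" for i using Finite_Cartesian_Product.norm_nth_le[where x = z and i = i] that by simp
    then have "(\<Prod>i\<in>UNIV. cmod (h i (\<alpha> i) (z $ i))) \<le> (\<Prod>i\<in>UNIV. C i * exp (\<delta> * real (\<alpha> i)))"
      using C by (intro prod_mono) auto
    also have "\<dots> = (\<Prod>i\<in>UNIV. C i) * exp (\<delta> * real (total_deg \<alpha>))"
      by (simp add: prod.distrib total_deg_def sum_distrib_left exp_sum)
    finally show ?thesis by (simp add: prod_norm)
  qed
  then show "\<exists>C. \<forall>\<alpha>. \<forall>z\<in>cball 0 R. cmod (\<Prod>i\<in>UNIV. h i (\<alpha> i) ((z :: complex^'n) $ i)) \<le> C * exp (\<delta> * real (total_deg \<alpha>))" by blast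
qed

lemma subexp_on_multi_hermite_ext: "subexp_on (cball 0 R) total_deg multi_hermite_ext"
  unfolding multi_hermite_ext_def[abs_def] by (rule subexp_on_prod[OF subexp_on_hermite_ext])

lemma subexp_on_multi_hermite_ext_deriv: "subexp_on (cball 0 R) total_deg (multi_hermite_ext_deriv i)"
proof -
  have "multi_hermite_ext_deriv i \<alpha> z = (\<Prod>j\<in>UNIV. (if j = i then hermite_ext_deriv else hermite_ext) (\<alpha> j) (z $ j))" for \<alpha> z
    by (simp add: multi_hermite_ext_deriv_def prod.remove[of UNIV i] cong: prod.cong_simp)
  then have "multi_hermite_ext_deriv i = (\<lambda>\<alpha> z. \<Prod>j\<in>UNIV. (if j = i then hermite_ext_deriv else hermite_ext) (\<alpha> j) (z $ j))"
    by blast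
  moreover have "subexp_on (cball 0 R) total_deg (\<lambda>\<alpha> z. \<Prod>j\<in>UNIV. (if j = i then hermite_ext_deriv else hermite_ext) (\<alpha> j) (z $ j))"
    by (rule subexp_on_prod) (simp add: subexp_on_hermite_ext subexp_on_hermite_ext_deriv)
  ultimately show ?thesis by simp
qed

definition subexp_coeff :: "(('n::finite \<Rightarrow> nat) \<Rightarrow> complex) \<Rightarrow> bool" where
  "subexp_coeff a \<longleftrightarrow> subexp_on (UNIV :: unit set) total_deg (\<lambda>\<alpha> _. a \<alpha>)"

lemma subexp_coeff_on: "subexp_coeff a \<Longrightarrow> subexp_on S total_deg (\<lambda>\<alpha> _. a \<alpha>)"
  unfolding subexp_coeff_def subexp_on_def by auto

text \<open>There are at most \<open>(k + 1)^n\<close> multi-indices of degree \<open>k\<close>, so summing over them keeps the growth class.\<close>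

lemma subexp_on_shell:
  fixes e :: "('n::finite \<Rightarrow> nat) \<Rightarrow> 'b \<Rightarrow> complex"
  assumes "subexp_on S total_deg e"
  shows "subexp_on S (\<lambda>k. k) (\<lambda>k z. \<Sum>\<alpha> | total_deg \<alpha> = k. e \<alpha> z)"
  unfolding subexp_on_def
proof (intro allI impI)
  fix \<delta> :: real assume "\<delta> > 0"
  then have d: "\<delta> / 2 > 0" by simp
  obtain C where C: "C > 0" "\<And>\<alpha> z. z \<in> S \<Longrightarrow> cmod (e \<alpha> z) \<le> C * exp (\<delta> / 2 * real (total_deg \<alpha>))"
    using subexp_onE[OF assms d] by blast
  have "subexp_on (UNIV :: unit set) (\<lambda>k. k) (\<lambda>k _. of_real (1 + real k) ^ CARD('n))"
    by (rule subexp_on_power[OF subexp_on_linear])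
  from subexp_onE[OF this d] obtain D where D: "D > 0"
    "\<And>k. cmod (of_real (1 + real k) ^ CARD('n)) \<le> D * exp (\<delta> / 2 * real k)" by auto
  have "cmod (\<Sum>\<alpha> | total_deg \<alpha> = k. e \<alpha> z) \<le> (D * C) * exp (\<delta> * real k)" if z: "z \<in> S" for k z
  proof -
    have "cmod (\<Sum>\<alpha> | total_deg \<alpha> = k. e \<alpha> z) \<le> (\<Sum>\<alpha> | total_deg (\<alpha> :: 'n \<Rightarrow> nat) = k. C * exp (\<delta> / 2 * real k))"
      by (intro sum_norm_le) (use C(2)[OF z] in auto)
    also have "\<dots> = real (card {\<alpha> :: 'n \<Rightarrow> nat. total_deg \<alpha> = k}) * (C * exp (\<delta> / 2 * real k))" by simp
    also have "\<dots> \<le> (D * exp (\<delta> / 2 * real k)) * (C * exp (\<delta> / 2 * real k))"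
    proof (intro mult_right_mono)
      have "real (card {\<alpha> :: 'n \<Rightarrow> nat. total_deg \<alpha> = k}) \<le> real ((k + 1) ^ CARD('n))"
        using card_total_deg_le[where ?'n = 'n, of k] of_nat_mono by blast
      also have "\<dots> = cmod (of_real (1 + real k) ^ CARD('n))"
        by (simp add: norm_power norm_of_real add.commute del: of_real_add of_real_1)
      finally show "real (card {\<alpha> :: 'n \<Rightarrow> nat. total_deg \<alpha> = k}) \<le> D * exp (\<delta> / 2 * real k)"
        using D(2)[of k] by linarith
    qed (use C in auto)
    also have "\<dots> = (D * C) * exp (\<delta> / 2 * real k + \<delta> / 2 * real k)"
      unfolding exp_add by (simp add: mult_ac)
    finally show ?thesis by simp
  qed
  then show "\<exists>C. \<forall>k. \<forall>z\<in>S. cmod (\<Sum>\<alpha> | total_deg \<alpha> = k. e \<alpha> z) \<le> C * exp (\<delta> * real k)" by blast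
qed

text \<open>The type argument carries the dimension, since \<open>k\<close> alone does not determine it.\<close>

definition eigenval :: "'n::finite itself \<Rightarrow> nat \<Rightarrow> real" where
  "eigenval _ k = 2 * real k + real CARD('n)"

lemma eigenval_ge_1: "1 \<le> eigenval TYPE('n::finite) k"
proof -
  have "0 < CARD('n)" by simp
  then show ?thesis unfolding eigenval_def by linarith
qed

lemma subexp_on_eigenval_power: "subexp_on S (\<lambda>k. k) (\<lambda>k z. of_real ((- eigenval TYPE('n::finite) k) ^ m))"
proof (rule subexp_on_mono[OF subexp_on_power[OF subexp_on_linear[of _ "\<lambda>k. k"]]])
  fix k
  have "eigenval TYPE('n) k \<le> (2 + real CARD('n)) * (1 + real k)"
    by (simp add: eigenval_def algebra_simps)
  then have "eigenval TYPE('n) k ^ m \<le> ((2 + real CARD('n)) * (1 + real k)) ^ m"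
    using eigenval_ge_1[where ?'n = 'n, of k] by (intro power_mono) auto
  then show "cmod (of_real ((- eigenval TYPE('n) k) ^ m)) \<le> (2 + real CARD('n)) ^ m * cmod (of_real (1 + real k) ^ m)"
    using eigenval_ge_1[where ?'n = 'n, of k]
    by (simp add: norm_power norm_of_real power_abs power_mult_distrib del: of_real_add of_real_1)
qed

lemma subexp_dominated:
  assumes p: "subexp_on S (\<lambda>k. k) p" and r: "r > 0"
  obtains M :: "nat \<Rightarrow> real" where "summable M"
    "\<And>k z \<rho>. z \<in> S \<Longrightarrow> \<rho> \<ge> r \<Longrightarrow> cmod (of_real (exp (- eigenval TYPE('n::finite) k * \<rho>)) * p k z) \<le> M k"
proof -
  obtain C where C: "C > 0" "\<And>k z. z \<in> S \<Longrightarrow> cmod (p k z) \<le> C * exp (r * real k)"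
    using subexp_onE[OF p r] by blast
  show ?thesis
  proof (rule that)
    show "summable (\<lambda>k. C * exp (- r) ^ k)"
      using r by (intro summable_mult summable_geometric) simp
    fix k z \<rho> assume z: "z \<in> S" and \<rho>: "\<rho> \<ge> r"
    have "2 * real k * r \<le> eigenval TYPE('n) k * \<rho>"
      using r \<rho> by (intro mult_mono) (auto simp: eigenval_def)
    then have "exp (- eigenval TYPE('n) k * \<rho>) \<le> exp (- (2 * real k * r))" by simp
    then have "cmod (of_real (exp (- eigenval TYPE('n) k * \<rho>)) * p k z) \<le> exp (- (2 * real k * r)) * (C * exp (r * real k))"
      unfolding norm_mult using C z by (intro mult_mono) auto
    also have "\<dots> = C * exp (- (2 * real k * r) + r * real k)" unfolding exp_add by simp
    also have "\<dots> = C * exp (- r) ^ k" by (simp add: exp_of_nat_mult[symmetric] algebra_simps)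
    finally show "cmod (of_real (exp (- eigenval TYPE('n) k * \<rho>)) * p k z) \<le> C * exp (- r) ^ k" .
  qed
qed

text \<open>The semigroup at time \<open>\<rho>\<close> applied to the expansion with coefficients \<open>a\<close>. The semigroup, the
  transform and all elements of \<open>HL2 \<rho>\<close> are of this form.\<close>

definition hermite_series :: "real \<Rightarrow> (('n::finite \<Rightarrow> nat) \<Rightarrow> complex) \<Rightarrow> complex^'n \<Rightarrow> complex" where
  "hermite_series \<rho> a z = (\<Sum>k. of_real (exp (- eigenval TYPE('n) k * \<rho>)) * (\<Sum>\<alpha> | total_deg \<alpha> = k. a \<alpha> * multi_hermite_ext \<alpha> z))"

lemma subexp_on_shell_sum:
  assumes "subexp_coeff a"
  shows "subexp_on (cball 0 R) (\<lambda>k. k) (\<lambda>k z. \<Sum>\<alpha> | total_deg \<alpha> = k. a \<alpha> * multi_hermite_ext \<alpha> z)"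
  by (intro subexp_on_shell subexp_on_mult subexp_on_multi_hermite_ext subexp_coeff_on assms)

lemma summable_hermite_series:
  fixes a :: "('n::finite \<Rightarrow> nat) \<Rightarrow> complex"
  assumes "subexp_coeff a" "\<rho> > 0"
  shows "summable (\<lambda>k. of_real (exp (- eigenval TYPE('n) k * \<rho>)) * (\<Sum>\<alpha> | total_deg \<alpha> = k. a \<alpha> * multi_hermite_ext \<alpha> z))"
proof -
  from subexp_dominated[OF subexp_on_shell_sum[OF assms(1), of "norm z"] assms(2), where ?'n = 'n]
  obtain M where M: "summable M"
    "\<And>k z' \<rho>'. z' \<in> cball 0 (norm z) \<Longrightarrow> \<rho>' \<ge> \<rho> \<Longrightarrow>
      cmod (of_real (exp (- eigenval TYPE('n) k * \<rho>')) * (\<Sum>\<alpha> | total_deg \<alpha> = k. a \<alpha> * multi_hermite_ext \<alpha> z')) \<le> M k"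
    by blast
  show ?thesis
    by (rule summable_comparison_test'[OF M(1), of 0]) (rule M(2), simp_all)
qed

text \<open>The partial derivatives of the terms have the same growth as the terms, so the series of
  derivatives converges uniformly on balls and its sum is complex linear in the direction.\<close>

lemma entire_hermite_series:
  fixes a :: "('n::finite \<Rightarrow> nat) \<Rightarrow> complex"
  assumes a: "subexp_coeff a" and \<rho>: "\<rho> > 0"
  shows "entire (hermite_series \<rho> a)"
  unfolding entire_def
proof
  fix z0 :: "complex^'n"
  define R where "R = norm z0 + 1"
  let ?S = "ball 0 R :: (complex^'n) set"
  let ?w = "\<lambda>k. complex_of_real (exp (- eigenval TYPE('n) k * \<rho>))"
  define f where "f k z = ?w k * (\<Sum>\<alpha> | total_deg \<alpha> = k. a \<alpha> * multi_hermite_ext \<alpha> z)" for k and z :: "complex^'n"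
  define d where "d i k z = ?w k * (\<Sum>\<alpha> | total_deg \<alpha> = k. a \<alpha> * multi_hermite_ext_deriv i \<alpha> z)" for i k and z :: "complex^'n"
  define G where "G z h = (\<Sum>i\<in>UNIV. (\<Sum>k. d i k z) * h $ i)" for z h :: "complex^'n"
  have S: "?S \<subseteq> cball 0 R" by auto
  have z0: "z0 \<in> ?S" by (simp add: R_def)
  have ul: "uniform_limit ?S (\<lambda>N z. \<Sum>k<N. d i k z) (\<lambda>z. \<Sum>k. d i k z) sequentially" for i
  proof -
    have "subexp_on (cball 0 R) (\<lambda>k. k) (\<lambda>k z. \<Sum>\<alpha> | total_deg \<alpha> = k. a \<alpha> * multi_hermite_ext_deriv i \<alpha> z)"
      by (intro subexp_on_shell subexp_on_mult subexp_on_multi_hermite_ext_deriv subexp_coeff_on a)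
    from subexp_dominated[OF this \<rho>] obtain M where M: "summable M"
      "\<And>k z' \<rho>'. z' \<in> cball 0 R \<Longrightarrow> \<rho>' \<ge> \<rho> \<Longrightarrow>
        cmod (of_real (exp (- eigenval TYPE('n::finite) k * \<rho>')) * (\<Sum>\<alpha> | total_deg \<alpha> = k. a \<alpha> * multi_hermite_ext_deriv i \<alpha> z')) \<le> M k"
      by blast
    show ?thesis
      by (rule Weierstrass_m_test[OF _ M(1)]) (use M(2) S in \<open>auto simp: d_def\<close>)
  qed
  have "\<exists>g. \<forall>z\<in>?S. (\<lambda>k. f k z) sums g z \<and> (g has_derivative G z) (at z within ?S)"
  proof (rule has_derivative_series[OF convex_ball _ _ z0])
    fix k z
    have "(f k has_derivative (\<lambda>h. ?w k * (\<Sum>\<alpha> | total_deg \<alpha> = k. a \<alpha> * (\<Sum>i\<in>UNIV. multi_hermite_ext_deriv i \<alpha> z * h $ i)))) (at z within ?S)"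
      unfolding f_def[abs_def]
      by (intro has_derivative_mult_right has_derivative_sum has_derivative_at_withinI[OF has_derivative_multi_hermite_ext])
    also have "(\<lambda>h. ?w k * (\<Sum>\<alpha> | total_deg \<alpha> = k. a \<alpha> * (\<Sum>i\<in>UNIV. multi_hermite_ext_deriv i \<alpha> z * h $ i))) = (\<lambda>h. \<Sum>i\<in>UNIV. d i k z * h $ i)"
      unfolding d_def sum_distrib_left sum_distrib_right
      by (subst sum.swap) (simp add: mult_ac)
    finally show "(f k has_derivative (\<lambda>h. \<Sum>i\<in>UNIV. d i k z * h $ i)) (at z within ?S)" .
  next
    fix \<epsilon> :: real assume \<epsilon>: "\<epsilon> > 0"
    then have e: "\<epsilon> / CARD('n) > 0" by simp
    have "\<forall>\<^sub>F N in sequentially. \<forall>i. \<forall>z\<in>?S. dist (\<Sum>k<N. d i k z) (\<Sum>k. d i k z) < \<epsilon> / CARD('n)"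
      using uniform_limitD[OF ul e] by (intro eventually_all_finite) auto
    then show "\<forall>\<^sub>F N in sequentially. \<forall>z\<in>?S. \<forall>h. norm ((\<Sum>k<N. \<Sum>i\<in>UNIV. d i k z * h $ i) - G z h) \<le> \<epsilon> * norm h"
    proof eventually_elim
      case (elim N)
      show ?case
      proof (intro ballI allI)
        fix z h :: "complex^'n" assume z: "z \<in> ?S"
        have "(\<Sum>k<N. \<Sum>i\<in>UNIV. d i k z * h $ i) - G z h = (\<Sum>i\<in>UNIV. ((\<Sum>k<N. d i k z) - (\<Sum>k. d i k z)) * h $ i)"
          unfolding G_def by (subst sum.swap) (simp add: sum_distrib_right left_diff_distrib sum_subtractf)
        also have "norm \<dots> \<le> (\<Sum>i\<in>(UNIV::'n set). (\<epsilon> / CARD('n)) * norm h)"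
        proof (rule sum_norm_le)
          fix i
          have "norm ((\<Sum>k<N. d i k z) - (\<Sum>k. d i k z)) \<le> \<epsilon> / CARD('n)"
            using elim z by (auto simp: dist_norm intro: less_imp_le)
          then show "norm (((\<Sum>k<N. d i k z) - (\<Sum>k. d i k z)) * h $ i) \<le> (\<epsilon> / CARD('n)) * norm h"
            unfolding norm_mult using e by (intro mult_mono Finite_Cartesian_Product.norm_nth_le) auto
        qed
        also have "\<dots> = \<epsilon> * norm h" by simp
        finally show "norm ((\<Sum>k<N. \<Sum>i\<in>UNIV. d i k z * h $ i) - G z h) \<le> \<epsilon> * norm h" .
      qed
    qed
  next
    show "(\<lambda>k. f k z0) sums (\<Sum>k. f k z0)"
      unfolding f_def by (intro summable_sums summable_hermite_series a \<rho>)
  qed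
  then obtain g where g: "\<And>z. z \<in> ?S \<Longrightarrow> (\<lambda>k. f k z) sums g z" "\<And>z. z \<in> ?S \<Longrightarrow> (g has_derivative G z) (at z within ?S)"
    by blast
  have "(g has_derivative G z0) (at z0)"
    using g(2)[OF z0] z0 by (subst (asm) at_within_open) auto
  moreover have "g z = hermite_series \<rho> a z" if "z \<in> ?S" for z
    using sums_unique[OF g(1)[OF that]] by (simp add: hermite_series_def f_def)
  ultimately have "(hermite_series \<rho> a has_derivative G z0) (at z0)"
    by (rule has_derivative_transform_within_open[OF _ open_ball z0])
  moreover have "G z0 (c *s v) = c * G z0 v" for c v
    by (simp add: G_def sum_distrib_left mult_ac)
  ultimately show "\<exists>D. (hermite_series \<rho> a has_derivative D) (at z0) \<and> (\<forall>c v. D (c *s v) = c * D v)" by blast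
qed

text \<open>At a fixed point the series is a Dirichlet series in \<open>\<rho>\<close> with coefficients \<open>p k\<close>; this is its
  termwise derivative of order \<open>m\<close>.\<close>

definition hermite_series_deriv :: "'n::finite itself \<Rightarrow> (nat \<Rightarrow> complex) \<Rightarrow> nat \<Rightarrow> real \<Rightarrow> complex" where
  "hermite_series_deriv T p m \<rho> = (\<Sum>k. of_real (exp (- eigenval T k * \<rho>)) * (of_real ((- eigenval T k) ^ m) * p k))"

lemma summable_hermite_series_deriv:
  assumes p: "subexp_on (UNIV :: unit set) (\<lambda>k. k) (\<lambda>k _. p k)" and \<rho>: "\<rho> > 0"
  shows "summable (\<lambda>k. cmod (of_real (exp (- eigenval TYPE('n::finite) k * \<rho>)) * (of_real ((- eigenval TYPE('n) k) ^ m) * p k)))"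
proof -
  have "subexp_on (UNIV :: unit set) (\<lambda>k. k) (\<lambda>k _. of_real ((- eigenval TYPE('n) k) ^ m) * p k)"
    by (intro subexp_on_mult subexp_on_eigenval_power p)
  from subexp_dominated[OF this \<rho>, where ?'n = 'n] obtain M where M: "summable M"
    "\<And>k \<rho>'. \<rho>' \<ge> \<rho> \<Longrightarrow> cmod (of_real (exp (- eigenval TYPE('n) k * \<rho>')) * (of_real ((- eigenval TYPE('n) k) ^ m) * p k)) \<le> M k"
    by auto
  show ?thesis
    by (rule summable_comparison_test'[OF M(1), of 0])
       (simp only: real_norm_def abs_norm_cancel M(2)[OF order_refl])
qed

lemma has_vector_derivative_hermite_series_deriv:
  assumes p: "subexp_on (UNIV :: unit set) (\<lambda>k. k) (\<lambda>k _. p k)" and \<rho>: "\<rho> > 0"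
  shows "(hermite_series_deriv TYPE('n::finite) p m has_vector_derivative hermite_series_deriv TYPE('n) p (Suc m) \<rho>) (at \<rho>)"
proof -
  let ?L = "eigenval TYPE('n)"
  let ?S = "{\<rho> / 2<..}"
  define f where "f m k x = complex_of_real (exp (- ?L k * x)) * (of_real ((- ?L k) ^ m) * p k)" for m k x
  have \<rho>2: "\<rho> / 2 > 0" using \<rho> by simp
  have ul: "uniform_limit ?S (\<lambda>N x. \<Sum>k<N. f (Suc m) k x) (\<lambda>x. \<Sum>k. f (Suc m) k x) sequentially"
  proof -
    have "subexp_on (UNIV :: unit set) (\<lambda>k. k) (\<lambda>k _. of_real ((- ?L k) ^ Suc m) * p k)"
      by (intro subexp_on_mult subexp_on_eigenval_power p)
    from subexp_dominated[OF this \<rho>2, where ?'n = 'n] obtain M where M: "summable M"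
      "\<And>k \<rho>'. \<rho>' \<ge> \<rho> / 2 \<Longrightarrow> cmod (f (Suc m) k \<rho>') \<le> M k"
      by (auto simp: f_def)
    show ?thesis
      by (rule Weierstrass_m_test[OF _ M(1)]) (use M(2) in auto)
  qed
  have "\<exists>g. \<forall>x\<in>?S. (\<lambda>k. f m k x) sums g x \<and> (g has_derivative (\<lambda>h. h *\<^sub>R (\<Sum>k. f (Suc m) k x))) (at x within ?S)"
  proof (rule has_derivative_series[where x = \<rho>])
    fix k x
    have "((\<lambda>x. complex_of_real (exp (- ?L k * x))) has_vector_derivative of_real (exp (- ?L k * x) * (- ?L k))) (at x within ?S)"
      by (rule has_vector_derivative_of_real) (auto intro!: derivative_eq_intros)
    from has_vector_derivative_mult_left[OF this, of "of_real ((- ?L k) ^ m) * p k"]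
    have "(f m k has_vector_derivative f (Suc m) k x) (at x within ?S)"
      unfolding f_def by (simp add: mult_ac)
    then show "(f m k has_derivative (\<lambda>h. h *\<^sub>R f (Suc m) k x)) (at x within ?S)"
      by (simp add: has_vector_derivative_def)
  next
    fix \<epsilon> :: real assume "\<epsilon> > 0"
    from uniform_limitD[OF ul this]
    show "\<forall>\<^sub>F N in sequentially. \<forall>x\<in>?S. \<forall>h. norm ((\<Sum>k<N. h *\<^sub>R f (Suc m) k x) - h *\<^sub>R (\<Sum>k. f (Suc m) k x)) \<le> \<epsilon> * norm h"
    proof eventually_elim
      case (elim N)
      show ?case
      proof (intro ballI allI)
        fix x h :: real assume "x \<in> ?S"
        then have "norm ((\<Sum>k<N. f (Suc m) k x) - (\<Sum>k. f (Suc m) k x)) \<le> \<epsilon>"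
          using elim by (auto simp: dist_norm less_imp_le)
        then show "norm ((\<Sum>k<N. h *\<^sub>R f (Suc m) k x) - h *\<^sub>R (\<Sum>k. f (Suc m) k x)) \<le> \<epsilon> * norm h"
          unfolding scaleR_sum_right[symmetric] scaleR_diff_right[symmetric] norm_scaleR
          by (subst mult.commute[of \<epsilon>]) (auto intro: mult_left_mono)
      qed
    qed
  next
    show "(\<lambda>k. f m k \<rho>) sums (\<Sum>k. f m k \<rho>)"
      unfolding f_def by (rule summable_sums, rule summable_norm_cancel, rule summable_hermite_series_deriv[OF p \<rho>])
  qed (use \<rho> in auto)
  then obtain g where g: "\<And>x. x \<in> ?S \<Longrightarrow> (\<lambda>k. f m k x) sums g x"
    "\<And>x. x \<in> ?S \<Longrightarrow> (g has_derivative (\<lambda>h. h *\<^sub>R (\<Sum>k. f (Suc m) k x))) (at x within ?S)"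
    by blast
  have \<rho>S: "\<rho> \<in> ?S" using \<rho> by simp
  have "(g has_derivative (\<lambda>h. h *\<^sub>R (\<Sum>k. f (Suc m) k \<rho>))) (at \<rho>)"
    using g(2)[OF \<rho>S] \<rho>S by (subst (asm) at_within_open) auto
  then have "(g has_vector_derivative hermite_series_deriv TYPE('n) p (Suc m) \<rho>) (at \<rho>)"
    by (simp add: has_vector_derivative_def hermite_series_deriv_def f_def)
  moreover have "g x = hermite_series_deriv TYPE('n) p m x" if "x \<in> ?S" for x
    using sums_unique[OF g(1)[OF that]] by (simp add: hermite_series_deriv_def f_def)
  ultimately show ?thesis
    by (rule has_vector_derivative_transform_within_open[OF _ open_greaterThan \<rho>S])
qed

text \<open>Derivatives are local, so agreement with the series on the open set of all \<open>r > - t\<close> identifies the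
  iterated derivative in the definition of the transform with the termwise one.\<close>

lemma iterated_vector_derivative_hermite_series_deriv:
  assumes p: "subexp_on (UNIV :: unit set) (\<lambda>k. k) (\<lambda>k _. p k)"
    and G: "\<And>r. r > - t \<Longrightarrow> G r = hermite_series_deriv TYPE('n::finite) p 0 (r + t)" and r: "r > - t"
  shows "((\<lambda>g \<rho>. vector_derivative g (at \<rho>)) ^^ m) G r = hermite_series_deriv TYPE('n) p m (r + t)"
  using r
proof (induction m arbitrary: r)
  case 0
  then show ?case by (simp add: G)
next
  case (Suc m)
  have "(hermite_series_deriv TYPE('n) p m has_vector_derivative hermite_series_deriv TYPE('n) p (Suc m) (r + t)) (at (r + t))"
    using Suc.prems by (intro has_vector_derivative_hermite_series_deriv p) auto
  then have "((\<lambda>x. hermite_series_deriv TYPE('n) p m (x + t)) has_vector_derivative hermite_series_deriv TYPE('n) p (Suc m) (r + t)) (at r)"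
    using vector_diff_chain_at[of "\<lambda>x. x + t" 1 r "hermite_series_deriv TYPE('n) p m"]
    by (simp add: o_def has_vector_derivative_add_const has_vector_derivative_id)
  then have "((((\<lambda>g \<rho>. vector_derivative g (at \<rho>)) ^^ m) G) has_vector_derivative hermite_series_deriv TYPE('n) p (Suc m) (r + t)) (at r)"
  proof (rule has_vector_derivative_transform_within_open[OF _ open_greaterThan])
    show "r \<in> {- t<..}" using Suc.prems by simp
    show "hermite_series_deriv TYPE('n) p m (x + t) = ((\<lambda>g \<rho>. vector_derivative g (at \<rho>)) ^^ m) G x" if "x \<in> {- t<..}" for x
      using Suc.IH[of x] that by simp
  qed
  then show ?case by (simp add: vector_derivative_at)
qed

section \<open>Orthogonality of the Hermite functions\<close>

text \<open>At most exponential growth at infinity: polynomials qualify, the class is closed under products,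
  and any Gaussian makes its members integrable.\<close>

definition exp_bounded :: "('a::real_normed_vector \<Rightarrow> complex) \<Rightarrow> bool" where
  "exp_bounded f \<longleftrightarrow> (\<exists>C\<ge>0. \<exists>B\<ge>0. \<forall>z. cmod (f z) \<le> C * exp (B * norm z))"

lemma exp_boundedI: "0 \<le> C \<Longrightarrow> 0 \<le> B \<Longrightarrow> (\<And>z. cmod (f z) \<le> C * exp (B * norm z)) \<Longrightarrow> exp_bounded f"
  unfolding exp_bounded_def by blast

lemma exp_bounded_const: "exp_bounded (\<lambda>z. c)"
  by (rule exp_boundedI[of "cmod c" 0]) auto

lemma exp_bounded_linear:
  assumes "\<And>z. cmod (f z) \<le> norm z" shows "exp_bounded f"
proof (rule exp_boundedI[of 1 1])
  fix z
  have "cmod (f z) \<le> 1 + norm z" using assms[of z] by linarith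
  also have "\<dots> \<le> exp (norm z)" by (rule exp_ge_add_one_self)
  finally show "cmod (f z) \<le> 1 * exp (1 * norm z)" by simp
qed auto

lemma exp_bounded_add:
  fixes f g :: "'a::real_normed_vector \<Rightarrow> complex"
  assumes "exp_bounded f" "exp_bounded g" shows "exp_bounded (\<lambda>z. f z + g z)"
proof -
  obtain C B where f: "C \<ge> 0" "B \<ge> 0" "\<And>z. cmod (f z) \<le> C * exp (B * norm z)"
    using assms(1) unfolding exp_bounded_def by blast
  obtain D E where g: "D \<ge> 0" "E \<ge> 0" "\<And>z. cmod (g z) \<le> D * exp (E * norm z)"
    using assms(2) unfolding exp_bounded_def by blast
  show ?thesis
  proof (rule exp_boundedI[of "C + D" "B + E"])
    fix z :: 'a
    have "C * exp (B * norm z) \<le> C * exp ((B + E) * norm z)" "D * exp (E * norm z) \<le> D * exp ((B + E) * norm z)"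
      using f(1,2) g(1,2) by (auto intro!: mult_left_mono mult_right_mono)
    then show "cmod (f z + g z) \<le> (C + D) * exp ((B + E) * norm z)"
      using norm_triangle_ineq[of "f z" "g z"] f(3)[of z] g(3)[of z] unfolding distrib_right[of C D] by linarith
  qed (use f g in auto)
qed

lemma exp_bounded_mult:
  fixes f g :: "'a::real_normed_vector \<Rightarrow> complex"
  assumes "exp_bounded f" "exp_bounded g" shows "exp_bounded (\<lambda>z. f z * g z)"
proof -
  obtain C B where f: "C \<ge> 0" "B \<ge> 0" "\<And>z. cmod (f z) \<le> C * exp (B * norm z)"
    using assms(1) unfolding exp_bounded_def by blast
  obtain D E where g: "D \<ge> 0" "E \<ge> 0" "\<And>z. cmod (g z) \<le> D * exp (E * norm z)"
    using assms(2) unfolding exp_bounded_def by blast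
  show ?thesis
  proof (rule exp_boundedI[of "C * D" "B + E"])
    fix z :: 'a
    have "cmod (f z * g z) \<le> (C * exp (B * norm z)) * (D * exp (E * norm z))"
      unfolding norm_mult using f g by (intro mult_mono) auto
    then show "cmod (f z * g z) \<le> (C * D) * exp ((B + E) * norm z)"
      by (simp add: algebra_simps exp_add)
  qed (use f g in auto)
qed

lemma exp_bounded_uminus: "exp_bounded f \<Longrightarrow> exp_bounded (\<lambda>z. - f z)"
  by (simp add: exp_bounded_def)

lemma exp_bounded_diff: "exp_bounded f \<Longrightarrow> exp_bounded g \<Longrightarrow> exp_bounded (\<lambda>z. f z - g z)"
  using exp_bounded_add[of f "\<lambda>z. - g z"] exp_bounded_uminus[of g] by simp

lemma exp_bounded_cnj: "exp_bounded f \<Longrightarrow> exp_bounded (\<lambda>z. cnj (f z))"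
  by (simp add: exp_bounded_def)

lemma exp_bounded_hermite_poly:
  assumes f: "\<And>z. cmod (f z) \<le> norm z"
  shows "exp_bounded (\<lambda>z. hermite_poly k (f z))"
proof (induction k rule: less_induct)
  case (less k)
  consider "k = 0" | "k = 1" | j where "k = Suc (Suc j)" by (metis One_nat_def not0_implies_Suc)
  then show ?case
  proof cases
    case (3 j)
    then have "exp_bounded (\<lambda>z. 2 * f z * hermite_poly (Suc j) (f z) - 2 * of_nat (Suc j) * hermite_poly j (f z))"
      using less by (intro exp_bounded_diff exp_bounded_mult exp_bounded_const exp_bounded_linear[OF f]) auto
    then show ?thesis using 3 by simp
  qed (auto intro!: exp_bounded_const exp_bounded_mult exp_bounded_linear[OF f])
qed

lemma integrable_exp_bounded_gaussian:
  fixes f w :: "'a::euclidean_space \<Rightarrow> complex"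
  assumes f: "exp_bounded f" "f \<in> borel_measurable borel" and w: "w \<in> borel_measurable borel"
    and c: "c > 0" "\<And>z. cmod (w z) \<le> exp (- c * (norm z)\<^sup>2)"
  shows "integrable lborel (\<lambda>z. f z * w z)"
proof -
  obtain C B where C: "C \<ge> 0" "B \<ge> 0" "\<And>z. cmod (f z) \<le> C * exp (B * norm z)"
    using f(1) unfolding exp_bounded_def by blast
  show ?thesis
  proof (rule integrable_gaussian_bound[OF _ c(1)])
    show "(\<lambda>z. f z * w z) \<in> borel_measurable borel" using f w by measurable
    fix z
    have "norm (f z * w z) \<le> (C * exp (B * norm z)) * exp (- c * (norm z)\<^sup>2)"
      unfolding norm_mult using C c by (intro mult_mono) auto
    then show "norm (f z * w z) \<le> C * exp (B * norm z - c * (norm z)\<^sup>2)"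
      by (simp add: exp_diff exp_minus divide_inverse mult.assoc)
  qed
qed

text \<open>Both orthogonality relations come out of the same recursion for the Gram matrix: \<open>q = 1\<close> on the line
  and \<open>q = e^(4 t)\<close> on the plane.\<close>

lemma hermite_moment_recursion:
  fixes A :: "nat \<Rightarrow> nat \<Rightarrow> complex"
  assumes rec: "\<And>k l. A (Suc k) l = 2 * of_nat l * q * A k (l - 1)"
    and zero: "\<And>l. l > 0 \<Longrightarrow> A 0 l = 0"
  shows "A k l = (if k = l then (2 * q) ^ k * fact k * A 0 0 else 0)"
proof (induction k arbitrary: l)
  case 0
  then show ?case using zero by auto
next
  case (Suc k)
  show ?case
  proof (cases l)
    case 0
    then show ?thesis by (simp add: rec)
  next
    case (Suc j)
    then show ?thesis by (simp add: rec Suc.IH)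
  qed
qed

text \<open>The integral of the derivative of \<open>H\<^sub>k H\<^sub>l e^(- x\<^sup>2)\<close> vanishes, and \<open>2 x H\<^sub>k - H\<^sub>k' = H\<^sub>k\<^sub>+\<^sub>1\<close>.\<close>

lemma hermite_poly_orthogonal_real:
  "(LINT x|lborel. hermite_poly k (complex_of_real x) * cnj (hermite_poly l (complex_of_real x)) * of_real (exp (- x\<^sup>2)))
    = (if k = l then 2 ^ k * fact k * of_real (sqrt pi) else 0)"
proof -
  define h where "h k x = hermite_poly k (complex_of_real x)" for k x
  define w where "w x = exp (- (complex_of_real x)\<^sup>2)" for x :: real
  have w_real: "w x = complex_of_real (exp (- x\<^sup>2))" for x by (simp add: w_def exp_of_real[symmetric])
  define A where "A k l = (LINT x|lborel. h k x * h l x * w x)" for k l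
  have cont: "continuous_on UNIV (h k)" for k unfolding h_def[abs_def] by (intro continuous_intros)
  have wcont: "continuous_on UNIV w" unfolding w_def[abs_def] by (intro continuous_intros)
  note bm = borel_measurable_continuous_onI[OF cont] borel_measurable_continuous_onI[OF wcont]
  have eb: "exp_bounded (h k)" for k unfolding h_def by (rule exp_bounded_hermite_poly) simp
  have wb: "cmod (w x) \<le> exp (- 1 * (norm x)\<^sup>2)" for x unfolding w_real by simp
  have int: "integrable lborel (\<lambda>x. h k x * h l x * w x)" for k l
    using bm by (intro integrable_exp_bounded_gaussian[of _ w 1] exp_bounded_mult eb wb) auto
  have cnjh: "cnj (h k x) = h k x" for k x by (simp add: h_def hermite_poly_of_real)
  have rec: "A (Suc k) l = 2 * of_nat l * 1 * A k (l - 1)" for k l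
  proof -
    define X where "X x = (2 * of_nat k * h (k - 1) x * h l x + h k x * (2 * of_nat l * h (l - 1) x) - 2 * of_real x * h k x * h l x)" for x
    have ebX: "exp_bounded X" unfolding X_def by (intro exp_bounded_diff exp_bounded_add exp_bounded_mult exp_bounded_const eb exp_bounded_linear) auto
    obtain C B where X: "C \<ge> 0" "B \<ge> 0" "\<And>z. cmod (X z) \<le> C * exp (B * norm z)"
      using ebX unfolding exp_bounded_def by blast
    have "exp_bounded (\<lambda>x. h k x * h l x)" by (intro exp_bounded_mult eb)
    then obtain D E where h: "D \<ge> 0" "E \<ge> 0" "\<And>z. cmod (h k z * h l z) \<le> D * exp (E * norm z)"
      unfolding exp_bounded_def by blast
    have bound: "norm (f x * w x) \<le> C * exp (B * \<bar>x\<bar> - 1 * x\<^sup>2)" if "\<And>z. cmod (f z) \<le> C * exp (B * norm z)" for f C B x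
    proof -
      have "norm (f x * w x) \<le> (C * exp (B * norm x)) * exp (- x\<^sup>2)"
        unfolding norm_mult using that[of x] wb[of x] by (intro mult_mono) (auto intro: order_trans[OF norm_ge_zero])
      then show ?thesis by (simp add: exp_diff exp_minus divide_inverse mult.assoc)
    qed
    have "(LINT x|lborel. X x * w x) = 0"
    proof (rule integral_derivative_eq_0[of 1 "\<lambda>x. h k x * h l x * w x"])
      show "continuous_on UNIV (\<lambda>x. X x * w x)"
        unfolding X_def by (intro continuous_intros cont wcont)
      fix x
      have "((\<lambda>z. hermite_poly k z * hermite_poly l z * exp (- z\<^sup>2)) has_field_derivative X x * w x) (at (complex_of_real x))"
        by (auto intro!: derivative_eq_intros DERIV_hermite_poly simp: X_def h_def w_def algebra_simps)
      from has_vector_derivative_real_field[OF this]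
      show "((\<lambda>x. h k x * h l x * w x) has_vector_derivative X x * w x) (at x)"
        by (simp add: h_def w_def)
      show "norm (h k x * h l x * w x) \<le> D * exp (E * \<bar>x\<bar> - 1 * x\<^sup>2)"
        by (rule bound) (rule h(3))
      show "norm (X x * w x) \<le> C * exp (B * \<bar>x\<bar> - 1 * x\<^sup>2)"
        by (rule bound) (rule X(3))
    qed simp
    then have "0 = - (LINT x|lborel. X x * w x)" by simp
    also have "\<dots> = (LINT x|lborel. h (Suc k) x * h l x * w x - 2 * of_nat l * (h k x * h (l - 1) x * w x))"
      unfolding integral_minus[symmetric] X_def
      by (intro Bochner_Integration.integral_cong refl) (simp add: h_def hermite_poly_Suc[of k] algebra_simps)
    also have "\<dots> = A (Suc k) l - 2 * of_nat l * A k (l - 1)"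
      unfolding A_def by (subst Bochner_Integration.integral_diff) (use int in auto)
    finally show ?thesis by simp
  qed
  have sym: "A k l = A l k" for k l unfolding A_def by (simp add: mult_ac)
  have zero: "A 0 l = 0" if "l > 0" for l
    using that sym[of 0 l] rec[of "l - 1" 0] by simp
  have "A 0 0 = of_real (sqrt pi)"
    unfolding A_def h_def w_real by (simp add: integral_complex_of_real integral_gaussian_real)
  then show ?thesis
    using hermite_moment_recursion[of A 1 k l, OF rec zero]
    by (simp add: A_def h_def[symmetric] w_real[symmetric] cnjh)
qed

lemma integral_continuous_pos:
  fixes f :: "'a::euclidean_space \<Rightarrow> real"
  assumes "integrable lborel f" "\<And>x. f x > 0"
  shows "(LINT x|lborel. f x) > 0"
proof -
  have "(LINT x|lborel. f x) \<ge> 0" using assms by (intro integral_nonneg_AE) (auto intro: less_imp_le)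
  moreover have "(LINT x|lborel. f x) \<noteq> 0"
  proof
    assume "(LINT x|lborel. f x) = 0"
    then have "AE x in lborel. f x = 0"
      using assms by (subst (asm) integral_nonneg_eq_0_iff_AE) (auto intro: less_imp_le)
    then have "AE x in (lborel :: 'a measure). False"
      by eventually_elim (use assms(2) in \<open>metis less_irrefl\<close>)
    then have "emeasure lborel (UNIV :: 'a set) = 0" by (simp add: AE_iff_null null_sets_def)
    then show False by simp
  qed
  ultimately show ?thesis by simp
qed

text \<open>Let \<open>P = H\<^sub>k\<close> and let \<open>Q\<close> be the conjugate of \<open>H\<^sub>l\<close>. Integrating the partial derivatives of \<open>P Q w\<close> in
  both real directions gives two relations. Their combination with weights \<open>1 / a\<close> and \<open>\<i> / b\<close> turns
  \<open>2 x + 2 \<i> y\<close> into \<open>2 z\<close>, and \<open>1 / a - 1 / b = 1\<close> is exactly the condition under which \<open>P' Q\<close> gets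
  the coefficient needed to form \<open>2 z P - P' = H\<^sub>k\<^sub>+\<^sub>1\<close>.\<close>

lemma hermite_poly_orthogonal_complex:
  assumes a: "a > 0" and b: "b > 0" and ab: "1 / a - 1 / b = (1::real)"
  obtains K where "K > 0"
    "\<And>k l. (LINT z|lborel. hermite_poly k z * cnj (hermite_poly l z) * complex_of_real (exp (- a * (Re z)\<^sup>2 - b * (Im z)\<^sup>2)))
        = (if k = l then of_real ((2 * (1 / a + 1 / b)) ^ k * fact k * K) else 0)"
proof -
  define w where "w z = complex_of_real (exp (- a * (Re z)\<^sup>2 - b * (Im z)\<^sup>2))" for z
  define A where "A k l = (LINT z|lborel. hermite_poly k z * cnj (hermite_poly l z) * w z)" for k l
  define q where "q = complex_of_real (1 / a + 1 / b)"
  \<comment> \<open>The weight lies below the radial Gaussian with the smaller of the two exponents.\<close>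
  define c where "c = min a b"
  have c: "c > 0" "c \<le> a" "c \<le> b" using a b by (auto simp: c_def)
  have cont: "continuous_on UNIV (hermite_poly k :: complex \<Rightarrow> complex)" for k by (intro continuous_intros)
  have wcont: "continuous_on UNIV w" unfolding w_def[abs_def] by (intro continuous_intros)
  have bm: "(\<lambda>z. hermite_poly k z :: complex) \<in> borel_measurable borel" "w \<in> borel_measurable borel" for k
    using borel_measurable_continuous_onI[OF cont] borel_measurable_continuous_onI[OF wcont] by auto
  have eb: "exp_bounded (\<lambda>z::complex. hermite_poly k z)" for k by (rule exp_bounded_hermite_poly) simp
  have ebc: "exp_bounded (\<lambda>z::complex. cnj (hermite_poly k z))" for k by (rule exp_bounded_cnj[OF eb])
  have wb: "cmod (w z) \<le> exp (- c * (norm z)\<^sup>2)" for z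
  proof -
    have "c * (norm z)\<^sup>2 \<le> a * (Re z)\<^sup>2 + b * (Im z)\<^sup>2"
      unfolding cmod_power2 distrib_left using c by (intro add_mono mult_right_mono) auto
    then show ?thesis unfolding w_def by simp
  qed
  have int: "integrable lborel (\<lambda>z. f z * w z)" if "exp_bounded f" "continuous_on UNIV f" for f
    using that bm by (intro integrable_exp_bounded_gaussian[OF _ _ _ c(1) wb]) (auto intro: borel_measurable_continuous_onI)
  have int2: "integrable lborel (\<lambda>z. hermite_poly k z * cnj (hermite_poly l z) * w z)" for k l
    by (intro int exp_bounded_mult eb ebc continuous_intros)
  have rec: "A (Suc k) l = 2 * of_nat l * q * A k (l - 1)" for k l
  proof -
    define P where "P = (\<lambda>z::complex. hermite_poly k z)"
    define P' where "P' z = 2 * of_nat k * hermite_poly (k - 1) z" for z :: complex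
    define Q where "Q z = cnj (hermite_poly l z)" for z
    define Q' where "Q' z = 2 * of_nat l * cnj (hermite_poly (l - 1) z)" for z
    define X where "X z = P' z * Q z + P z * Q' z - 2 * of_real a * of_real (Re z) * P z * Q z" for z
    define Y where "Y z = \<i> * P' z * Q z - \<i> * P z * Q' z - 2 * of_real b * of_real (Im z) * P z * Q z" for z
    have ePQ: "exp_bounded P" "exp_bounded P'" "exp_bounded Q" "exp_bounded Q'"
      unfolding P_def P'_def Q_def Q'_def by (intro exp_bounded_mult exp_bounded_const eb ebc)+
    have re: "exp_bounded (\<lambda>z. complex_of_real (Re z))" "exp_bounded (\<lambda>z. complex_of_real (Im z))"
      by (rule exp_bounded_linear, simp add: abs_Re_le_cmod abs_Im_le_cmod)+
    have cPQ: "continuous_on UNIV P" "continuous_on UNIV P'" "continuous_on UNIV Q" "continuous_on UNIV Q'"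
      unfolding P_def P'_def Q_def Q'_def by (intro continuous_intros)+
    have eX: "exp_bounded X" and eY: "exp_bounded Y" and eF: "exp_bounded (\<lambda>z. P z * Q z)"
      unfolding X_def Y_def by (intro exp_bounded_diff exp_bounded_add exp_bounded_mult exp_bounded_const ePQ re)+
    have cX: "continuous_on UNIV X" and cY: "continuous_on UNIV Y"
      unfolding X_def Y_def by (intro continuous_intros cPQ)+
    have bound: "norm (f z * w z) \<le> C * exp (B * norm z - c * (norm z)\<^sup>2)" if "\<And>z. cmod (f z) \<le> C * exp (B * norm z)" for f C B z
    proof -
      have "norm (f z * w z) \<le> (C * exp (B * norm z)) * exp (- c * (norm z)\<^sup>2)"
        unfolding norm_mult using that[of z] wb by (intro mult_mono) (auto intro: order_trans[OF norm_ge_zero])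
      then show ?thesis by (simp add: exp_diff exp_minus divide_inverse mult.assoc)
    qed
    have dx: "((\<lambda>x. P (Complex x y) * Q (Complex x y) * w (Complex x y)) has_vector_derivative X (Complex x y) * w (Complex x y)) (at x)" for x y
    proof -
      have z: "((\<lambda>x. Complex x y) has_vector_derivative 1) (at x)"
        unfolding Complex_eq by (auto intro!: derivative_eq_intros simp: has_vector_derivative_of_real)
      have p: "((\<lambda>x. hermite_poly j (Complex x y)) has_vector_derivative 2 * of_nat j * hermite_poly (j - 1) (Complex x y)) (at x)" for j
        using field_vector_diff_chain_at[OF z DERIV_hermite_poly] by (simp add: o_def)
      have "((\<lambda>x. exp (- a * x\<^sup>2 - b * y\<^sup>2)) has_real_derivative exp (- a * x\<^sup>2 - b * y\<^sup>2) * (- 2 * a * x)) (at x)"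
        by (auto intro!: derivative_eq_intros)
      from has_vector_derivative_of_real[OF this]
      have w: "((\<lambda>x. w (Complex x y)) has_vector_derivative w (Complex x y) * of_real (- 2 * a * x)) (at x)"
        by (simp add: w_def)
      show ?thesis
        unfolding P_def Q_def
        using has_vector_derivative_mult[OF has_vector_derivative_mult[OF p[of k] has_vector_derivative_cnj[OF p[of l]]] w]
        by (rule has_vector_derivative_eq_rhs) (simp add: P_def Q_def P'_def Q'_def X_def algebra_simps)
    qed
    have dy: "((\<lambda>y. P (Complex x y) * Q (Complex x y) * w (Complex x y)) has_vector_derivative Y (Complex x y) * w (Complex x y)) (at y)" for x y
    proof -
      have z: "((\<lambda>y. Complex x y) has_vector_derivative \<i>) (at y)"
        unfolding Complex_eq by (auto intro!: derivative_eq_intros simp: has_vector_derivative_of_real)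
      have p: "((\<lambda>y. hermite_poly j (Complex x y)) has_vector_derivative \<i> * (2 * of_nat j * hermite_poly (j - 1) (Complex x y))) (at y)" for j
        using field_vector_diff_chain_at[OF z DERIV_hermite_poly] by (simp add: o_def)
      have "((\<lambda>y. exp (- a * x\<^sup>2 - b * y\<^sup>2)) has_real_derivative exp (- a * x\<^sup>2 - b * y\<^sup>2) * (- 2 * b * y)) (at y)"
        by (auto intro!: derivative_eq_intros)
      from has_vector_derivative_of_real[OF this]
      have w: "((\<lambda>y. w (Complex x y)) has_vector_derivative w (Complex x y) * of_real (- 2 * b * y)) (at y)"
        by (simp add: w_def)
      show ?thesis
        unfolding P_def Q_def
        using has_vector_derivative_mult[OF has_vector_derivative_mult[OF p[of k] has_vector_derivative_cnj[OF p[of l]]] w]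
        by (rule has_vector_derivative_eq_rhs) (simp add: P_def Q_def P'_def Q'_def Y_def algebra_simps)
    qed
    obtain C1 B1 where 1: "C1 \<ge> 0" "B1 \<ge> 0" "\<And>z. cmod (P z * Q z) \<le> C1 * exp (B1 * norm z)"
      using eF unfolding exp_bounded_def by blast
    obtain C2 B2 where 2: "C2 \<ge> 0" "B2 \<ge> 0" "\<And>z. cmod (X z) \<le> C2 * exp (B2 * norm z)"
      using eX unfolding exp_bounded_def by blast
    obtain C3 B3 where 3: "C3 \<ge> 0" "B3 \<ge> 0" "\<And>z. cmod (Y z) \<le> C3 * exp (B3 * norm z)"
      using eY unfolding exp_bounded_def by blast
    have X0: "(LINT z|lborel. X z * w z) = 0"
      by (rule integral_complex_partial_eq_0(1)[OF c(1) 1(2,1) 2(2,1) bound[OF 1(3)] bound[OF 2(3)] _ dx])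
         (intro continuous_intros cX wcont)
    have Y0: "(LINT z|lborel. Y z * w z) = 0"
      by (rule integral_complex_partial_eq_0(2)[OF c(1) 1(2,1) 3(2,1) bound[OF 1(3)] bound[OF 3(3)] _ dy])
         (intro continuous_intros cY wcont)
    have id: "hermite_poly (Suc k) z * cnj (hermite_poly l z) - 2 * of_nat l * q * (hermite_poly k z * cnj (hermite_poly (l - 1) z))
        = - (1 / of_real a) * X z - (\<i> / of_real b) * Y z" for z
    proof -
      have e1: "(1 / of_real a - 1 / of_real b :: complex) = 1"
        using ab by (metis of_real_1 of_real_diff of_real_divide)
      have nz: "complex_of_real a \<noteq> 0" "complex_of_real b \<noteq> 0" using a b by auto
      have zz: "z = of_real (Re z) + \<i> * of_real (Im z)" by (rule complex_eq)
      have "(1 / of_real a) * X z + (\<i> / of_real b) * Y z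
        = (1 / of_real a - 1 / of_real b) * (P' z * Q z) + (1 / of_real a + 1 / of_real b) * (P z * Q' z)
          - 2 * (of_real (Re z) + \<i> * of_real (Im z)) * P z * Q z"
        unfolding X_def Y_def using nz by (simp add: field_simps)
      also have "\<dots> = P' z * Q z + q * (P z * Q' z) - 2 * z * P z * Q z"
        unfolding e1 zz[symmetric] by (simp add: q_def)
      finally have "- (1 / of_real a) * X z - (\<i> / of_real b) * Y z = 2 * z * P z * Q z - P' z * Q z - q * (P z * Q' z)"
        by (simp add: algebra_simps)
      then show ?thesis by (simp add: hermite_poly_Suc[of k] P_def P'_def Q_def Q'_def algebra_simps)
    qed
    have "A (Suc k) l - 2 * of_nat l * q * A k (l - 1) =
       (LINT z|lborel. hermite_poly (Suc k) z * cnj (hermite_poly l z) * w z - 2 * of_nat l * q * (hermite_poly k z * cnj (hermite_poly (l - 1) z) * w z))"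
      unfolding A_def by (subst Bochner_Integration.integral_diff) (use int2 in auto)
    also have "\<dots> = (LINT z|lborel. - (1 / of_real a) * (X z * w z) - (\<i> / of_real b) * (Y z * w z))"
    proof (intro Bochner_Integration.integral_cong refl)
      fix z
      have "hermite_poly (Suc k) z * cnj (hermite_poly l z) * w z - 2 * of_nat l * q * (hermite_poly k z * cnj (hermite_poly (l - 1) z) * w z)
        = (hermite_poly (Suc k) z * cnj (hermite_poly l z) - 2 * of_nat l * q * (hermite_poly k z * cnj (hermite_poly (l - 1) z))) * w z"
        by (simp add: algebra_simps)
      also have "\<dots> = - (1 / of_real a) * (X z * w z) - (\<i> / of_real b) * (Y z * w z)"
        unfolding id by (simp add: algebra_simps)
      finally show "hermite_poly (Suc k) z * cnj (hermite_poly l z) * w z - 2 * of_nat l * q * (hermite_poly k z * cnj (hermite_poly (l - 1) z) * w z)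
         = - (1 / of_real a) * (X z * w z) - (\<i> / of_real b) * (Y z * w z)" .
    qed
    also have "\<dots> = - (1 / of_real a) * (LINT z|lborel. X z * w z) - (\<i> / of_real b) * (LINT z|lborel. Y z * w z)"
      by (subst Bochner_Integration.integral_diff) (use int[OF eX cX] int[OF eY cY] in auto)
    finally show ?thesis by (simp add: X0 Y0)
  qed
  have sym: "A k l = cnj (A l k)" for k l
    unfolding A_def by (subst Bochner_Integration.integral_cnj[symmetric]) (simp add: mult_ac w_def)
  have zero: "A 0 l = 0" if "l > 0" for l
    using that sym[of 0 l] rec[of "l - 1" 0] by simp
  define K where "K = (LINT z|lborel. exp (- a * (Re z)\<^sup>2 - b * (Im z)\<^sup>2))"
  have A00: "A 0 0 = of_real K"
    unfolding A_def w_def K_def by (simp only: hermite_poly.simps complex_cnj_one mult_1 integral_complex_of_real)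
  have "integrable lborel (\<lambda>z. 1 * w z)" by (intro int exp_bounded_const continuous_intros)
  then have "integrable lborel (\<lambda>z. Re (w z))" by simp
  then have "integrable lborel (\<lambda>z. exp (- a * (Re z)\<^sup>2 - b * (Im z)\<^sup>2))" by (simp add: w_def)
  then have K: "K > 0" unfolding K_def by (rule integral_continuous_pos) simp
  show ?thesis
  proof (rule that[OF K])
    fix k l
    show "(LINT z|lborel. hermite_poly k z * cnj (hermite_poly l z) * complex_of_real (exp (- a * (Re z)\<^sup>2 - b * (Im z)\<^sup>2)))
        = (if k = l then of_real ((2 * (1 / a + 1 / b)) ^ k * fact k * K) else 0)"
      using hermite_moment_recursion[of A q k l, OF rec zero] A00
      by (simp add: A_def w_def q_def)
  qed
qed

lemma hermite_ext_orthonormal_real: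
  "(LINT x|lborel. hermite_ext k (complex_of_real x) * cnj (hermite_ext l (complex_of_real x))) = (if k = l then 1 else 0)"
proof -
  have "hermite_ext k (complex_of_real x) * cnj (hermite_ext l (complex_of_real x)) =
      of_real (hermite_const k * hermite_const l) * (hermite_poly k (complex_of_real x) * cnj (hermite_poly l (complex_of_real x)) * of_real (exp (- x\<^sup>2)))" for x
  proof -
    have "exp (- (complex_of_real x)\<^sup>2 / 2) * cnj (exp (- (complex_of_real x)\<^sup>2 / 2)) = of_real (exp (- x\<^sup>2 / 2) * exp (- x\<^sup>2 / 2))"
      by (simp add: exp_cnj exp_of_real[symmetric])
    also have "exp (- x\<^sup>2 / 2) * exp (- x\<^sup>2 / 2) = exp (- x\<^sup>2)" by (simp add: exp_add[symmetric])
    finally show ?thesis by (simp add: hermite_ext_def mult_ac)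
  qed
  then have "(LINT x|lborel. hermite_ext k (complex_of_real x) * cnj (hermite_ext l (complex_of_real x))) =
      of_real (hermite_const k * hermite_const l) * (if k = l then 2 ^ k * fact k * of_real (sqrt pi) else 0)"
    by (simp add: hermite_poly_orthogonal_real)
  also have "\<dots> = (if k = l then 1 else 0)"
  proof -
    have "hermite_const k * hermite_const k * (2 ^ k * fact k * sqrt pi) = 1"
      by (simp add: hermite_const_def)
    then have "complex_of_real (hermite_const k * hermite_const k * (2 ^ k * fact k * sqrt pi)) = 1" by simp
    then show ?thesis by (auto simp: mult_ac)
  qed
  finally show ?thesis .
qed

text \<open>The Bochner integral of a function that is not integrable is 0 by convention, so a nonzero value
  proves integrability. This gives square integrability of the Hermite functions from their norms.\<close>

lemma integrable_if_integral_nonzero: "integral\<^sup>L M f \<noteq> 0 \<Longrightarrow> integrable M f"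
  using not_integrable_integral_eq by blast

lemma sq_int_if_nonzero:
  assumes "f \<in> borel_measurable M" "inner_prod M f f \<noteq> 0"
  shows "sq_int M f"
proof -
  have "integrable M (\<lambda>x. f x * cnj (f x))"
    using assms(2) unfolding inner_prod_def by (rule integrable_if_integral_nonzero)
  then have "integrable M (\<lambda>x. Re (f x * cnj (f x)))" by (rule integrable_Re)
  moreover have "Re (f x * cnj (f x)) = (cmod (f x))\<^sup>2" for x
    by (simp only: complex_norm_square[symmetric] Re_complex_of_real)
  ultimately show ?thesis using assms(1) by (simp add: sq_int_def)
qed

lemma hermite_ons: "graded_ons (lborel :: (real^'n) measure) multi_hermite_fun total_deg"
proof
  fix \<alpha> \<beta> :: "'n \<Rightarrow> nat"
  have meas: "(multi_hermite_fun \<alpha> :: real^'n \<Rightarrow> complex) \<in> borel_measurable lborel" for \<alpha>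
  proof -
    have "continuous_on UNIV (\<lambda>x::real^'n. multi_hermite_ext \<alpha> (complex_vec x))"
      unfolding complex_vec_def by (intro continuous_intros)
    then show ?thesis using borel_measurable_continuous_onI by (auto simp: multi_hermite_fun_eq[abs_def])
  qed
  have int: "integrable lborel (\<lambda>x. hermite_ext k (complex_of_real x) * cnj (hermite_ext l (complex_of_real x)))" for k l
  proof -
    have "sq_int lborel (\<lambda>x. hermite_ext k (complex_of_real x))" for k
    proof (rule sq_int_if_nonzero)
      have "continuous_on UNIV (\<lambda>x. hermite_ext k (complex_of_real x))" by (intro continuous_intros)
      then show "(\<lambda>x. hermite_ext k (complex_of_real x)) \<in> borel_measurable lborel"
        using borel_measurable_continuous_onI by auto
    qed (simp add: inner_prod_def hermite_ext_orthonormal_real)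
    then show ?thesis by (intro sq_int_mult)
  qed
  have orth: "inner_prod lborel (multi_hermite_fun \<alpha> :: real^'n \<Rightarrow> complex) (multi_hermite_fun \<beta>) = (if \<alpha> = \<beta> then 1 else 0)" for \<alpha> \<beta>
  proof -
    have "inner_prod lborel (multi_hermite_fun \<alpha> :: real^'n \<Rightarrow> complex) (multi_hermite_fun \<beta>) =
       (LINT x|lborel. (\<Prod>i\<in>UNIV. (\<lambda>y. hermite_ext (\<alpha> i) (complex_of_real y) * cnj (hermite_ext (\<beta> i) (complex_of_real y))) ((x :: real^'n) $ i)))"
      by (simp add: inner_prod_def multi_hermite_fun_eq multi_hermite_ext_def complex_vec_def prod.distrib)
    also have "\<dots> = (\<Prod>i\<in>UNIV. if \<alpha> i = \<beta> i then 1 else 0)"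
      by (subst integral_lborel_vec_prod) (auto simp: int hermite_ext_orthonormal_real)
    also have "\<dots> = (if \<alpha> = \<beta> then 1 else 0)"
      by (auto simp: fun_eq_iff)
    finally show ?thesis .
  qed
  show "inner_prod lborel (multi_hermite_fun \<alpha> :: real^'n \<Rightarrow> complex) (multi_hermite_fun \<beta>) = (if \<alpha> = \<beta> then 1 else 0)"
    by (rule orth)
  show "sq_int lborel (multi_hermite_fun \<alpha> :: real^'n \<Rightarrow> complex)"
    by (rule sq_int_if_nonzero[OF meas]) (simp add: orth)
  show "finite {\<alpha> :: 'n \<Rightarrow> nat. total_deg \<alpha> = k}" for k by (rule finite_total_deg)
qed

text \<open>The weight becomes part of the measure, so that the results on general measures apply to \<open>HL2 t\<close>.\<close>

definition U_measure :: "real \<Rightarrow> (complex^'n) measure" where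
  "U_measure t = density lborel (\<lambda>z. ennreal (U_weight t z))"

lemma U_weight_pos: "t > 0 \<Longrightarrow> U_weight t z > 0"
  by (simp add: U_weight_def)

lemma U_weight_measurable [measurable]: "U_weight t \<in> borel_measurable borel"
proof -
  have "continuous_on UNIV (U_weight t :: complex^'n \<Rightarrow> real)"
    unfolding U_weight_def Im_vec_def Re_vec_def by (intro continuous_intros)
  then show ?thesis by (rule borel_measurable_continuous_onI)
qed

lemma integral_U_measure:
  fixes f :: "complex^'n \<Rightarrow> 'b::{banach,second_countable_topology}"
  assumes "t > 0" "f \<in> borel_measurable borel"
  shows "integral\<^sup>L (U_measure t) f = (LINT z|lborel. U_weight t z *\<^sub>R f z)"
  unfolding U_measure_def using assms U_weight_pos[OF assms(1)]
  by (intro integral_density) (auto intro: less_imp_le)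

lemma integrable_U_measure:
  fixes f :: "complex^'n \<Rightarrow> 'b::{banach,second_countable_topology}"
  assumes "t > 0" "f \<in> borel_measurable borel"
  shows "integrable (U_measure t) f \<longleftrightarrow> integrable lborel (\<lambda>z. U_weight t z *\<^sub>R f z)"
  unfolding U_measure_def using assms U_weight_pos[OF assms(1)]
  by (intro integrable_density) (auto intro: less_imp_le)

definition U_weight_1 :: "real \<Rightarrow> complex \<Rightarrow> real" where
  "U_weight_1 t z = 2 * sinh (4 * t) powr (- 1 / 2) * exp (- (cosh (2 * t) / sinh (2 * t)) * (Im z)\<^sup>2 + tanh (2 * t) * (Re z)\<^sup>2)"

lemma U_weight_prod:
  assumes "t > 0"
  shows "U_weight t z = (\<Prod>i\<in>UNIV. U_weight_1 t ((z :: complex^'n) $ i))"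
proof -
  have "(\<Sum>i\<in>UNIV. - (cosh (2 * t) / sinh (2 * t)) * (Im (z $ i))\<^sup>2 + tanh (2 * t) * (Re (z $ i))\<^sup>2)
     = - (cosh (2 * t) / sinh (2 * t)) * (norm (Im_vec z))\<^sup>2 + tanh (2 * t) * (norm (Re_vec z))\<^sup>2"
    by (simp add: sum.distrib sum_subtractf sum_negf sum_distrib_left sum_divide_distrib norm_vec_def L2_set_def sum_nonneg
        Im_vec_def Re_vec_def)
  moreover have "(sinh (4 * t) powr (- 1 / 2)) ^ CARD('n) = sinh (4 * t) powr (- real CARD('n) / 2)"
    using assms by (simp add: powr_realpow[symmetric] powr_powr)
  ultimately show ?thesis
    unfolding U_weight_1_def U_weight_def prod.distrib exp_sum[OF finite, symmetric] by simp
qed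

text \<open>With \<open>T = tanh 2t\<close> the exponents of the weight are \<open>T\<close> and \<open>1 / T\<close>; after the factor \<open>|e^(- z\<^sup>2 / 2)|\<^sup>2\<close> is
  absorbed they become \<open>a = 1 - T\<close> and \<open>b = 1 / T - 1\<close>, for which \<open>1 / a + 1 / b = (1 + T) / (1 - T)\<close>.\<close>

lemma tanh_facts:
  fixes t :: real
  assumes t: "t > 0"
  defines "T \<equiv> tanh (2 * t)"
  shows "0 < T" "T < 1" "cosh (2 * t) / sinh (2 * t) = 1 / T" "(1 + T) / (1 - T) = exp (4 * t)"
proof -
  show "0 < T" "T < 1" using t by (auto simp: T_def tanh_real_lt_1)
  show "cosh (2 * t) / sinh (2 * t) = 1 / T" by (simp add: T_def tanh_def)
  have "1 + T = exp (2 * t) / cosh (2 * t)" "1 - T = exp (- (2 * t)) / cosh (2 * t)"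
    unfolding T_def tanh_def by (simp_all add: field_simps cosh_plus_sinh cosh_minus_sinh)
  then have "(1 + T) / (1 - T) = exp (2 * t) / exp (- (2 * t))" by simp
  also have "\<dots> = exp (4 * t)" by (simp add: exp_diff[symmetric])
  finally show "(1 + T) / (1 - T) = exp (4 * t)" .
qed

lemma hermite_ext_orthogonal_complex:
  assumes t: "t > 0"
  obtains K where "K > 0"
    "\<And>k l. (LINT z|lborel. hermite_ext k z * cnj (hermite_ext l z) * of_real (U_weight_1 t z)) = (if k = l then of_real (K * exp (4 * t) ^ k) else 0)"
proof -
  define T where "T = tanh (2 * t)"
  note T = tanh_facts[OF t, folded T_def]
  define a where "a = 1 - T"
  define b where "b = 1 / T - 1"
  have ab: "a > 0" "b > 0" using T by (auto simp: a_def b_def field_simps)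
  have b': "b = a / T" using T by (simp add: a_def b_def field_simps)
  have 1: "1 / a - 1 / b = 1" "1 / a + 1 / b = exp (4 * t)"
    unfolding b' T(4)[symmetric] using ab(1) T by (simp_all add: a_def field_simps)
  obtain K where K: "K > 0"
    "\<And>k l. (LINT z|lborel. hermite_poly k z * cnj (hermite_poly l z) * complex_of_real (exp (- a * (Re z)\<^sup>2 - b * (Im z)\<^sup>2)))
        = (if k = l then of_real ((2 * (1 / a + 1 / b)) ^ k * fact k * K) else 0)"
    using hermite_poly_orthogonal_complex[OF ab 1(1)] by blast
  define S where "S = 2 * sinh (4 * t) powr (- 1 / 2)"
  have S: "S > 0" using t by (simp add: S_def)
  have pt: "hermite_ext k z * cnj (hermite_ext l z) * of_real (U_weight_1 t z) =
      of_real (hermite_const k * hermite_const l * S) * (hermite_poly k z * cnj (hermite_poly l z) * complex_of_real (exp (- a * (Re z)\<^sup>2 - b * (Im z)\<^sup>2)))" for k l z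
  proof -
    have "exp (- z\<^sup>2 / 2) * cnj (exp (- z\<^sup>2 / 2)) = of_real ((cmod (exp (- z\<^sup>2 / 2)))\<^sup>2)"
      by (simp only: complex_norm_square)
    also have "(cmod (exp (- z\<^sup>2 / 2)))\<^sup>2 = exp (- (Re z)\<^sup>2 + (Im z)\<^sup>2)"
      by (simp add: power2_eq_square exp_add[symmetric] algebra_simps)
    finally have e: "exp (- z\<^sup>2 / 2) * cnj (exp (- z\<^sup>2 / 2)) = of_real (exp (- (Re z)\<^sup>2 + (Im z)\<^sup>2))" .
    have e2: "exp (- (Re z)\<^sup>2 + (Im z)\<^sup>2) * exp (- (1 / T) * (Im z)\<^sup>2 + T * (Re z)\<^sup>2) = exp (- a * (Re z)\<^sup>2 - b * (Im z)\<^sup>2)"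
      by (simp add: exp_add[symmetric] a_def b_def algebra_simps)
    have "exp (- (Re z)\<^sup>2 + (Im z)\<^sup>2) * U_weight_1 t z = S * exp (- a * (Re z)\<^sup>2 - b * (Im z)\<^sup>2)"
      unfolding U_weight_1_def T(3) T_def[symmetric] S_def[symmetric] e2[symmetric] by (rule mult.left_commute)
    then have "complex_of_real (exp (- (Re z)\<^sup>2 + (Im z)\<^sup>2)) * complex_of_real (U_weight_1 t z) = of_real (S * exp (- a * (Re z)\<^sup>2 - b * (Im z)\<^sup>2))"
      by (simp only: of_real_mult[symmetric])
    then have "(exp (- z\<^sup>2 / 2) * cnj (exp (- z\<^sup>2 / 2))) * complex_of_real (U_weight_1 t z) = of_real S * complex_of_real (exp (- a * (Re z)\<^sup>2 - b * (Im z)\<^sup>2))"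
      unfolding e of_real_mult .
    moreover have "hermite_ext k z * cnj (hermite_ext l z) * of_real (U_weight_1 t z) =
       of_real (hermite_const k * hermite_const l) * (hermite_poly k z * cnj (hermite_poly l z)) * ((exp (- z\<^sup>2 / 2) * cnj (exp (- z\<^sup>2 / 2))) * complex_of_real (U_weight_1 t z))"
      by (simp add: hermite_ext_def mult_ac)
    ultimately show ?thesis by (simp only: of_real_mult mult_ac)
  qed
  show ?thesis
  proof (rule that[of "S * K / sqrt pi"])
    show "S * K / sqrt pi > 0" using S K by simp
    fix k l
    have "(LINT z|lborel. hermite_ext k z * cnj (hermite_ext l z) * of_real (U_weight_1 t z)) =
        of_real (hermite_const k * hermite_const l * S) * (if k = l then of_real ((2 * exp (4 * t)) ^ k * fact k * K) else 0)"
      unfolding pt using K(2)[of k l] by (simp add: 1(2) del: of_real_mult of_real_power)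
    also have "\<dots> = (if k = l then of_real (S * K / sqrt pi * exp (4 * t) ^ k) else 0)"
    proof -
      have "hermite_const k * hermite_const k * S * ((2 * exp (4 * t)) ^ k * fact k * K) = S * K / sqrt pi * exp (4 * t) ^ k"
        by (simp add: hermite_const_def power_mult_distrib field_simps)
      then have "complex_of_real (hermite_const k * hermite_const k * S) * of_real ((2 * exp (4 * t)) ^ k * fact k * K) = of_real (S * K / sqrt pi * exp (4 * t) ^ k)"
        by (simp only: of_real_mult[symmetric])
      then show ?thesis by (cases "k = l") (simp_all only: if_True if_False mult_zero_right simp_thms)
    qed
    finally show "(LINT z|lborel. hermite_ext k z * cnj (hermite_ext l z) * of_real (U_weight_1 t z)) = (if k = l then of_real (S * K / sqrt pi * exp (4 * t) ^ k) else 0)" .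
  qed
qed

definition multi_hermite_U :: "real \<Rightarrow> real \<Rightarrow> ('n::finite \<Rightarrow> nat) \<Rightarrow> complex^'n \<Rightarrow> complex" where
  "multi_hermite_U K t \<alpha> z = of_real (1 / sqrt (K * exp (4 * t) ^ total_deg \<alpha>)) * multi_hermite_ext \<alpha> z"

lemma multi_hermite_ext_measurable: "multi_hermite_ext \<alpha> \<in> borel_measurable borel"
  by (rule borel_measurable_continuous_onI) (intro continuous_intros)

text \<open>The squared norm of \<open>\<Phi>\<^sub>\<alpha>\<close> in \<open>L\<^sup>2(U\<^sub>t)\<close> is \<open>K q^|\<alpha>|\<close> with \<open>q = e^(4 t)\<close>, by the product structure of
  weight and basis.\<close>

lemma hermite_ons_U_measure:
  assumes t: "t > 0"
  obtains K where "K > 0" "graded_ons (U_measure t :: (complex^'n) measure) (multi_hermite_U K t) total_deg"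
proof -
  obtain K where K: "K > 0"
    "\<And>k l. (LINT z|lborel. hermite_ext k z * cnj (hermite_ext l z) * of_real (U_weight_1 t z)) = (if k = l then of_real (K * exp (4 * t) ^ k) else 0)"
    using hermite_ext_orthogonal_complex[OF t] by blast
  let ?K = "K ^ CARD('n)"
  have U_weight_1: "U_weight_1 t z > 0" for z using t by (simp add: U_weight_1_def)
  have root: "hermite_ext k z * of_real (sqrt (U_weight_1 t z)) * cnj (hermite_ext l z * of_real (sqrt (U_weight_1 t z))) = hermite_ext k z * cnj (hermite_ext l z) * of_real (U_weight_1 t z)" for k l z
  proof -
    have "sqrt (U_weight_1 t z) * sqrt (U_weight_1 t z) = U_weight_1 t z" using U_weight_1[of z] by simp
    then have "complex_of_real (sqrt (U_weight_1 t z)) * of_real (sqrt (U_weight_1 t z)) = of_real (U_weight_1 t z)"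
      by (simp only: of_real_mult[symmetric])
    moreover have "hermite_ext k z * of_real (sqrt (U_weight_1 t z)) * cnj (hermite_ext l z * of_real (sqrt (U_weight_1 t z))) =
        hermite_ext k z * cnj (hermite_ext l z) * (of_real (sqrt (U_weight_1 t z)) * of_real (sqrt (U_weight_1 t z)))"
      by simp
    ultimately show ?thesis by simp
  qed
  have int: "integrable lborel (\<lambda>z. hermite_ext k z * cnj (hermite_ext l z) * of_real (U_weight_1 t z))" for k l
  proof -
    have "sq_int lborel (\<lambda>z. hermite_ext k z * of_real (sqrt (U_weight_1 t z)))" for k
    proof (rule sq_int_if_nonzero)
      have "continuous_on UNIV (\<lambda>z. hermite_ext k z * of_real (sqrt (U_weight_1 t z)))"
        unfolding U_weight_1_def by (intro continuous_intros)
      then show "(\<lambda>z. hermite_ext k z * of_real (sqrt (U_weight_1 t z))) \<in> borel_measurable lborel"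
        using borel_measurable_continuous_onI by auto
      show "inner_prod lborel (\<lambda>z. hermite_ext k z * of_real (sqrt (U_weight_1 t z))) (\<lambda>z. hermite_ext k z * of_real (sqrt (U_weight_1 t z))) \<noteq> 0"
        unfolding inner_prod_def root K(2) using K(1) by simp
    qed
    from sq_int_mult[OF this this]
    have "integrable lborel (\<lambda>z. hermite_ext k z * of_real (sqrt (U_weight_1 t z)) * cnj (hermite_ext l z * of_real (sqrt (U_weight_1 t z))))" .
    then show ?thesis unfolding root .
  qed
  have orth: "inner_prod (U_measure t) (multi_hermite_ext \<alpha>) (multi_hermite_ext \<beta>) = (if \<alpha> = \<beta> then of_real (?K * exp (4 * t) ^ total_deg \<alpha>) else 0)" for \<alpha> \<beta> :: "'n \<Rightarrow> nat"
  proof -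
    have "inner_prod (U_measure t) (multi_hermite_ext \<alpha>) (multi_hermite_ext \<beta>) = (LINT z|lborel. U_weight t z *\<^sub>R (multi_hermite_ext \<alpha> z * cnj (multi_hermite_ext \<beta> z)))"
      unfolding inner_prod_def by (rule integral_U_measure[OF t]) (use multi_hermite_ext_measurable in measurable)
    also have "\<dots> = (LINT z|lborel. (\<Prod>i\<in>UNIV. (\<lambda>y. hermite_ext (\<alpha> i) y * cnj (hermite_ext (\<beta> i) y) * of_real (U_weight_1 t y)) (z $ i)))"
      by (simp add: U_weight_prod[OF t] multi_hermite_ext_def scaleR_conv_of_real prod.distrib mult_ac)
    also have "\<dots> = (\<Prod>i\<in>UNIV. if \<alpha> i = \<beta> i then of_real (K * exp (4 * t) ^ \<alpha> i) else 0)"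
      by (subst integral_lborel_vec_prod) (auto simp: int K(2))
    also have "\<dots> = (if \<alpha> = \<beta> then of_real (?K * exp (4 * t) ^ total_deg \<alpha>) else 0)"
    proof (cases "\<alpha> = \<beta>")
      case True
      then show ?thesis by (simp add: prod.distrib total_deg_def power_sum)
    next
      case False
      then obtain i where "\<alpha> i \<noteq> \<beta> i" by auto
      then show ?thesis using False by (auto intro!: prod_zero)
    qed
    finally show ?thesis .
  qed
  have K': "?K > 0" using K by simp
  have meas: "multi_hermite_U ?K t \<alpha> \<in> borel_measurable (U_measure t)" for \<alpha> :: "'n \<Rightarrow> nat"
    unfolding multi_hermite_U_def[abs_def] U_measure_def using multi_hermite_ext_measurable[of \<alpha>] by simp
  have orthU: "inner_prod (U_measure t) (multi_hermite_U ?K t \<alpha>) (multi_hermite_U ?K t \<beta>) = (if \<alpha> = \<beta> then 1 else 0)" for \<alpha> \<beta> :: "'n \<Rightarrow> nat"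
  proof -
    have "inner_prod (U_measure t) (multi_hermite_U ?K t \<alpha>) (multi_hermite_U ?K t \<beta>) =
        of_real (1 / sqrt (?K * exp (4 * t) ^ total_deg \<alpha>)) * (of_real (1 / sqrt (?K * exp (4 * t) ^ total_deg \<beta>)) * inner_prod (U_measure t) (multi_hermite_ext \<alpha>) (multi_hermite_ext \<beta>))"
      unfolding multi_hermite_U_def[abs_def] inner_prod_cmult_left inner_prod_cmult_right by simp
    also have "\<dots> = (if \<alpha> = \<beta> then 1 else 0)"
    proof -
      define y where "y = ?K * exp (4 * t) ^ total_deg \<alpha>"
      have "y > 0" using K' by (simp add: y_def)
      then have "1 / sqrt y * (1 / sqrt y * y) = 1" by simp
      then have "complex_of_real (1 / sqrt y) * (of_real (1 / sqrt y) * of_real y) = 1"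
        by (metis of_real_1 of_real_mult)
      then show ?thesis unfolding orth y_def by auto
    qed
    finally show ?thesis .
  qed
  have "graded_ons (U_measure t :: (complex^'n) measure) (multi_hermite_U ?K t) total_deg"
  proof
    fix \<alpha> \<beta> :: "'n \<Rightarrow> nat"
    show "inner_prod (U_measure t) (multi_hermite_U ?K t \<alpha>) (multi_hermite_U ?K t \<beta>) = (if \<alpha> = \<beta> then 1 else 0)" by (rule orthU)
    show "sq_int (U_measure t) (multi_hermite_U ?K t \<alpha>)" by (rule sq_int_if_nonzero[OF meas]) (simp add: orthU)
    show "finite {\<alpha> :: 'n \<Rightarrow> nat. total_deg \<alpha> = k}" for k by (rule finite_total_deg)
  qed
  then show ?thesis using that[OF K'] by blast
qed

section \<open>Exponential series, Gaussian averages and mean values\<close>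

text \<open>The step that moves Gaussian exponents and produces exponentials of linear forms: a function
  orthogonal to all powers of \<open>\<omega>\<close> is orthogonal to \<open>e^\<omega>\<close>, by dominated convergence of the power series.\<close>

lemma integral_exp_eq_0:
  fixes h \<omega> :: "'a \<Rightarrow> complex"
  assumes h [measurable]: "h \<in> borel_measurable M" and \<omega> [measurable]: "\<omega> \<in> borel_measurable M"
    and int: "integrable M (\<lambda>x. cmod (h x) * exp (cmod (\<omega> x)))"
    and zero: "\<And>k. (LINT x|M. h x * \<omega> x ^ k) = 0"
  shows "integrable M (\<lambda>x. h x * exp (\<omega> x))" and "(LINT x|M. h x * exp (\<omega> x)) = 0"
proof -
  have term_le: "cmod (\<omega> x ^ k /\<^sub>R fact k) \<le> exp (cmod (\<omega> x))" for x k
  proof -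
    have "cmod (\<omega> x ^ k /\<^sub>R fact k) = (\<Sum>j\<in>{k}. cmod (\<omega> x) ^ j /\<^sub>R fact j)"
      by (simp add: norm_power divide_inverse)
    also have "\<dots> \<le> exp (cmod (\<omega> x))"
      unfolding exp_def by (rule sum_le_suminf[OF summable_exp_generic]) auto
    finally show ?thesis .
  qed
  have partial: "cmod (\<Sum>k<N. \<omega> x ^ k /\<^sub>R fact k) \<le> exp (cmod (\<omega> x))" for x N
  proof -
    have "cmod (\<Sum>k<N. \<omega> x ^ k /\<^sub>R fact k) \<le> (\<Sum>k<N. cmod (\<omega> x) ^ k /\<^sub>R fact k)"
      by (rule sum_norm_le) (simp add: norm_power)
    also have "\<dots> \<le> exp (cmod (\<omega> x))"
      unfolding exp_def by (rule sum_le_suminf[OF summable_exp_generic]) auto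
    finally show ?thesis .
  qed
  have e [measurable]: "(\<lambda>x. exp (\<omega> x)) \<in> borel_measurable M"
    by (rule measurable_compose[OF \<omega>]) (intro borel_measurable_continuous_onI continuous_intros)
  have i: "integrable M (\<lambda>x. h x * (\<omega> x ^ k /\<^sub>R fact k))" for k
  proof (rule Bochner_Integration.integrable_bound[OF int])
    show "AE x in M. norm (h x * (\<omega> x ^ k /\<^sub>R fact k)) \<le> norm (cmod (h x) * exp (cmod (\<omega> x)))"
      unfolding norm_mult[of "h _"] using term_le by (intro AE_I2) (auto intro!: mult_left_mono simp del: norm_scaleR)
  qed measurable
  have lim: "(\<lambda>N. LINT x|M. h x * (\<Sum>k<N. \<omega> x ^ k /\<^sub>R fact k)) \<longlonglongrightarrow> (LINT x|M. h x * exp (\<omega> x))"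
  proof (rule integral_dominated_convergence[OF _ _ int])
    show "AE x in M. (\<lambda>N. h x * (\<Sum>k<N. \<omega> x ^ k /\<^sub>R fact k)) \<longlonglongrightarrow> h x * exp (\<omega> x)"
      using exp_converges by (intro AE_I2 tendsto_mult tendsto_const) (auto simp: sums_def)
    show "AE x in M. norm (h x * (\<Sum>k<N. \<omega> x ^ k /\<^sub>R fact k)) \<le> cmod (h x) * exp (cmod (\<omega> x))" for N
      unfolding norm_mult using partial by (intro AE_I2 mult_left_mono) auto
  qed measurable
  show "integrable M (\<lambda>x. h x * exp (\<omega> x))"
  proof (rule Bochner_Integration.integrable_bound[OF int])
    show "AE x in M. norm (h x * exp (\<omega> x)) \<le> norm (cmod (h x) * exp (cmod (\<omega> x)))"
      using complex_Re_le_cmod by (intro AE_I2) (auto simp: norm_mult intro!: mult_left_mono)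
  qed measurable
  have "(LINT x|M. h x * (\<omega> x ^ k /\<^sub>R fact k)) = 0" for k
    using zero[of k] by (subst mult_scaleR_right, subst Bochner_Integration.integral_scaleR_right) simp
  then have "(LINT x|M. h x * (\<Sum>k<N. \<omega> x ^ k /\<^sub>R fact k)) = 0" for N
    unfolding sum_distrib_left by (subst Bochner_Integration.integral_sum) (use i in auto)
  with lim have "(\<lambda>N::nat. 0) \<longlonglongrightarrow> (LINT x|M. h x * exp (\<omega> x))" by simp
  then show "(LINT x|M. h x * exp (\<omega> x)) = 0" by (simp add: LIMSEQ_const_iff)
qed

inductive cpoly :: "(complex^'n \<Rightarrow> complex) \<Rightarrow> bool" where
  cpoly_const: "cpoly (\<lambda>z. c)"
| cpoly_nth: "cpoly (\<lambda>z. z $ i)"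
| cpoly_add: "cpoly p \<Longrightarrow> cpoly q \<Longrightarrow> cpoly (\<lambda>z. p z + q z)"
| cpoly_mult: "cpoly p \<Longrightarrow> cpoly q \<Longrightarrow> cpoly (\<lambda>z. p z * q z)"

lemma cpoly_power: "cpoly p \<Longrightarrow> cpoly (\<lambda>z. p z ^ k)"
  by (induction k) (auto intro: cpoly.intros)

lemma cpoly_sum: "(\<And>i. i \<in> A \<Longrightarrow> cpoly (p i)) \<Longrightarrow> cpoly (\<lambda>z. \<Sum>i\<in>A. p i z)"
  by (induction A rule: infinite_finite_induct) (auto intro: cpoly.intros)

lemma cpoly_exp_bounded: "cpoly p \<Longrightarrow> exp_bounded p"
  by (induction rule: cpoly.induct)
     (auto intro: exp_bounded_const exp_bounded_linear exp_bounded_add exp_bounded_mult Finite_Cartesian_Product.norm_nth_le)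

lemma cpoly_continuous: "cpoly p \<Longrightarrow> continuous_on S p"
  by (induction rule: cpoly.induct) (auto intro!: continuous_intros)

definition multi_hermite_poly :: "('n::finite \<Rightarrow> nat) \<Rightarrow> complex^'n \<Rightarrow> complex" where
  "multi_hermite_poly \<alpha> z = (\<Prod>i\<in>UNIV. hermite_poly (\<alpha> i) (z $ i))"

text \<open>Finite linear combinations of products of Hermite polynomials. By the recurrence multiplication by a
  coordinate stays inside, hence these are all polynomials.\<close>

inductive hermite_span :: "(complex^'n \<Rightarrow> complex) \<Rightarrow> bool" where
  hs_base: "hermite_span (multi_hermite_poly \<alpha>)"
| hs_scale: "hermite_span p \<Longrightarrow> hermite_span (\<lambda>z. c * p z)"
| hs_add: "hermite_span p \<Longrightarrow> hermite_span q \<Longrightarrow> hermite_span (\<lambda>z. p z + q z)"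

lemma hermite_span_nth_mult:
  assumes "hermite_span p" shows "hermite_span (\<lambda>z. z $ i * p z)"
  using assms
proof induction
  case (hs_base \<alpha>)
  have up: "multi_hermite_poly (\<alpha>(i := k)) z = hermite_poly k (z $ i) * (\<Prod>j\<in>UNIV - {i}. hermite_poly (\<alpha> j) (z $ j))" for k z
    unfolding multi_hermite_poly_def by (subst prod.remove[of UNIV i]) (auto intro!: prod.cong)
  have self: "multi_hermite_poly \<alpha> z = hermite_poly (\<alpha> i) (z $ i) * (\<Prod>j\<in>UNIV - {i}. hermite_poly (\<alpha> j) (z $ j))" for z
    using up[of "\<alpha> i" z] by (simp only: fun_upd_triv)
  have "z $ i * multi_hermite_poly \<alpha> z = 1 / 2 * multi_hermite_poly (\<alpha>(i := Suc (\<alpha> i))) z + of_nat (\<alpha> i) * multi_hermite_poly (\<alpha>(i := \<alpha> i - 1)) z" for z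
    unfolding up self hermite_poly_Suc by (simp add: algebra_simps)
  then have "(\<lambda>z. z $ i * multi_hermite_poly \<alpha> z) = (\<lambda>z. 1 / 2 * multi_hermite_poly (\<alpha>(i := Suc (\<alpha> i))) z + of_nat (\<alpha> i) * multi_hermite_poly (\<alpha>(i := \<alpha> i - 1)) z)"
    by (rule ext)
  then show ?case by (simp only:) (intro hermite_span.intros)
next
  case (hs_scale p c)
  have "(\<lambda>z. z $ i * (c * p z)) = (\<lambda>z. c * (z $ i * p z))" by (simp add: mult_ac)
  then show ?case using hermite_span.hs_scale[OF hs_scale.IH, of c] by simp
next
  case (hs_add p q)
  have "(\<lambda>z. z $ i * (p z + q z)) = (\<lambda>z. z $ i * p z + z $ i * q z)" by (simp add: distrib_left)
  then show ?case using hermite_span.hs_add[OF hs_add.IH] by simp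
qed

lemma hermite_span_cpoly:
  assumes "cpoly p" shows "hermite_span p"
proof -
  have "hermite_span q \<Longrightarrow> hermite_span (\<lambda>z. p z * q z)" for q
    using assms
  proof (induction p arbitrary: q)
    case (cpoly_const c)
    then show ?case by (rule hs_scale)
  next
    case (cpoly_nth i)
    then show ?case by (rule hermite_span_nth_mult)
  next
    case (cpoly_add p p')
    have "(\<lambda>z. (p z + p' z) * q z) = (\<lambda>z. p z * q z + p' z * q z)" by (simp add: distrib_right)
    then show ?case using hs_add[OF cpoly_add.IH(1)[OF cpoly_add.prems] cpoly_add.IH(2)[OF cpoly_add.prems]] by simp
  next
    case (cpoly_mult p p')
    have "(\<lambda>z. p z * p' z * q z) = (\<lambda>z. p z * (p' z * q z))" by (simp add: mult.assoc)
    then show ?case using cpoly_mult.IH(1)[OF cpoly_mult.IH(2)[OF cpoly_mult.prems]] by simp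
  qed
  from this[OF hs_base[of "\<lambda>_. 0"]] show ?thesis by (simp add: multi_hermite_poly_def)
qed

lemma integral_lborel_affine:
  fixes f :: "'a::euclidean_space \<Rightarrow> complex"
  assumes c: "c \<noteq> 0" and f: "f \<in> borel_measurable borel"
  shows "(LINT x|lborel. f x) = \<bar>c\<bar> ^ DIM('a) *\<^sub>R (LINT x|lborel. f (t + c *\<^sub>R x))"
proof -
  have m: "(\<lambda>x::'a. t + c *\<^sub>R x) \<in> measurable lborel borel" by simp
  have "(LINT x|lborel. f x) = (LINT x|density (distr lborel borel (\<lambda>x. t + c *\<^sub>R x)) (\<lambda>_. ennreal (\<bar>c\<bar> ^ DIM('a))). f x)"
    using lborel_affine[OF c, of t] by (simp add: ennreal_power)
  also have "\<dots> = (LINT x|distr lborel borel (\<lambda>x. t + c *\<^sub>R x). \<bar>c\<bar> ^ DIM('a) *\<^sub>R f x)"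
    by (rule integral_density) (use f in auto)
  also have "\<dots> = (LINT x|lborel. \<bar>c\<bar> ^ DIM('a) *\<^sub>R f (t + c *\<^sub>R x))"
    by (rule integral_distr[OF m]) (use f in auto)
  finally show ?thesis by simp
qed

lemma AE_not_in_boundary_box: "AE x in lborel. x \<notin> cbox l u - box l (u :: 'a::euclidean_space)"
proof -
  have "cbox l u - box l u \<in> null_sets lebesgue"
    using negligible_frontier_interval[of l u] negligible_iff_null_sets by blast
  then have "cbox l u - box l u \<in> null_sets lborel"
    by (subst (asm) null_sets_completion_iff) auto
  then show ?thesis by (rule AE_not_in)
qed

lemma (in pair_sigma_finite) integrable_pair_mult:
  fixes f :: "'a \<Rightarrow> complex" and g :: "'b \<Rightarrow> complex"
  assumes f: "integrable M1 f" and g: "integrable M2 g"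
  shows "integrable (M1 \<Otimes>\<^sub>M M2) (\<lambda>(x, y). f x * g y)"
proof (rule Fubini_integrable)
  have [measurable]: "f \<in> borel_measurable M1" "g \<in> borel_measurable M2" using f g by auto
  show "(\<lambda>(x, y). f x * g y) \<in> borel_measurable (M1 \<Otimes>\<^sub>M M2)" by measurable
  show "integrable M1 (\<lambda>x. \<integral> y. norm (case (x, y) of (x, y) \<Rightarrow> f x * g y) \<partial>M2)"
    using f by (simp add: norm_mult)
  show "AE x in M1. integrable M2 (\<lambda>y. case (x, y) of (x, y) \<Rightarrow> f x * g y)"
    using g by simp
qed

text \<open>Average the hypothesis over all centres \<open>w\<close> in the box. By Fubini this tests \<open>h\<close> against a smoothed
  indicator of the box, which converges to the indicator off the boundary as the Gaussians get narrow.\<close>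

lemma integral_box_eq_0:
  fixes h :: "'a::euclidean_space \<Rightarrow> complex"
  assumes h: "integrable lborel h"
    and zero: "\<And>j w. (LINT x|lborel. h x * of_real (exp (- (real (Suc j) * c) * (norm (x - w))\<^sup>2))) = 0"
    and c: "c > 0"
  shows "(LINT x|lborel. indicator (box l u) x *\<^sub>R h x) = 0"
proof -
  let ?B = "box l u"
  have hm [measurable]: "h \<in> borel_measurable borel" using borel_measurable_integrable[OF h] by simp
  define \<tau> where "\<tau> j = real (Suc j) * c" for j
  have \<tau>: "\<tau> j > 0" for j using c by (simp add: \<tau>_def)
  define \<phi> where "\<phi> j x = (LINT v|lborel. indicator ?B (x + (1 / sqrt (\<tau> j)) *\<^sub>R v) *\<^sub>R complex_of_real (exp (- (norm v)\<^sup>2)))" for j x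
  define G where "G = (LINT v|lborel. exp (- (norm (v::'a))\<^sup>2))"
  have gi: "integrable lborel (\<lambda>v::'a. exp (- (norm v)\<^sup>2))" using integrable_gaussian[of 1] by simp
  have G: "G > 0" unfolding G_def by (rule integral_continuous_pos[OF gi]) simp
  have Bm [measurable]: "?B \<in> sets borel" by simp
  have shift [measurable]: "(\<lambda>v. x + (1 / sqrt (\<tau> j)) *\<^sub>R v) \<in> borel_measurable borel" for j and x :: 'a by simp
  \<comment> \<open>The substitution \<open>w = x + v / \<surd>\<tau>\<close> turns \<open>\<phi> j x\<close> into an average over the centres in the box.\<close>
  have zero': "(LINT x|lborel. h x * \<phi> j x) = 0" for j
  proof -
    define k where "k x w = h x * (indicator ?B w *\<^sub>R complex_of_real (exp (- \<tau> j * (norm (x - w))\<^sup>2)))" for x w :: 'a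
    have conv: "\<phi> j x = \<bar>sqrt (\<tau> j)\<bar> ^ DIM('a) *\<^sub>R (LINT w|lborel. indicator ?B w *\<^sub>R complex_of_real (exp (- \<tau> j * (norm (x - w))\<^sup>2)))" for x
    proof -
      have "(LINT w|lborel. indicator ?B w *\<^sub>R complex_of_real (exp (- \<tau> j * (norm (x - w))\<^sup>2))) =
        \<bar>1 / sqrt (\<tau> j)\<bar> ^ DIM('a) *\<^sub>R (LINT v|lborel. indicator ?B (x + (1 / sqrt (\<tau> j)) *\<^sub>R v) *\<^sub>R
           complex_of_real (exp (- \<tau> j * (norm (x - (x + (1 / sqrt (\<tau> j)) *\<^sub>R v)))\<^sup>2)))"
        by (rule integral_lborel_affine) (use \<tau>[of j] in \<open>auto\<close>)
      also have "(\<lambda>v::'a. indicator ?B (x + (1 / sqrt (\<tau> j)) *\<^sub>R v) *\<^sub>R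
           complex_of_real (exp (- \<tau> j * (norm (x - (x + (1 / sqrt (\<tau> j)) *\<^sub>R v)))\<^sup>2))) =
           (\<lambda>v. indicator ?B (x + (1 / sqrt (\<tau> j)) *\<^sub>R v) *\<^sub>R complex_of_real (exp (- (norm v)\<^sup>2)))"
        using \<tau>[of j] by (auto simp: power_mult_distrib power_divide)
      finally show ?thesis using \<tau>[of j] by (simp add: \<phi>_def power_divide)
    qed
    have km: "case_prod k \<in> borel_measurable (lborel \<Otimes>\<^sub>M lborel)"
      unfolding k_def[abs_def] by measurable
    have "integrable lborel (\<lambda>w. complex_of_real (indicat_real ?B w))"
      by (intro integrable_of_real integrable_real_indicator) (simp, rule emeasure_lborel_box_finite)
    from lborel_pair.integrable_pair_mult[OF h this]
    have ki: "integrable (lborel \<Otimes>\<^sub>M lborel) (case_prod k)"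
    proof (rule Bochner_Integration.integrable_bound[OF _ km])
      have "exp (- (\<tau> j * (norm (a - b))\<^sup>2)) \<le> 1" for a b :: 'a using \<tau>[of j] by simp
      then show "AE p in lborel \<Otimes>\<^sub>M lborel. norm (case_prod k p) \<le> norm (case p of (x, w) \<Rightarrow> h x * complex_of_real (indicat_real ?B w))"
        by (intro AE_I2) (auto simp: k_def norm_mult indicator_def intro!: mult_left_le)
    qed
    have kz: "(LINT x|lborel. k x w) = 0" for w
    proof -
      have "(LINT x|lborel. k x w) = (LINT x|lborel. (indicator ?B w) * (h x * complex_of_real (exp (- \<tau> j * (norm (x - w))\<^sup>2))))"
        unfolding k_def by (intro Bochner_Integration.integral_cong refl) (simp add: indicator_def)
      also have "\<dots> = 0" using zero[of j w] by (simp only: integral_mult_right_zero \<tau>_def[symmetric] mult_zero_right)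
      finally show ?thesis .
    qed
    have "(LINT x|lborel. h x * \<phi> j x) = (LINT x|lborel. of_real (\<bar>sqrt (\<tau> j)\<bar> ^ DIM('a)) * (LINT w|lborel. k x w))"
      unfolding conv k_def by (intro Bochner_Integration.integral_cong refl) (simp add: scaleR_conv_of_real)
    also have "\<dots> = of_real (\<bar>sqrt (\<tau> j)\<bar> ^ DIM('a)) * (LINT w|lborel. (LINT x|lborel. k x w))"
      by (simp add: lborel_pair.Fubini_integral[OF ki])
    also have "\<dots> = 0" by (simp add: kz)
    finally show ?thesis .
  qed
  have cm: "(\<lambda>v::'a. complex_of_real (exp (- (norm v)\<^sup>2))) \<in> borel_measurable borel" by measurable
  have \<phi>m: "\<phi> j \<in> borel_measurable lborel" for j
    unfolding \<phi>_def[abs_def] by measurable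
  have \<phi>lim: "(\<lambda>j. \<phi> j x) \<longlonglongrightarrow> indicator ?B x *\<^sub>R complex_of_real G" if x: "x \<notin> cbox l u - box l u" for x
  proof -
    have "(\<lambda>j. LINT v|lborel. indicator ?B (x + (1 / sqrt (\<tau> j)) *\<^sub>R v) *\<^sub>R complex_of_real (exp (- (norm v)\<^sup>2)))
        \<longlonglongrightarrow> (LINT v|lborel. indicator ?B x *\<^sub>R complex_of_real (exp (- (norm (v::'a))\<^sup>2)))"
    proof (rule integral_dominated_convergence[OF _ _ gi])
      show "AE v in lborel. norm (indicator ?B (x + (1 / sqrt (\<tau> j)) *\<^sub>R v) *\<^sub>R complex_of_real (exp (- (norm v)\<^sup>2))) \<le> exp (- (norm v)\<^sup>2)" for j
        by (intro AE_I2) (auto simp: indicator_def)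
      show "AE v in lborel. (\<lambda>j. indicator ?B (x + (1 / sqrt (\<tau> j)) *\<^sub>R v) *\<^sub>R complex_of_real (exp (- (norm v)\<^sup>2)))
          \<longlonglongrightarrow> indicator ?B x *\<^sub>R complex_of_real (exp (- (norm v)\<^sup>2))"
      proof (rule AE_I2)
        fix v :: 'a
        have "(\<lambda>j. 1 / sqrt (\<tau> j)) \<longlonglongrightarrow> 0" unfolding \<tau>_def using c by real_asymp
        then have "(\<lambda>j. x + (1 / sqrt (\<tau> j)) *\<^sub>R v) \<longlonglongrightarrow> x + 0 *\<^sub>R v"
          by (intro tendsto_intros)
        then have lim: "(\<lambda>j. x + (1 / sqrt (\<tau> j)) *\<^sub>R v) \<longlonglongrightarrow> x" by simp
        have "\<forall>\<^sub>F j in sequentially. indicat_real ?B (x + (1 / sqrt (\<tau> j)) *\<^sub>R v) = indicat_real ?B x"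
        proof (cases "x \<in> ?B")
          case True
          from topological_tendstoD[OF lim open_box True] show ?thesis
            by eventually_elim (use True in simp)
        next
          case False
          then have "x \<in> - cbox l u" using x by auto
          from topological_tendstoD[OF lim _ this] have "\<forall>\<^sub>F j in sequentially. x + (1 / sqrt (\<tau> j)) *\<^sub>R v \<in> - cbox l u"
            by (simp add: open_Compl closed_cbox)
          then show ?thesis
            by eventually_elim (use False box_subset_cbox[of l u] in \<open>auto simp: indicator_def\<close>)
        qed
        then have "\<forall>\<^sub>F j in sequentially. indicator ?B (x + (1 / sqrt (\<tau> j)) *\<^sub>R v) *\<^sub>R complex_of_real (exp (- (norm v)\<^sup>2))
            = indicator ?B x *\<^sub>R complex_of_real (exp (- (norm v)\<^sup>2))"
          by eventually_elim simp
        then show "(\<lambda>j. indicator ?B (x + (1 / sqrt (\<tau> j)) *\<^sub>R v) *\<^sub>R complex_of_real (exp (- (norm v)\<^sup>2)))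
          \<longlonglongrightarrow> indicator ?B x *\<^sub>R complex_of_real (exp (- (norm v)\<^sup>2))"
          by (rule tendsto_eventually)
      qed
    qed measurable
    then show ?thesis
      unfolding \<phi>_def[symmetric] integral_scaleR_right G_def integral_complex_of_real .
  qed
  have \<phi>b: "norm (\<phi> j x) \<le> G" for j x
  proof -
    have "norm (\<phi> j x) \<le> (LINT v|lborel. norm (indicator ?B (x + (1 / sqrt (\<tau> j)) *\<^sub>R v) *\<^sub>R complex_of_real (exp (- (norm v)\<^sup>2))))"
      unfolding \<phi>_def by (rule integral_norm_bound)
    also have "\<dots> \<le> G"
      unfolding G_def by (rule integral_mono_AE'[OF gi]) (auto simp: indicator_def)
    finally show ?thesis .
  qed
  have "(\<lambda>j. LINT x|lborel. h x * \<phi> j x) \<longlonglongrightarrow> (LINT x|lborel. h x * (indicator ?B x *\<^sub>R complex_of_real G))"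
  proof (rule integral_dominated_convergence[where w = "\<lambda>x. norm (h x) * G"])
    show "integrable lborel (\<lambda>x. norm (h x) * G)" using h by simp
    show "AE x in lborel. (\<lambda>j. h x * \<phi> j x) \<longlonglongrightarrow> h x * (indicator ?B x *\<^sub>R complex_of_real G)"
      using AE_not_in_boundary_box[of l u] by eventually_elim (intro tendsto_mult tendsto_const \<phi>lim)
    show "AE x in lborel. norm (h x * \<phi> j x) \<le> norm (h x) * G" for j
      unfolding norm_mult using \<phi>b by (intro AE_I2 mult_left_mono) auto
    show "(\<lambda>x. h x * \<phi> j x) \<in> borel_measurable lborel" for j using \<phi>m[of j] by measurable
  qed measurable
  then have 0: "(LINT x|lborel. h x * (indicator ?B x *\<^sub>R complex_of_real G)) = 0"
    by (simp add: zero' LIMSEQ_const_iff)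
  have eq: "h x * (indicator ?B x *\<^sub>R complex_of_real G) = of_real G * (indicator ?B x *\<^sub>R h x)" for x
    by (simp add: indicator_def)
  have "of_real G * (LINT x|lborel. indicator ?B x *\<^sub>R h x) = 0"
    using 0 unfolding eq integral_mult_right_zero .
  then show ?thesis using G by simp
qed

text \<open>Boxes are stable under intersection and generate the Borel sets, so by Dynkin's lemma the integral
  of \<open>h\<close> over every Borel set vanishes.\<close>

lemma AE_eq_0_if_box_integrals:
  fixes h :: "'a::euclidean_space \<Rightarrow> complex"
  assumes h: "integrable lborel h"
    and box: "\<And>l u. (LINT x|lborel. indicator (box l u) x *\<^sub>R h x) = 0"
  shows "AE x in lborel. h x = 0"
proof (rule sigma_finite_measure.density_zero[OF lborel.sigma_finite_measure_axioms h])
  have hm [measurable]: "h \<in> borel_measurable borel" using borel_measurable_integrable[OF h] by simp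
  have si: "set_integrable lborel A h" if "A \<in> sets borel" for A
    unfolding set_integrable_def using that h by (intro integrable_mult_indicator) auto
  have all: "(LINT x|lborel. h x) = 0"
  proof -
    have "(\<lambda>k. LINT x|lborel. indicator (box (- real k *\<^sub>R One) (real k *\<^sub>R One)) x *\<^sub>R h x) \<longlonglongrightarrow> (LINT x|lborel. h x)"
    proof (rule integral_dominated_convergence[OF _ _ integrable_norm[OF h]])
      show "AE x in lborel. (\<lambda>k. indicator (box (- real k *\<^sub>R One) (real k *\<^sub>R One)) x *\<^sub>R h x) \<longlonglongrightarrow> h x"
      proof (rule AE_I2)
        fix x :: 'a
        obtain K where K: "x \<in> box (- real K *\<^sub>R One) (real K *\<^sub>R One)"
          using UN_box_eq_UNIV by auto
        have "\<forall>\<^sub>F k in sequentially. indicator (box (- real k *\<^sub>R One) (real k *\<^sub>R One)) x *\<^sub>R h x = h x"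
          using eventually_ge_at_top[of K]
        proof eventually_elim
          case (elim k)
          then have "x \<in> box (- real k *\<^sub>R One) (real k *\<^sub>R One)"
            using K by (force simp: box_def)
          then show ?case by simp
        qed
        then show "(\<lambda>k. indicator (box (- real k *\<^sub>R One) (real k *\<^sub>R One)) x *\<^sub>R h x) \<longlonglongrightarrow> h x"
          by (rule tendsto_eventually)
      qed
      show "AE x in lborel. norm (indicator (box (- real k *\<^sub>R One) (real k *\<^sub>R One)) x *\<^sub>R h x) \<le> norm (h x)" for k
        by (intro AE_I2) (auto simp: indicator_def)
    qed measurable
    then show ?thesis by (simp add: box LIMSEQ_const_iff)
  qed
  fix A assume "A \<in> sets (lborel :: 'a measure)"
  then have A: "A \<in> sigma_sets UNIV (range (\<lambda>(a, b). box a b :: 'a set))"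
    by (simp add: borel_eq_box)
  have sub: "sigma_sets UNIV (range (\<lambda>(a, b). box a b :: 'a set)) = sets borel"
    by (simp add: borel_eq_box)
  have stable: "Int_stable (range (\<lambda>(a, b). box a b :: 'a set))"
    by (auto simp: Int_stable_def box_Int_box)
  have "range (\<lambda>(a, b). box a b :: 'a set) \<subseteq> Pow UNIV" by simp
  from stable this A show "(LINT x:A|lborel. h x) = 0"
  proof (induction rule: sigma_sets_induct_disjoint)
    case (basic A)
    then show ?case using box by (auto simp: set_lebesgue_integral_def)
  next
    case empty
    then show ?case by (simp add: set_lebesgue_integral_def)
  next
    case (compl A)
    then have A: "A \<in> sets borel" by (simp add: sub)
    have "indicator (UNIV - A) x *\<^sub>R h x = h x - indicator A x *\<^sub>R h x" for x
      by (simp add: indicator_def)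
    then have "(LINT x:(UNIV - A)|lborel. h x) = (LINT x|lborel. h x) - (LINT x:A|lborel. h x)"
      unfolding set_lebesgue_integral_def
      using h si[OF A] by (simp add: set_integrable_def)
    then show ?case using compl.IH all by simp
  next
    case (union A)
    then have m: "A i \<in> sets borel" for i by (auto simp: sub)
    have "(LINT x:(\<Union>i. A i)|lborel. h x) = (\<Sum>i. (LINT x:(A i)|lborel. h x))"
      by (rule lebesgue_integral_countable_add) (use m union.hyps(1) in \<open>auto simp: disjoint_family_on_def intro!: si\<close>)
    then show ?case using union.IH by simp
  qed
qed

lemma entire_line:
  assumes "entire F"
  shows "(\<lambda>\<zeta>. F (a + \<zeta> *s b)) holomorphic_on S"
proof -
  have "\<exists>d. ((\<lambda>\<zeta>. F (a + \<zeta> *s b)) has_field_derivative d) (at \<zeta>)" for \<zeta>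
  proof -
    obtain D where D: "(F has_derivative D) (at (a + \<zeta> *s b))" "\<And>c v. D (c *s v) = c * D v"
      using assms unfolding entire_def by blast
    have "bounded_linear (\<lambda>h. h *s b)"
      by (rule linear_conv_bounded_linear[THEN iffD1], rule linearI) (auto simp: vec_eq_iff algebra_simps)
    then have "((\<lambda>\<zeta>. a + \<zeta> *s b) has_derivative (\<lambda>h. 0 + h *s b)) (at \<zeta>)"
      by (intro has_derivative_add has_derivative_const bounded_linear_imp_has_derivative)
    from has_derivative_compose[OF this D(1)]
    have "((\<lambda>\<zeta>. F (a + \<zeta> *s b)) has_derivative (\<lambda>h. h * D b)) (at \<zeta>)"
      by (simp add: D(2))
    then show ?thesis
      by (intro exI[of _ "D b"]) (simp add: has_field_derivative_def mult_commute_abs)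
  qed
  then show ?thesis
    by (auto simp: holomorphic_on_def field_differentiable_def intro: has_field_derivative_at_within)
qed

lemma entire_continuous: "entire F \<Longrightarrow> continuous_on S F"
  unfolding entire_def
  by (metis has_derivative_continuous continuous_at_imp_continuous_on)

lemma islimpt_Reals_0: "(0::complex) islimpt \<real>"
  unfolding islimpt_approachable
proof (intro allI impI)
  fix e :: real assume "e > 0"
  then show "\<exists>x'\<in>\<real>. x' \<noteq> 0 \<and> dist x' (0::complex) < e"
    by (intro bexI[of _ "of_real (e / 2)"]) auto
qed

text \<open>On \<open>\<real>\<^sup>n\<close> the function vanishes by continuity. For \<open>z = x + \<i> y\<close> the function \<open>\<zeta> \<mapsto> F(x + \<zeta> y)\<close> of one variable is
  holomorphic and vanishes for real \<open>\<zeta>\<close>, hence also at \<open>\<zeta> = \<i>\<close>. This makes the entire extension unique.\<close>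

lemma entire_eq_0_if_AE_real:
  fixes F :: "complex^'n \<Rightarrow> complex"
  assumes F: "entire F" and ae: "AE x in lborel. F (complex_vec x) = 0"
  shows "F z = 0"
proof -
  have real: "F (complex_vec x) = 0" for x
  proof (rule ccontr)
    assume nz: "F (complex_vec x) \<noteq> 0"
    have "continuous_on UNIV (\<lambda>x. F (complex_vec x))"
      by (rule continuous_on_compose2[OF entire_continuous[OF F, of UNIV]])
         (auto simp: complex_vec_def intro!: continuous_intros)
    then have "open {x. F (complex_vec x) \<noteq> 0}"
      using open_Collect_neq[of "\<lambda>x. F (complex_vec x)" "\<lambda>_. 0"] by auto
    then have "\<not> negligible {x. F (complex_vec x) \<noteq> 0}"
      using nz by (intro open_not_negligible) auto
    moreover have "negligible {x. F (complex_vec x) \<noteq> 0}"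
    proof -
      have "{x. F (complex_vec x) \<noteq> 0} \<in> null_sets lborel"
        using ae \<open>open _\<close> by (subst AE_iff_null_sets) auto
      then show ?thesis by (simp add: negligible_iff_null_sets null_sets_completionI)
    qed
    ultimately show False by blast
  qed
  \<comment> \<open>The complex line through \<open>z\<close> and its real part meets \<open>\<real>\<^sup>n\<close> in a real line.\<close>
  define g where "g \<zeta> = F (complex_vec (Re_vec z) + \<zeta> *s complex_vec (Im_vec z))" for \<zeta>
  have hol: "g holomorphic_on UNIV" unfolding g_def by (rule entire_line[OF F])
  have g0: "g \<zeta> = 0" if Z: "\<zeta> \<in> \<real>" for \<zeta>
  proof -
    obtain r where r: "\<zeta> = of_real r" using Z by (auto simp: Reals_def)
    have "complex_vec (Re_vec z) + \<zeta> *s complex_vec (Im_vec z) = complex_vec (Re_vec z + r *\<^sub>R Im_vec z)"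
      by (simp add: vec_eq_iff complex_vec_def r)
    then show ?thesis by (simp add: g_def real)
  qed
  have "g \<i> = 0"
    by (rule analytic_continuation[OF hol open_UNIV connected_UNIV subset_UNIV UNIV_I islimpt_Reals_0 g0 UNIV_I])
  moreover have "complex_vec (Re_vec z) + \<i> *s complex_vec (Im_vec z) = z"
    by (simp add: vec_eq_iff complex_vec_def Re_vec_def Im_vec_def complex_eq[symmetric])
  ultimately show ?thesis by (simp add: g_def)
qed

lemma circle_mean_value:
  assumes g: "g holomorphic_on UNIV"
  shows "(LINT x|lborel. indicator {0..1} x *\<^sub>R g (exp (2 * of_real pi * \<i> * of_real x))) = g 0"
proof -
  let ?e = "\<lambda>x::real. exp (2 * of_real pi * \<i> * of_real x)"
  have "((\<lambda>u. g u / (u - 0)) has_contour_integral (2 * of_real pi * \<i> * g 0)) (circlepath 0 1)"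
    by (rule Cauchy_integral_circlepath_simple) (auto intro: holomorphic_on_subset[OF g])
  then have h0: "((\<lambda>x. g (circlepath 0 1 x) / (circlepath 0 1 x - 0) * vector_derivative (circlepath 0 1) (at x within {0..1}))
      has_integral (2 * of_real pi * \<i> * g 0)) {0..1}"
    unfolding has_contour_integral_def .
  have cp: "circlepath 0 1 x = ?e x" for x by (simp add: circlepath)
  have vd: "vector_derivative (circlepath 0 1) (at x within {0..1}) = 2 * of_real pi * \<i> * ?e x"
    if "x \<in> {0..1}" for x
    by (rule vector_derivative_within_closed_interval)
       (use that in \<open>auto intro!: has_vector_derivative_eq_rhs[OF has_vector_derivative_circlepath]\<close>)
  have "((\<lambda>x. g (?e x) / ?e x * (2 * of_real pi * \<i> * ?e x)) has_integral (2 * of_real pi * \<i> * g 0)) {0..1}"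
    by (rule has_integral_eq[OF _ h0]) (simp only: cp vd diff_zero)
  then have "((\<lambda>x. (1 / (2 * of_real pi * \<i>)) * (g (?e x) / ?e x * (2 * of_real pi * \<i> * ?e x))) has_integral
      (1 / (2 * of_real pi * \<i>)) * (2 * of_real pi * \<i> * g 0)) {0..1}"
    by (rule has_integral_mult_right)
  then have 1: "((\<lambda>x. g (?e x)) has_integral g 0) {0..1}" by simp
  have "continuous_on {0..1} (\<lambda>x. g (?e x))"
    by (rule continuous_on_compose2[OF holomorphic_on_imp_continuous_on[OF g]]) (auto intro!: continuous_intros)
  then have "set_integrable lborel {0..1} (\<lambda>x. g (?e x))"
    by (rule borel_integrable_atLeastAtMost')
  from set_borel_integral_eq_integral(2)[OF this] 1 show ?thesis
    by (simp add: set_lebesgue_integral_def integral_unique)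
qed

text \<open>Averaging over the rotations \<open>u \<mapsto> e^(2 \<pi> \<i> x) u\<close> changes neither the Gaussian nor Lebesgue measure, and it
  replaces \<open>H\<close> by its mean over a circle in a complex line through 0, which is \<open>H 0\<close>.\<close>

lemma gaussian_mean_value:
  fixes H :: "complex^'n \<Rightarrow> complex"
  assumes cont: "continuous_on UNIV H" and hol: "\<And>u. (\<lambda>\<zeta>. H (\<zeta> *s u)) holomorphic_on UNIV"
    and int: "integrable lborel (\<lambda>u. H u * of_real (exp (- \<kappa> * (norm u)\<^sup>2)))"
  shows "(LINT u|lborel. H u * of_real (exp (- \<kappa> * (norm u)\<^sup>2))) =
    H 0 * of_real (LINT u|lborel. exp (- \<kappa> * (norm (u :: complex^'n))\<^sup>2))"
proof -
  let ?e = "\<lambda>x::real. exp (2 * of_real pi * \<i> * of_real x)"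
  define f where "f u = H u * of_real (exp (- \<kappa> * (norm u)\<^sup>2))" for u
  have [measurable]: "H \<in> borel_measurable borel" by (rule borel_measurable_continuous_onI[OF cont])
  have fm [measurable]: "f \<in> borel_measurable borel" unfolding f_def[abs_def] by measurable
  have rot: "(\<lambda>u::complex^'n. w *s u) \<in> measurable lborel borel" for w
  proof -
    have "continuous_on UNIV (\<lambda>u::complex^'n. w *s u)"
      unfolding vector_scalar_mult_def by (intro continuous_intros)
    then show ?thesis using borel_measurable_continuous_onI by auto
  qed
  have e1: "cmod (?e x) = 1" for x by (simp add: norm_exp_i_times[of "2 * pi * x"] mult_ac)
  have nrot: "norm (w *s u) = norm u" if "cmod w = 1" for w and u :: "complex^'n"
    using that by (simp add: norm_vec_def L2_set_def norm_mult)
  have rint: "integrable lborel (\<lambda>u. f (?e x *s u))" for x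
  proof (rule integrable_distr_eq[OF rot fm, THEN iffD1])
    show "integrable (distr lborel borel (\<lambda>u. ?e x *s u)) f"
      unfolding lborel_complex_vec_rotate[OF e1] using int by (simp add: f_def[abs_def])
  qed
  have rval: "(LINT u|lborel. f (?e x *s u)) = (LINT u|lborel. f u)" for x
    by (subst integral_distr[OF rot fm, symmetric], subst lborel_complex_vec_rotate[OF e1], rule refl)
  have fnm: "(\<lambda>u. norm (f u)) \<in> borel_measurable borel" by measurable
  have rnorm: "(LINT u|lborel. norm (f (?e x *s u))) = (LINT u|lborel. norm (f u))" for x
    by (subst integral_distr[OF rot fnm, symmetric], subst lborel_complex_vec_rotate[OF e1], rule refl)
  define k where "k x u = indicator {0..1} x *\<^sub>R f (?e x *s u)" for x :: real and u :: "complex^'n"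
  have "continuous_on UNIV (\<lambda>p::real \<times> (complex^'n). ?e (fst p) *s snd p)"
    unfolding vector_scalar_mult_def by (intro continuous_intros)
  then have em: "(\<lambda>p::real \<times> (complex^'n). ?e (fst p) *s snd p) \<in> borel_measurable (lborel \<Otimes>\<^sub>M lborel)"
    unfolding lborel_prod using borel_measurable_continuous_onI by auto
  have "(\<lambda>p. f (?e (fst p) *s snd p)) \<in> borel_measurable (lborel \<Otimes>\<^sub>M lborel)"
    using measurable_compose[OF em fm] .
  then have km: "case_prod k \<in> borel_measurable (lborel \<Otimes>\<^sub>M lborel)"
    unfolding k_def[abs_def] case_prod_unfold by measurable
  have ki: "integrable (lborel \<Otimes>\<^sub>M lborel) (case_prod k)"
  proof (rule lborel_pair.Fubini_integrable[OF km])
    show "AE x in lborel. integrable lborel (\<lambda>u. case_prod k (x, u))"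
      using rint by (intro AE_I2) (simp add: k_def)
    have "integrable lborel (\<lambda>x::real. indicat_real {0..1} x * (LINT u|lborel. norm (f u)))"
      by (intro integrable_mult_left) simp
    also have "(\<lambda>x. indicat_real {0..1} x * (LINT u|lborel. norm (f u))) = (\<lambda>x. LINT u|lborel. norm (case_prod k (x, u)))"
      using rnorm by (auto simp: k_def indicator_def fun_eq_iff)
    finally show "integrable lborel (\<lambda>x. LINT u|lborel. norm (case_prod k (x, u)))" .
  qed
  \<comment> \<open>Integrating over the circle first leaves the value at the centre.\<close>
  have kz: "(LINT x|lborel. k x u) = H 0 * of_real (exp (- \<kappa> * (norm u)\<^sup>2))" for u
  proof -
    have "(LINT x|lborel. k x u) = (LINT x|lborel. (indicator {0..1} x *\<^sub>R H (?e x *s u)) * of_real (exp (- \<kappa> * (norm u)\<^sup>2)))"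
      by (simp add: k_def f_def nrot[OF e1])
    also have "\<dots> = (LINT x|lborel. indicator {0..1} x *\<^sub>R H (?e x *s u)) * of_real (exp (- \<kappa> * (norm u)\<^sup>2))"
      by (rule integral_mult_left_zero)
    finally show ?thesis using circle_mean_value[OF hol[of u]] by simp
  qed
  have "(LINT u|lborel. f u) = (LINT x|lborel. LINT u|lborel. k x u)"
    by (simp add: k_def rval)
  also have "\<dots> = (LINT u|lborel. LINT x|lborel. k x u)"
    by (rule lborel_pair.Fubini_integral[OF ki, symmetric])
  also have "\<dots> = H 0 * of_real (LINT u|lborel. exp (- \<kappa> * (norm (u :: complex^'n))\<^sup>2))"
    unfolding kz by (subst integral_mult_right_zero, subst integral_complex_of_real) simp
  finally show ?thesis by (simp add: f_def)
qed

section \<open>Completeness of the Hermite functions\<close>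

lemma cpoly_prod: "finite A \<Longrightarrow> (\<And>i. i \<in> A \<Longrightarrow> cpoly (p i)) \<Longrightarrow> cpoly (\<lambda>z. \<Prod>i\<in>A. p i z)"
  by (induction A rule: finite_induct) (auto intro: cpoly.intros)

lemma cpoly_hermite_poly: "cpoly (\<lambda>z :: complex^'n. hermite_poly k (z $ i))"
proof (induction k rule: less_induct)
  case (less k)
  consider "k = 0" | "k = 1" | j where "k = Suc (Suc j)" by (metis One_nat_def not0_implies_Suc)
  then show ?case
  proof cases
    case (3 j)
    then have "cpoly (\<lambda>z. 2 * z $ i * hermite_poly (Suc j) (z $ i) + (- 2 * of_nat (Suc j)) * hermite_poly j (z $ i))"
      using less by (intro cpoly_add cpoly_mult cpoly_const cpoly_nth) auto
    moreover have "(\<lambda>z :: complex^'n. hermite_poly k (z $ i)) =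
        (\<lambda>z. 2 * z $ i * hermite_poly (Suc j) (z $ i) + (- 2 * of_nat (Suc j)) * hermite_poly j (z $ i))"
      unfolding 3 by (simp add: algebra_simps)
    ultimately show ?thesis by (simp only:)
  qed (auto intro!: cpoly.intros)
qed

lemma hermite_span_imp_cpoly: "hermite_span p \<Longrightarrow> cpoly p"
proof (induction rule: hermite_span.induct)
  case (hs_base \<alpha>)
  then show ?case unfolding multi_hermite_poly_def[abs_def] by (intro cpoly_prod cpoly_hermite_poly) auto
qed (auto intro: cpoly.intros)

text \<open>The holomorphic square \<open>z\<^sup>2 = \<Sum>\<^sub>i z\<^sub>i\<^sup>2\<close>, not the squared norm; they agree on \<open>\<real>\<^sup>n\<close>.\<close>

definition sum_sq :: "complex^'n \<Rightarrow> complex" where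
  "sum_sq z = (\<Sum>i\<in>UNIV. (z $ i)\<^sup>2)"

lemma cpoly_sum_sq: "cpoly sum_sq"
  unfolding sum_sq_def[abs_def] by (intro cpoly_sum cpoly_power cpoly_nth)

lemma multi_hermite_ext_eq: "multi_hermite_ext \<alpha> z = of_real (\<Prod>i\<in>UNIV. hermite_const (\<alpha> i)) * (multi_hermite_poly \<alpha> z * exp (- (1 / 2) * sum_sq z))"
proof -
  have "(\<Prod>i\<in>UNIV. exp (- (z $ i)\<^sup>2 / 2)) = exp (- (1 / 2) * sum_sq z)"
    unfolding sum_sq_def exp_sum[OF finite, symmetric] by (simp add: sum_distrib_left)
  then show ?thesis by (simp add: multi_hermite_ext_def hermite_ext_def multi_hermite_poly_def prod.distrib)
qed

lemma sum_sq_complex_vec: "sum_sq (complex_vec x) = of_real ((norm x)\<^sup>2)"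
  by (simp add: sum_sq_def complex_vec_def norm_vec_def L2_set_def sum_nonneg)

lemma norm_complex_vec [simp]: "norm (complex_vec x) = norm x"
  by (simp add: complex_vec_def norm_vec_def L2_set_def)

lemma continuous_on_complex_vec: "continuous_on S complex_vec"
  unfolding complex_vec_def by (intro continuous_intros)

lemma sq_int_cnj: "sq_int M f \<Longrightarrow> sq_int M (\<lambda>x. cnj (f x))"
  by (auto simp: sq_int_def intro: borel_measurable_cnj)

lemma sq_int_mult': "sq_int M f \<Longrightarrow> sq_int M g \<Longrightarrow> integrable M (\<lambda>x. f x * g x)"
  using sq_int_mult[OF _ sq_int_cnj, of M f g] by simp

lemma sq_int_norm_le:
  assumes g: "g \<in> borel_measurable M" and i: "integrable M b" and le: "\<And>x. (cmod (g x))\<^sup>2 \<le> b x"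
  shows "sq_int M g"
  unfolding sq_int_def
proof
  show "integrable M (\<lambda>x. (cmod (g x))\<^sup>2)"
  proof (rule Bochner_Integration.integrable_bound[OF i])
    show "(\<lambda>x. (cmod (g x))\<^sup>2) \<in> borel_measurable M" using g by measurable
    show "AE x in M. norm ((cmod (g x))\<^sup>2) \<le> norm (b x)"
      using le by (intro AE_I2) (auto intro: order_trans[OF le abs_ge_self])
  qed
qed (rule g)

lemma sq_int_exp_bounded_gaussian:
  fixes p :: "'a::euclidean_space \<Rightarrow> complex"
  assumes p: "exp_bounded p" "p \<in> borel_measurable borel" and \<tau>: "\<tau> > 0"
  shows "sq_int lborel (\<lambda>x. p x * of_real (exp (- \<tau> * (norm x)\<^sup>2)))"
proof (rule sq_int_norm_le)
  have [measurable]: "p \<in> borel_measurable borel" by (rule p)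
  have "integrable lborel (\<lambda>x. (p x * cnj (p x)) * complex_of_real (exp (- (2 * \<tau>) * (norm x)\<^sup>2)))"
    using \<tau> by (intro integrable_exp_bounded_gaussian[of _ _ "2 * \<tau>"] exp_bounded_mult exp_bounded_cnj p) auto
  then show "integrable lborel (\<lambda>x. norm ((p x * cnj (p x)) * complex_of_real (exp (- (2 * \<tau>) * (norm x)\<^sup>2))))"
    by (rule integrable_norm)
  show "(\<lambda>x. p x * of_real (exp (- \<tau> * (norm x)\<^sup>2))) \<in> borel_measurable lborel" by measurable
  show "(cmod (p x * of_real (exp (- \<tau> * (norm x)\<^sup>2))))\<^sup>2 \<le> norm ((p x * cnj (p x)) * complex_of_real (exp (- (2 * \<tau>) * (norm x)\<^sup>2)))" for x
  proof -
    have "exp (- (2 * \<tau>) * (norm x)\<^sup>2) = (exp (- \<tau> * (norm x)\<^sup>2))\<^sup>2"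
      by (simp add: exp_double[symmetric])
    then show ?thesis
      by (simp only: norm_mult norm_of_real abs_exp_cancel complex_mod_cnj power_mult_distrib)
         (simp add: power2_eq_square)
  qed
qed

lemma exp_bounded_compose:
  assumes "exp_bounded p" "\<And>x. norm (f x) \<le> norm x"
  shows "exp_bounded (\<lambda>x. p (f x))"
proof -
  obtain C B where C: "C \<ge> 0" "B \<ge> 0" "\<And>z. cmod (p z) \<le> C * exp (B * norm z)"
    using assms(1) unfolding exp_bounded_def by blast
  show ?thesis
  proof (rule exp_boundedI[OF C(1,2)])
    fix x
    have "C * exp (B * norm (f x)) \<le> C * exp (B * norm x)"
      using C assms(2)[of x] by (auto intro!: mult_left_mono)
    then show "cmod (p (f x)) \<le> C * exp (B * norm x)" using C(3)[of "f x"] by linarith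
  qed
qed

text \<open>Orthogonality to the Hermite functions says that \<open>f\<close> is orthogonal to all polynomials times \<open>e^(- \<tau> |x|\<^sup>2)\<close>
  for \<open>\<tau> = 1 / 2\<close>. Any \<open>\<delta> < \<tau>\<close> can be added to \<open>\<tau>\<close>, as \<open>e^(\<delta> |x|\<^sup>2)\<close> is still absorbed; steps of \<open>1 / 4\<close> reach
  arbitrarily large \<open>\<tau>\<close>. One more exponential series supplies the factor \<open>e^(2 \<tau> x \<cdot> w)\<close> that moves the centre
  of the Gaussian to \<open>w\<close>. One factor \<open>e^(- |x|\<^sup>2 / 2)\<close> stays with \<open>f\<close> to make it integrable.\<close>

theorem hermite_complete_real:
  fixes f :: "real^'n \<Rightarrow> complex"
  assumes f: "sq_int lborel f" and orth: "\<And>\<alpha>. inner_prod lborel f (multi_hermite_fun \<alpha>) = 0"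
  shows "AE x in lborel. f x = 0"
proof -
  define g where "g \<tau> x = complex_of_real (exp (- \<tau> * (norm x)\<^sup>2))" for \<tau> and x :: "real^'n"
  have g_add: "g a x * g b x = g (a + b) x" for a b x
    by (simp add: g_def exp_add[symmetric] of_real_mult[symmetric] algebra_simps del: of_real_mult)
  have [measurable]: "f \<in> borel_measurable lborel" by (rule sq_int_measurable[OF f])
  have gm [measurable]: "g \<tau> \<in> borel_measurable borel" for \<tau> unfolding g_def[abs_def] by measurable
  have pm: "(\<lambda>x. q (complex_vec x)) \<in> borel_measurable borel" if "cpoly q" for q :: "complex^'n \<Rightarrow> complex"
    by (intro borel_measurable_continuous_onI continuous_on_compose2[OF cpoly_continuous[OF that, of UNIV] continuous_on_complex_vec]) auto
  have sqg: "sq_int lborel (\<lambda>x. q (complex_vec x) * g \<tau> x)" if "cpoly q" "\<tau> > 0" for q :: "complex^'n \<Rightarrow> complex" and \<tau>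
    unfolding g_def by (rule sq_int_exp_bounded_gaussian[OF exp_bounded_compose[OF cpoly_exp_bounded[OF that(1)]] pm[OF that(1)] that(2)]) simp
  note int = sq_int_mult'[OF f sqg]
  define Claim where "Claim \<tau> \<longleftrightarrow> (\<forall>q. cpoly q \<longrightarrow> (LINT x|lborel. f x * (q (complex_vec x) * g \<tau> x)) = 0)" for \<tau>
  have base: "Claim (1/2)"
    unfolding Claim_def
  proof (intro allI impI)
    fix q :: "complex^'n \<Rightarrow> complex" assume "cpoly q"
    then have "hermite_span q" by (rule hermite_span_cpoly)
    then show "(LINT x|lborel. f x * (q (complex_vec x) * g (1/2) x)) = 0"
    proof (induction rule: hermite_span.induct)
      case (hs_base \<alpha>)
      let ?c = "complex_of_real (\<Prod>i\<in>UNIV. hermite_const (\<alpha> i))"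
      have "f x * cnj (multi_hermite_fun \<alpha> x) = ?c * (f x * (multi_hermite_poly \<alpha> (complex_vec x) * g (1/2) x))" for x
      proof -
        have "cnj (multi_hermite_fun \<alpha> x) = multi_hermite_fun \<alpha> x"
          by (simp add: multi_hermite_fun_def)
        also have "\<dots> = ?c * (multi_hermite_poly \<alpha> (complex_vec x) * g (1/2) x)"
          by (simp add: multi_hermite_fun_eq multi_hermite_ext_eq sum_sq_complex_vec g_def exp_of_real[symmetric])
        finally show ?thesis by simp
      qed
      then have "?c * (LINT x|lborel. f x * (multi_hermite_poly \<alpha> (complex_vec x) * g (1/2) x)) = 0"
        using orth[of \<alpha>] unfolding inner_prod_def by (simp only: integral_mult_right_zero)
      moreover have "?c \<noteq> 0" using hermite_const_pos by (simp add: less_imp_neq[symmetric])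
      ultimately show ?case by simp
    next
      case (hs_scale p c)
      have "f x * (c * p (complex_vec x) * g (1/2) x) = c * (f x * (p (complex_vec x) * g (1/2) x))" for x by simp
      then show ?case using hs_scale.IH by (simp only: integral_mult_right_zero mult_zero_right)
    next
      case (hs_add p q)
      have "f x * ((p (complex_vec x) + q (complex_vec x)) * g (1/2) x) =
        f x * (p (complex_vec x) * g (1/2) x) + f x * (q (complex_vec x) * g (1/2) x)" for x
        by (simp add: algebra_simps)
      then show ?case
        using hs_add.IH int[OF hermite_span_imp_cpoly[OF hs_add.hyps(1)], of "1/2"] int[OF hermite_span_imp_cpoly[OF hs_add.hyps(2)], of "1/2"]
        by simp
    qed
  qed
  have step: "Claim (\<tau> + \<delta>)" if C: "Claim \<tau>" and \<delta>: "0 < \<delta>" "\<delta> < \<tau>" for \<tau> \<delta>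
    unfolding Claim_def
  proof (intro allI impI)
    fix q :: "complex^'n \<Rightarrow> complex" assume q: "cpoly q"
    define h where "h x = f x * (q (complex_vec x) * g \<tau> x)" for x
    define \<omega> where "\<omega> x = complex_of_real (- \<delta> * (norm x)\<^sup>2)" for x :: "real^'n"
    have \<omega>: "\<omega> x = (- of_real \<delta>) * sum_sq (complex_vec x)" for x by (simp add: \<omega>_def sum_sq_complex_vec)
    note [measurable] = pm[OF q]
    have "(LINT x|lborel. h x * exp (\<omega> x)) = 0"
    proof (rule integral_exp_eq_0(2))
      show "h \<in> borel_measurable lborel" unfolding h_def[abs_def] by measurable
      show "\<omega> \<in> borel_measurable lborel" unfolding \<omega>_def[abs_def] by measurable
      have "cmod (h x) * exp (cmod (\<omega> x)) = norm (f x * (q (complex_vec x) * g (\<tau> - \<delta>) x))" for x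
      proof -
        have "exp (cmod (\<omega> x)) = norm (g (- \<delta>) x)" using \<delta> by (simp add: \<omega>_def g_def norm_mult norm_power)
        then have "cmod (h x) * exp (cmod (\<omega> x)) = norm (f x * (q (complex_vec x) * (g \<tau> x * g (- \<delta>) x)))"
          by (simp add: h_def norm_mult)
        then show ?thesis by (simp add: g_add)
      qed
      then show "integrable lborel (\<lambda>x. cmod (h x) * exp (cmod (\<omega> x)))"
        using integrable_norm[OF int[OF q, of "\<tau> - \<delta>"]] \<delta> by simp
      fix k
      have "cpoly (\<lambda>z. q z * ((- of_real \<delta>) * sum_sq z) ^ k)"
        by (intro cpoly_mult cpoly_power cpoly_const q cpoly_sum_sq)
      with C have "(LINT x|lborel. f x * ((q (complex_vec x) * ((- of_real \<delta>) * sum_sq (complex_vec x)) ^ k) * g \<tau> x)) = 0"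
        unfolding Claim_def by blast
      also have "(\<lambda>x. f x * ((q (complex_vec x) * ((- of_real \<delta>) * sum_sq (complex_vec x)) ^ k) * g \<tau> x)) = (\<lambda>x. h x * \<omega> x ^ k)"
        unfolding h_def \<omega> by (simp add: mult_ac)
      finally show "(LINT x|lborel. h x * \<omega> x ^ k) = 0" .
    qed
    moreover have "h x * exp (\<omega> x) = f x * (q (complex_vec x) * g (\<tau> + \<delta>) x)" for x
    proof -
      have "exp (\<omega> x) = g \<delta> x" by (simp only: \<omega>_def g_def exp_of_real)
      then show ?thesis by (simp add: h_def g_add[symmetric])
    qed
    ultimately show "(LINT x|lborel. f x * (q (complex_vec x) * g (\<tau> + \<delta>) x)) = 0" by simp
  qed
  have claims: "Claim (1/2 + real j * (1/4))" for j
  proof (induction j)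
    case (Suc j)
    have "Claim (1/2 + real j * (1/4) + 1/4)" by (rule step[OF Suc]) auto
    moreover have "1/2 + real j * (1/4) + 1/4 = 1/2 + real (Suc j) * (1/4)" by (simp add: field_simps)
    ultimately show ?case by (simp only:)
  qed (use base in simp)
  define h0 where "h0 x = f x * g (1/2) x" for x
  have h0: "integrable lborel h0"
    using int[OF cpoly_const[of 1], of "1/2"] by (simp add: h0_def[abs_def])
  \<comment> \<open>The Gaussian \<open>e^(- (1 / 2 + \<tau>) |x|\<^sup>2)\<close> is split: the half stays in \<open>h0\<close>, the rest is completed to a square around \<open>w\<close>.\<close>
  have conv: "(LINT x|lborel. h0 x * of_real (exp (- (real (Suc j) * (1/4)) * (norm (x - w))\<^sup>2))) = 0" for j w
  proof -
    define \<tau> where "\<tau> = real (Suc j) * (1/4)"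
    have \<tau>: "\<tau> > 0" by (simp add: \<tau>_def)
    define h where "h x = f x * g (1/2 + \<tau>) x" for x
    define L where "L z = (\<Sum>i\<in>UNIV. of_real (2 * \<tau> * w $ i) * z $ i)" for z :: "complex^'n"
    define \<omega> where "\<omega> x = complex_of_real (2 * \<tau> * (x \<bullet> w))" for x
    have L: "cpoly L" unfolding L_def[abs_def] by (intro cpoly_sum cpoly_mult cpoly_const cpoly_nth)
    have \<omega>L: "\<omega> x = L (complex_vec x)" for x
      by (simp add: \<omega>_def L_def complex_vec_def inner_vec_def sum_distrib_left mult_ac)
    have \<omega>m [measurable]: "\<omega> \<in> borel_measurable lborel" unfolding \<omega>_def[abs_def] by measurable
    have "(LINT x|lborel. h x * exp (\<omega> x)) = 0"
    proof (rule integral_exp_eq_0(2))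
      show "h \<in> borel_measurable lborel" unfolding h_def[abs_def] by measurable
      have "exp_bounded (\<lambda>x. complex_of_real (exp (cmod (\<omega> x))))"
      proof (rule exp_boundedI[of 1 "2 * \<tau> * norm w"])
        fix x :: "real^'n"
        have "cmod (\<omega> x) \<le> 2 * \<tau> * (norm x * norm w)"
          unfolding \<omega>_def norm_of_real abs_mult using \<tau> Cauchy_Schwarz_ineq2[of x w] by (intro mult_mono) auto
        then show "cmod (complex_of_real (exp (cmod (\<omega> x)))) \<le> 1 * exp (2 * \<tau> * norm w * norm x)"
          by (simp add: mult_ac)
      qed (use \<tau> in auto)
      then have "sq_int lborel (\<lambda>x. complex_of_real (exp (cmod (\<omega> x))) * g (1/2 + \<tau>) x)"
        unfolding g_def using \<tau> by (intro sq_int_exp_bounded_gaussian) (use \<omega>m in \<open>auto intro!: borel_measurable_of_real\<close>)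
      from integrable_norm[OF sq_int_mult'[OF f this]]
      show "integrable lborel (\<lambda>x. cmod (h x) * exp (cmod (\<omega> x)))"
        by (simp add: h_def norm_mult mult_ac)
      fix k
      have "(LINT x|lborel. f x * (L (complex_vec x) ^ k * g (1/2 + \<tau>) x)) = 0"
        using claims[of "Suc j"] cpoly_power[OF L, of k] unfolding Claim_def \<tau>_def by blast
      then show "(LINT x|lborel. h x * \<omega> x ^ k) = 0" by (simp add: h_def \<omega>L mult_ac)
    qed (rule \<omega>m)
    moreover have "h0 x * of_real (exp (- \<tau> * (norm (x - w))\<^sup>2)) = of_real (exp (- \<tau> * (norm w)\<^sup>2)) * (h x * exp (\<omega> x))" for x
    proof -
      have "- \<tau> * (norm (x - w))\<^sup>2 = - \<tau> * (norm w)\<^sup>2 + (- \<tau> * (norm x)\<^sup>2) + 2 * \<tau> * (x \<bullet> w)"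
        by (simp add: power2_norm_eq_inner inner_diff_left inner_diff_right inner_commute algebra_simps)
      moreover have "exp (\<omega> x) = of_real (exp (2 * \<tau> * (x \<bullet> w)))" by (simp only: \<omega>_def exp_of_real)
      ultimately have "complex_of_real (exp (- \<tau> * (norm (x - w))\<^sup>2)) = of_real (exp (- \<tau> * (norm w)\<^sup>2)) * g \<tau> x * exp (\<omega> x)"
        by (simp only: exp_add of_real_mult g_def)
      then show ?thesis by (simp add: h0_def h_def g_add[symmetric] mult_ac)
    qed
    ultimately show ?thesis unfolding \<tau>_def[symmetric] by simp
  qed
  have "AE x in lborel. h0 x = 0"
    by (rule AE_eq_0_if_box_integrals[OF h0 integral_box_eq_0[OF h0 conv]]) simp
  then show ?thesis
    by eventually_elim (simp add: h0_def g_def)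
qed

lemma norm_Re_Im_vec: "(norm z)\<^sup>2 = (norm (Re_vec z))\<^sup>2 + (norm (Im_vec z))\<^sup>2" for z :: "complex^'n"
  by (simp add: norm_vec_def L2_set_def sum_nonneg Re_vec_def Im_vec_def cmod_power2 sum.distrib)

lemma Re_sum_sq: "Re (sum_sq z) = (norm (Re_vec z))\<^sup>2 - (norm (Im_vec z))\<^sup>2"
  by (simp add: sum_sq_def norm_vec_def L2_set_def sum_nonneg Re_vec_def Im_vec_def sum_subtractf Re_power2)

lemma norm_sum_sq_le: "cmod (sum_sq z) \<le> (norm z)\<^sup>2"
proof -
  have "cmod (sum_sq z) \<le> (\<Sum>i\<in>UNIV. (cmod (z $ i))\<^sup>2)"
    unfolding sum_sq_def by (rule sum_norm_le) (simp add: norm_power)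
  then show ?thesis by (simp add: norm_vec_def L2_set_def sum_nonneg)
qed

text \<open>The function \<open>e^(- \<tau> z\<^sup>2)\<close> turns the exponents \<open>T |x|\<^sup>2 - |y|\<^sup>2 / T\<close> of the weight into
  \<open>- (2 \<tau> - T) |x|\<^sup>2 - (1 / T - 2 \<tau>) |y|\<^sup>2\<close>; both coefficients must leave room for \<open>e^(2 \<delta> |z|\<^sup>2)\<close>.\<close>

lemma sq_int_U_measure:
  fixes k p :: "complex^'n \<Rightarrow> complex"
  assumes t: "t > 0" and k: "k \<in> borel_measurable borel" and p: "exp_bounded p" "p \<in> borel_measurable borel"
    and kp: "\<And>z. cmod (k z) \<le> cmod (p z) * exp (\<delta> * (norm z)\<^sup>2)"
    and d: "d > 0" "tanh (2 * t) + 2 * \<delta> + d \<le> 2 * \<tau>" "2 * \<tau> \<le> 1 / tanh (2 * t) - 2 * \<delta> - d"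
  shows "sq_int (U_measure t) (\<lambda>z. k z * exp (- of_real \<tau> * sum_sq z))"
proof (rule sq_int_norm_le)
  define T where "T = tanh (2 * t)"
  note T = tanh_facts[OF t, folded T_def]
  define S where "S = 2 ^ CARD('n) * sinh (4 * t) powr (- real CARD('n) / 2)"
  have S: "S > 0" using t by (simp add: S_def)
  have [measurable]: "k \<in> borel_measurable borel" "p \<in> borel_measurable borel" by (fact k p)+
  have [measurable]: "sum_sq \<in> borel_measurable borel"
    by (rule borel_measurable_continuous_onI[OF cpoly_continuous[OF cpoly_sum_sq]])
  have em: "(\<lambda>z. exp (- of_real \<tau> * sum_sq z)) \<in> borel_measurable borel"
    by (intro borel_measurable_continuous_onI continuous_intros cpoly_continuous[OF cpoly_sum_sq])
  then have km: "(\<lambda>z. k z * exp (- of_real \<tau> * sum_sq z)) \<in> borel_measurable borel" by measurable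
  then show "(\<lambda>z. k z * exp (- of_real \<tau> * sum_sq z)) \<in> borel_measurable (U_measure t)"
    by (simp add: U_measure_def)
  define b where "b z = (cmod (k z * exp (- of_real \<tau> * sum_sq z)))\<^sup>2" for z
  have bm: "b \<in> borel_measurable borel" unfolding b_def[abs_def] using km by measurable
  have "integrable lborel (\<lambda>z. U_weight t z *\<^sub>R b z)"
  proof (rule Bochner_Integration.integrable_bound)
    have "integrable lborel (\<lambda>z. (p z * cnj (p z)) * complex_of_real (exp (- d * (norm z)\<^sup>2)))"
      using d by (intro integrable_exp_bounded_gaussian[of _ _ d] exp_bounded_mult exp_bounded_cnj p) auto
    then have "integrable lborel (\<lambda>z. S * norm ((p z * cnj (p z)) * complex_of_real (exp (- d * (norm z)\<^sup>2))))"
      by (intro integrable_mult_right integrable_norm)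
    then show "integrable lborel (\<lambda>z. S * ((cmod (p z))\<^sup>2 * exp (- d * (norm z)\<^sup>2)))"
      by (simp add: norm_mult power2_eq_square)
    show "(\<lambda>z. U_weight t z *\<^sub>R b z) \<in> borel_measurable lborel"
      using bm by measurable
    have "U_weight t z * b z \<le> S * ((cmod (p z))\<^sup>2 * exp (- d * (norm z)\<^sup>2))" for z
    proof -
      let ?x = "(norm (Re_vec z))\<^sup>2" and ?y = "(norm (Im_vec z))\<^sup>2"
      have U: "U_weight t z = S * exp (- (1 / T) * ?y + T * ?x)"
        by (simp add: U_weight_def S_def T(3)[unfolded T_def[symmetric]] T_def[symmetric] T(3))
      have "b z = (cmod (k z))\<^sup>2 * (exp (- \<tau> * (?x - ?y)))\<^sup>2"
        by (simp add: b_def norm_mult power_mult_distrib Re_sum_sq)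
      also have "\<dots> \<le> (cmod (p z) * exp (\<delta> * (norm z)\<^sup>2))\<^sup>2 * (exp (- \<tau> * (?x - ?y)))\<^sup>2"
        using kp by (intro mult_right_mono power_mono) auto
      also have "\<dots> = (cmod (p z))\<^sup>2 * exp (2 * \<delta> * (?x + ?y) - 2 * \<tau> * (?x - ?y))"
        by (simp add: norm_Re_Im_vec power_mult_distrib power2_eq_square[of "exp _"] exp_add[symmetric] algebra_simps)
      finally have "U_weight t z * b z \<le> S * exp (- (1 / T) * ?y + T * ?x) * ((cmod (p z))\<^sup>2 * exp (2 * \<delta> * (?x + ?y) - 2 * \<tau> * (?x - ?y)))"
        unfolding U using S by (intro mult_left_mono) auto
      also have "\<dots> = S * ((cmod (p z))\<^sup>2 * exp ((- (1 / T) * ?y + T * ?x) + (2 * \<delta> * (?x + ?y) - 2 * \<tau> * (?x - ?y))))"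
        by (simp only: exp_add mult_ac)
      also have "\<dots> \<le> S * ((cmod (p z))\<^sup>2 * exp (- d * (norm z)\<^sup>2))"
      proof -
        have "(T + 2 * \<delta> + d) * ?x \<le> 2 * \<tau> * ?x" "2 * \<tau> * ?y \<le> (1 / T - 2 * \<delta> - d) * ?y"
          using d(2,3) unfolding T_def by (auto intro!: mult_right_mono)
        then have "(- (1 / T) * ?y + T * ?x) + (2 * \<delta> * (?x + ?y) - 2 * \<tau> * (?x - ?y)) \<le> - d * (norm z)\<^sup>2"
          unfolding norm_Re_Im_vec by (simp add: algebra_simps)
        then show ?thesis using S by (intro mult_left_mono) auto
      qed
      finally show ?thesis .
    qed
    moreover have "U_weight t z * b z \<ge> 0" for z using U_weight_pos[OF t, of z] by (simp add: b_def)
    ultimately show "AE z in lborel. norm (U_weight t z *\<^sub>R b z) \<le> norm (S * ((cmod (p z))\<^sup>2 * exp (- d * (norm z)\<^sup>2)))"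
      by (intro AE_I2) (simp add: order_trans[OF _ abs_ge_self])
  qed
  then show "integrable (U_measure t) b" using integrable_U_measure[OF t bm] by simp
  show "(cmod (k z * exp (- of_real \<tau> * sum_sq z)))\<^sup>2 \<le> b z" for z by (simp add: b_def)
qed

text \<open>As on \<open>\<real>\<^sup>n\<close>, \<open>F\<close> is orthogonal to all polynomials times \<open>e^(- \<tau> z\<^sup>2)\<close> for \<open>\<tau> = 1 / 2\<close>. Steps of size at most
  \<open>(1 - T) / 4\<close> lead to \<open>\<tau>\<^sub>1 = (T + 1 / T) / 4\<close>, the value at which \<open>|e^(- \<tau>\<^sub>1 z\<^sup>2)|\<^sup>2 U\<^sub>t\<close> is a multiple of
  \<open>e^(- \<kappa> |z|\<^sup>2)\<close> with \<open>\<kappa> = (1 / T - T) / 2\<close>. Thus \<open>G = F e^(\<tau>\<^sub>1 z\<^sup>2)\<close> is orthogonal, for this weight, to all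
  exponentials of linear forms. The exponential of \<open>\<kappa> z \<cdot> w\<close> with conjugated \<open>w\<close> acts as the reproducing kernel: translating by
  \<open>w\<close> and applying the mean value property leaves a positive multiple of \<open>G w\<close>.\<close>

theorem hermite_complete_entire:
  fixes F :: "complex^'n \<Rightarrow> complex"
  assumes t: "t > 0" and F: "entire F" and sqF: "sq_int (U_measure t) F"
    and orth: "\<And>\<alpha>. inner_prod (U_measure t) F (multi_hermite_ext \<alpha>) = 0"
  shows "F w = 0"
proof -
  define T where "T = tanh (2 * t)"
  note T = tanh_facts[OF t, folded T_def]
  define S where "S = 2 ^ CARD('n) * sinh (4 * t) powr (- real CARD('n) / 2)"
  have S: "S > 0" using t by (simp add: S_def)
  define E where "E \<tau> z = exp (- of_real \<tau> * sum_sq z)" for \<tau> and z :: "complex^'n"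
  have E_add: "E a z * E b z = E (a + b) z" for a b z
    by (simp add: E_def exp_add[symmetric] algebra_simps)
  have Em [measurable]: "E \<tau> \<in> borel_measurable borel" for \<tau>
    unfolding E_def[abs_def] by (intro borel_measurable_continuous_onI continuous_intros cpoly_continuous[OF cpoly_sum_sq])
  have Fm [measurable]: "F \<in> borel_measurable borel"
    by (rule borel_measurable_continuous_onI[OF entire_continuous[OF F]])
  have pm: "q \<in> borel_measurable borel" if "cpoly q" for q :: "complex^'n \<Rightarrow> complex"
    by (rule borel_measurable_continuous_onI[OF cpoly_continuous[OF that]])
  have MUm: "borel_measurable (U_measure t) = borel_measurable (borel :: (complex^'n) measure)"
    unfolding U_measure_def by (intro measurable_cong_sets) auto
  define \<tau>1 where "\<tau>1 = (T + 1 / T) / 4"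
  define \<kappa> where "\<kappa> = (1 / T - T) / 2"
  \<comment> \<open>This gives both exponents on the whole path from \<open>1 / 2\<close> to \<open>\<tau>1\<close> the margin \<open>1 - T\<close>.\<close>
  have \<kappa>1: "\<kappa> \<ge> 1 - T"
  proof -
    have "\<kappa> - (1 - T) = (1 - T)\<^sup>2 / (2 * T)" using T by (simp add: \<kappa>_def power2_eq_square field_simps)
    also have "\<dots> \<ge> 0" using T by simp
    finally show ?thesis by simp
  qed
  then have \<kappa>: "\<kappa> > 0" using T by linarith
  have \<tau>1: "2 * \<tau>1 = T + \<kappa>" "2 * \<tau>1 = 1 / T - \<kappa>" by (simp_all add: \<tau>1_def \<kappa>_def field_simps)
  have \<tau>1_ge: "2 * \<tau>1 \<ge> 1" using \<tau>1 \<kappa>1 by linarith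
  have sqE: "sq_int (U_measure t) (\<lambda>z. k z * E \<tau> z)"
    if "k \<in> borel_measurable borel" "exp_bounded p" "p \<in> borel_measurable borel"
      "\<And>z. cmod (k z) \<le> cmod (p z) * exp (\<delta> * (norm z)\<^sup>2)" "1 / 2 \<le> \<tau>" "\<tau> \<le> \<tau>1" "\<delta> \<le> (1 - T) / 4" for k p \<delta> \<tau>
    unfolding E_def
  proof (rule sq_int_U_measure[OF t that(1-4)])
    show "(1 - T) / 2 > 0" using T by simp
    show "tanh (2 * t) + 2 * \<delta> + (1 - T) / 2 \<le> 2 * \<tau>"
      unfolding T_def[symmetric] using that(5-7) by (simp add: field_simps)
    show "2 * \<tau> \<le> 1 / tanh (2 * t) - 2 * \<delta> - (1 - T) / 2"
    proof -
      have "2 * \<tau> \<le> 1 / T - \<kappa>" using that(6) \<tau>1(2) by simp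
      moreover have "2 * \<delta> + (1 - T) / 2 \<le> \<kappa>" using that(7) \<kappa>1 by (simp add: field_simps)
      ultimately show ?thesis unfolding T_def[symmetric] by simp
    qed
  qed
  have sqP: "sq_int (U_measure t) (\<lambda>z. q z * E \<tau> z)" if "cpoly q" "1 / 2 \<le> \<tau>" "\<tau> \<le> \<tau>1" for q \<tau>
    by (rule sqE[of q q 0]) (use that pm cpoly_exp_bounded T in auto)
  define Claim where "Claim \<tau> \<longleftrightarrow> (\<forall>q. cpoly q \<longrightarrow> inner_prod (U_measure t) (\<lambda>z. q z * E \<tau> z) F = 0)" for \<tau>
  have base: "Claim (1/2)"
    unfolding Claim_def
  proof (intro allI impI)
    fix q :: "complex^'n \<Rightarrow> complex" assume "cpoly q"
    then have "hermite_span q" by (rule hermite_span_cpoly)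
    then show "inner_prod (U_measure t) (\<lambda>z. q z * E (1/2) z) F = 0"
    proof (induction rule: hermite_span.induct)
      case (hs_base \<alpha>)
      let ?c = "complex_of_real (\<Prod>i\<in>UNIV. hermite_const (\<alpha> i))"
      have "multi_hermite_ext \<alpha> = (\<lambda>z. ?c * (multi_hermite_poly \<alpha> z * E (1/2) z))"
        by (simp add: fun_eq_iff multi_hermite_ext_eq E_def)
      then have "inner_prod (U_measure t) (multi_hermite_ext \<alpha>) F = ?c * inner_prod (U_measure t) (\<lambda>z. multi_hermite_poly \<alpha> z * E (1/2) z) F"
        by (simp only: inner_prod_cmult_left)
      moreover have "inner_prod (U_measure t) (multi_hermite_ext \<alpha>) F = 0" using orth[of \<alpha>] by (subst inner_prod_cnj) simp
      moreover have "?c \<noteq> 0" using hermite_const_pos by (simp add: less_imp_neq[symmetric])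
      ultimately show ?case by simp
    next
      case (hs_scale p c)
      have "(\<lambda>z. c * p z * E (1/2) z) = (\<lambda>z. c * (p z * E (1/2) z))" by (simp add: mult_ac)
      then show ?case using hs_scale.IH by (simp only: inner_prod_cmult_left mult_zero_right)
    next
      case (hs_add p q)
      have "(\<lambda>z. (p z + q z) * E (1/2) z) = (\<lambda>z. p z * E (1/2) z + q z * E (1/2) z)"
        by (simp add: distrib_right)
      moreover have "inner_prod (U_measure t) (\<lambda>z. p z * E (1/2) z + q z * E (1/2) z) F = inner_prod (U_measure t) (\<lambda>z. p z * E (1/2) z) F + inner_prod (U_measure t) (\<lambda>z. q z * E (1/2) z) F"
        by (intro inner_prod_add_left sqP sqF hermite_span_imp_cpoly hs_add.hyps) (use \<tau>1_ge in auto)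
      ultimately show ?case using hs_add.IH by simp
    qed
  qed
  have step: "Claim (\<tau> + \<delta>)" if C: "Claim \<tau>" and \<delta>: "0 \<le> \<delta>" "\<delta> \<le> (1 - T) / 4" "1 / 2 \<le> \<tau>" "\<tau> \<le> \<tau>1" for \<tau> \<delta>
    unfolding Claim_def
  proof (intro allI impI)
    fix q :: "complex^'n \<Rightarrow> complex" assume q: "cpoly q"
    define h where "h z = (q z * E \<tau> z) * cnj (F z)" for z
    define \<omega> where "\<omega> z = (- of_real \<delta>) * sum_sq z" for z :: "complex^'n"
    note [measurable] = pm[OF q] pm[OF cpoly_sum_sq]
    have "(LINT z|U_measure t. h z * exp (\<omega> z)) = 0"
    proof (rule integral_exp_eq_0(2))
      show "h \<in> borel_measurable (U_measure t)" unfolding MUm h_def[abs_def] by measurable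
      show "\<omega> \<in> borel_measurable (U_measure t)" unfolding MUm \<omega>_def[abs_def] by measurable
      have "sq_int (U_measure t) (\<lambda>z. (q z * of_real (exp (cmod (\<omega> z)))) * E \<tau> z)"
      proof (rule sqE[of _ q \<delta>])
        show "(\<lambda>z. q z * of_real (exp (cmod (\<omega> z)))) \<in> borel_measurable borel"
          unfolding \<omega>_def by measurable
        fix z :: "complex^'n"
        have "cmod (\<omega> z) \<le> \<delta> * (norm z)\<^sup>2"
          unfolding \<omega>_def using norm_sum_sq_le[of z] \<delta> by (simp add: norm_mult mult_left_mono)
        then show "cmod (q z * of_real (exp (cmod (\<omega> z)))) \<le> cmod (q z) * exp (\<delta> * (norm z)\<^sup>2)"
          by (simp add: norm_mult mult_left_mono)
      qed (use \<delta> pm[OF q] cpoly_exp_bounded[OF q] in auto)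
      from integrable_norm[OF sq_int_mult[OF this sqF]]
      show "integrable (U_measure t) (\<lambda>z. cmod (h z) * exp (cmod (\<omega> z)))"
        by (simp add: h_def norm_mult mult_ac)
      fix k
      have "cpoly (\<lambda>z. q z * ((- of_real \<delta>) * sum_sq z) ^ k)"
        by (intro cpoly_mult cpoly_power cpoly_const q cpoly_sum_sq)
      with C have "inner_prod (U_measure t) (\<lambda>z. (q z * ((- of_real \<delta>) * sum_sq z) ^ k) * E \<tau> z) F = 0"
        unfolding Claim_def by blast
      then show "(LINT z|U_measure t. h z * \<omega> z ^ k) = 0"
        unfolding inner_prod_def h_def \<omega>_def by (simp only: mult_ac)
    qed
    moreover have "h z * exp (\<omega> z) = (q z * E (\<tau> + \<delta>) z) * cnj (F z)" for z
    proof -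
      have "exp (\<omega> z) = E \<delta> z" by (simp only: \<omega>_def E_def)
      then show ?thesis by (simp add: h_def E_add[symmetric])
    qed
    ultimately show "inner_prod (U_measure t) (\<lambda>z. q z * E (\<tau> + \<delta>) z) F = 0" by (simp add: inner_prod_def)
  qed
  have "Claim \<tau>1"
  proof -
    \<comment> \<open>The number of steps that makes each of them short enough.\<close>
    define N where "N = Suc (nat \<lceil>(\<tau>1 - 1 / 2) * 4 / (1 - T)\<rceil>)"
    define \<delta> where "\<delta> = (\<tau>1 - 1 / 2) / N"
    have \<delta>0: "\<delta> \<ge> 0" using \<tau>1_ge by (simp add: \<delta>_def)
    have "(\<tau>1 - 1 / 2) * 4 / (1 - T) \<le> real N" unfolding N_def by linarith
    then have "(\<tau>1 - 1 / 2) * 4 \<le> real N * (1 - T)" using T by (simp add: divide_le_eq)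
    then have \<delta>1: "\<delta> \<le> (1 - T) / 4" by (simp add: \<delta>_def N_def divide_le_eq mult_ac del: of_nat_Suc)
    have N: "real N * \<delta> = \<tau>1 - 1 / 2" by (simp add: \<delta>_def N_def del: of_nat_Suc)
    have "Claim (1 / 2 + real j * \<delta>)" if "j \<le> N" for j
      using that
    proof (induction j)
      case (Suc j)
      have "real j * \<delta> \<le> real N * \<delta>" using Suc.prems \<delta>0 by (intro mult_right_mono) auto
      then have "1 / 2 + real j * \<delta> \<le> \<tau>1" using N by linarith
      then have "Claim (1 / 2 + real j * \<delta> + \<delta>)"
        using Suc \<delta>0 by (intro step[of "1 / 2 + real j * \<delta>" \<delta>] \<delta>1) auto
      then show ?case by (simp add: algebra_simps)
    qed (use base in simp)
    from this[of N] show ?thesis using N by simp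
  qed
  define \<omega> where "\<omega> z = (\<Sum>i\<in>UNIV. (of_real \<kappa> * cnj (w $ i)) * z $ i)" for z :: "complex^'n"
  have L: "cpoly \<omega>" unfolding \<omega>_def[abs_def] by (intro cpoly_sum cpoly_mult cpoly_const cpoly_nth)
  note [measurable] = pm[OF L]
  define h where "h z = E \<tau>1 z * cnj (F z)" for z
  have hm: "h \<in> borel_measurable (U_measure t)" "\<omega> \<in> borel_measurable (U_measure t)" unfolding MUm h_def[abs_def] by measurable
  have hint: "integrable (U_measure t) (\<lambda>z. cmod (h z) * exp (cmod (\<omega> z)))"
  proof -
    have "sq_int (U_measure t) (\<lambda>z. complex_of_real (exp (cmod (\<omega> z))) * E \<tau>1 z)"
    proof (rule sqE[of _ "\<lambda>z. complex_of_real (exp (cmod (\<omega> z)))" 0])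
      show "exp_bounded (\<lambda>z. complex_of_real (exp (cmod (\<omega> z))))"
      proof (rule exp_boundedI[of 1 "\<Sum>i\<in>UNIV. \<kappa> * cmod (w $ i)"])
        fix z :: "complex^'n"
        have "cmod (\<omega> z) \<le> (\<Sum>i\<in>UNIV. (\<kappa> * cmod (w $ i)) * norm z)"
          unfolding \<omega>_def
          by (rule sum_norm_le) (use \<kappa> in \<open>auto simp: norm_mult intro!: mult_left_mono Finite_Cartesian_Product.norm_nth_le\<close>)
        then show "cmod (complex_of_real (exp (cmod (\<omega> z)))) \<le> 1 * exp ((\<Sum>i\<in>UNIV. \<kappa> * cmod (w $ i)) * norm z)"
          by (simp add: sum_distrib_right)
      qed (use \<kappa> in \<open>auto intro: sum_nonneg\<close>)
    qed (use T \<tau>1_ge in auto)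
    from integrable_norm[OF sq_int_mult[OF this sqF]] show ?thesis
      by (simp add: h_def norm_mult mult_ac)
  qed
  have hzero: "(LINT z|U_measure t. h z * \<omega> z ^ k) = 0" for k
  proof -
    have "inner_prod (U_measure t) (\<lambda>z. \<omega> z ^ k * E \<tau>1 z) F = 0"
      using \<open>Claim \<tau>1\<close> cpoly_power[OF L, of k] unfolding Claim_def by blast
    then show ?thesis unfolding inner_prod_def h_def by (simp only: mult_ac)
  qed
  note he = integral_exp_eq_0[OF hm hint hzero]
  define G where "G z = F z * E (- \<tau>1) z" for z
  define f where "f z = G z * cnj (exp (\<omega> z)) * of_real (exp (- \<kappa> * (norm z)\<^sup>2))" for z
  have hexpm: "(\<lambda>z. h z * exp (\<omega> z)) \<in> borel_measurable borel"
  proof -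
    have "(\<lambda>z. exp (\<omega> z)) \<in> borel_measurable borel"
      by (intro borel_measurable_continuous_onI continuous_intros cpoly_continuous[OF L])
    then show ?thesis using hm unfolding MUm by measurable
  qed
  have fU: "cnj (U_weight t z *\<^sub>R (h z * exp (\<omega> z))) = of_real S * f z" for z
  proof -
    let ?x = "(norm (Re_vec z))\<^sup>2" and ?y = "(norm (Im_vec z))\<^sup>2"
    have U: "U_weight t z = S * exp (- (1 / T) * ?y + T * ?x)"
      by (simp add: U_weight_def S_def T_def[symmetric] T(3))
    have "cnj (E \<tau>1 z) * E \<tau>1 z = of_real ((cmod (E \<tau>1 z))\<^sup>2)"
      by (simp only: complex_norm_square mult.commute)
    also have "(cmod (E \<tau>1 z))\<^sup>2 = exp (- 2 * \<tau>1 * (?x - ?y))"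
      by (simp add: E_def Re_sum_sq power2_eq_square[of "exp _"] exp_add[symmetric])
    finally have EE: "cnj (E \<tau>1 z) * E \<tau>1 z = of_real (exp (- 2 * \<tau>1 * (?x - ?y)))" .
    have "exp (- (1 / T) * ?y + T * ?x) * exp (- 2 * \<tau>1 * (?x - ?y)) = exp (- \<kappa> * (norm z)\<^sup>2)"
    proof -
      have "(- (1 / T) * ?y + T * ?x) + (- 2 * \<tau>1 * (?x - ?y)) = (T - 2 * \<tau>1) * ?x + (2 * \<tau>1 - 1 / T) * ?y"
        by (simp add: algebra_simps)
      also have "T - 2 * \<tau>1 = - \<kappa>" using \<tau>1(1) by simp
      also have "2 * \<tau>1 - 1 / T = - \<kappa>" using \<tau>1(2) by simp
      finally show ?thesis by (simp only: exp_add[symmetric] norm_Re_Im_vec distrib_left)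
    qed
    then have "complex_of_real (exp (- (1 / T) * ?y + T * ?x)) * of_real (exp (- 2 * \<tau>1 * (?x - ?y))) = of_real (exp (- \<kappa> * (norm z)\<^sup>2))"
      by (simp only: of_real_mult[symmetric])
    then have EU: "of_real (U_weight t z) * (cnj (E \<tau>1 z) * E \<tau>1 z) = of_real S * complex_of_real (exp (- \<kappa> * (norm z)\<^sup>2))"
      unfolding EE U of_real_mult by (simp only: mult.assoc)
    have "E (- \<tau>1) z * E \<tau>1 z = 1" unfolding E_add by (simp add: E_def)
    then have FG: "F z = G z * E \<tau>1 z" by (simp add: G_def mult.assoc)
    have "cnj (U_weight t z *\<^sub>R (h z * exp (\<omega> z))) = of_real (U_weight t z) * (cnj (E \<tau>1 z) * F z * cnj (exp (\<omega> z)))"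
      by (simp add: h_def scaleR_conv_of_real)
    also have "\<dots> = (of_real (U_weight t z) * (cnj (E \<tau>1 z) * E \<tau>1 z)) * (G z * cnj (exp (\<omega> z)))"
      unfolding FG by (simp only: mult_ac)
    also have "\<dots> = of_real S * f z" unfolding EU f_def by (simp only: mult_ac)
    finally show ?thesis .
  qed
  have fint: "integrable lborel f"
  proof -
    have "integrable lborel (\<lambda>z. cnj (U_weight t z *\<^sub>R (h z * exp (\<omega> z))))"
      using he(1) integrable_U_measure[OF t hexpm] by (intro integrable_cnj) simp
    then have "integrable lborel (\<lambda>z. (1 / of_real S) * (of_real S * f z))"
      unfolding fU by (rule integrable_mult_right)
    then show ?thesis using S by simp
  qed
  have fzero: "(LINT z|lborel. f z) = 0"
  proof -
    have "(LINT z|lborel. cnj (U_weight t z *\<^sub>R (h z * exp (\<omega> z)))) = cnj 0"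
      unfolding Bochner_Integration.integral_cnj integral_U_measure[OF t hexpm, symmetric] he(2) ..
    then show ?thesis unfolding fU using S by simp
  qed
  define H where "H u = G (w + u) * exp (- of_real \<kappa> * (\<Sum>i\<in>UNIV. u $ i * cnj (w $ i)))" for u
  \<comment> \<open>In the exponent, the conjugate of \<open>z\<close> times \<open>w - z\<close> becomes the conjugate of \<open>w + u\<close> times \<open>- u\<close>.\<close>
  have fH: "f (w + u) = H u * of_real (exp (- \<kappa> * (norm u)\<^sup>2))" for u
  proof -
    have n2: "complex_of_real ((norm z)\<^sup>2) = (\<Sum>i\<in>UNIV. z $ i * cnj (z $ i))" for z :: "complex^'n"
      by (simp add: norm_vec_def L2_set_def sum_nonneg complex_norm_square[symmetric])
    have "cnj (\<omega> (w + u)) - of_real \<kappa> * of_real ((norm (w + u))\<^sup>2)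
        = - of_real \<kappa> * (\<Sum>i\<in>UNIV. u $ i * cnj (w $ i)) - of_real \<kappa> * of_real ((norm u)\<^sup>2)"
      unfolding n2 \<omega>_def
      by (simp add: sum_distrib_left sum_subtractf[symmetric] sum_negf[symmetric] algebra_simps)
         (intro sum.cong refl, simp)
    then have "exp (cnj (\<omega> (w + u)) + complex_of_real (- \<kappa> * (norm (w + u))\<^sup>2))
        = exp (- of_real \<kappa> * (\<Sum>i\<in>UNIV. u $ i * cnj (w $ i)) + complex_of_real (- \<kappa> * (norm u)\<^sup>2))"
      by simp
    then have "cnj (exp (\<omega> (w + u))) * of_real (exp (- \<kappa> * (norm (w + u))\<^sup>2))
        = exp (- of_real \<kappa> * (\<Sum>i\<in>UNIV. u $ i * cnj (w $ i))) * of_real (exp (- \<kappa> * (norm u)\<^sup>2))"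
      unfolding exp_add exp_of_real exp_cnj[symmetric] .
    then show ?thesis unfolding f_def H_def by (simp only: mult.assoc)
  qed
  have fm: "f \<in> borel_measurable borel" using borel_measurable_integrable[OF fint] by simp
  have mt: "(+) w \<in> measurable lborel borel" by simp
  have Hint: "integrable lborel (\<lambda>u. H u * of_real (exp (- \<kappa> * (norm u)\<^sup>2)))"
  proof -
    have "integrable (distr lborel borel ((+) w)) f" using fint by (simp add: lborel_distr_plus)
    then have "integrable lborel (\<lambda>u. f (w + u))" by (rule integrable_distr_eq[OF mt fm, THEN iffD1])
    then show ?thesis unfolding fH .
  qed
  have Hzero: "(LINT u|lborel. H u * of_real (exp (- \<kappa> * (norm u)\<^sup>2))) = 0"
  proof -
    have "(LINT u|lborel. f (w + u)) = (LINT z|distr lborel borel ((+) w). f z)"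
      by (rule integral_distr[OF mt fm, symmetric])
    then show ?thesis unfolding fH by (simp add: lborel_distr_plus fzero)
  qed
  have Hcont: "continuous_on UNIV H"
    unfolding H_def G_def E_def
    by (intro continuous_intros continuous_on_compose2[OF entire_continuous[OF F, of UNIV]]
        continuous_on_compose2[OF cpoly_continuous[OF cpoly_sum_sq, of UNIV]]) auto
  have Hhol: "(\<lambda>\<zeta>. H (\<zeta> *s u)) holomorphic_on UNIV" for u
  proof -
    have eq: "(\<lambda>\<zeta>. H (\<zeta> *s u)) = (\<lambda>\<zeta>. F (w + \<zeta> *s u) * exp (of_real \<tau>1 * (\<Sum>i\<in>UNIV. (w $ i + \<zeta> * u $ i)\<^sup>2)) *
        exp (- of_real \<kappa> * (\<Sum>i\<in>UNIV. \<zeta> * u $ i * cnj (w $ i))))"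
      by (simp add: H_def G_def E_def sum_sq_def)
    show ?thesis
      unfolding eq by (intro holomorphic_intros entire_line[OF F])
  qed
  have "0 = H 0 * of_real (LINT u|lborel. exp (- \<kappa> * (norm (u :: complex^'n))\<^sup>2))"
    using gaussian_mean_value[OF Hcont Hhol Hint] Hzero by simp
  moreover have "(LINT u|lborel. exp (- \<kappa> * (norm (u :: complex^'n))\<^sup>2)) > 0"
    using integrable_gaussian[OF \<kappa>, where ?'a = "complex^'n"] by (intro integral_continuous_pos) auto
  ultimately have "H 0 = 0" by simp
  then show ?thesis by (simp add: H_def G_def E_def)
qed

section \<open>The multiplier of the transform\<close>

lemma has_bochner_integral_Ioo:
  fixes f :: "real \<Rightarrow> real"
  assumes f: "f \<in> borel_measurable borel" and nonneg: "\<And>x. 0 \<le> f x" and I: "(f has_integral I) {0..c}"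
  shows "has_bochner_integral lborel (\<lambda>r. indicator {0<..<c} r *\<^sub>R f r) I"
proof (rule has_bochner_integral_nn_integral)
  show m: "(\<lambda>r. indicator {0<..<c} r *\<^sub>R f r) \<in> borel_measurable lborel" using f by measurable
  show "AE x in lborel. 0 \<le> indicator {0<..<c} x *\<^sub>R f x" using nonneg by simp
  show "0 \<le> I" using I nonneg by (rule has_integral_nonneg) 
  have "(f has_integral I) {0<..<c}" using I by (simp add: has_integral_Icc_iff_Ioo)
  then have "((\<lambda>r. if r \<in> {0<..<c} then f r else 0) has_integral I) UNIV"
    by (subst has_integral_restrict_UNIV)
  also have "(\<lambda>r. if r \<in> {0<..<c} then f r else 0) = (\<lambda>r. indicator {0<..<c} r *\<^sub>R f r)"
    by (auto simp: indicator_def fun_eq_iff)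
  finally show "(\<integral>\<^sup>+ x. ennreal (indicator {0<..<c} x *\<^sub>R f x) \<partial>lborel) = ennreal I"
    by (intro nn_integral_has_integral_lborel) (use m nonneg in auto)
qed

lemma has_bochner_integral_powr:
  fixes a c :: real
  assumes "a > 0" "c \<ge> 0"
  shows "has_bochner_integral lborel (\<lambda>r. indicator {0<..<c} r *\<^sub>R (r powr (a - 1))) (c powr a / a)"
proof (rule has_bochner_integral_Ioo)
  show "((\<lambda>x. x powr (a - 1)) has_integral c powr a / a) {0..c}"
    using has_integral_powr_from_0[of "a - 1" c] assms by simp
qed auto

definition incomplete_gamma_integral :: "real \<Rightarrow> real \<Rightarrow> real \<Rightarrow> real" where
  "incomplete_gamma_integral a t l = (LINT r|lborel. indicator {0<..<t} r *\<^sub>R (r powr (a - 1) * exp (- l * r)))"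

lemma integrable_incomplete_gamma:
  fixes a t l :: real
  assumes a: "a > 0" and t: "t > 0" and l: "l \<ge> 0"
  shows "integrable lborel (\<lambda>r. indicator {0<..<t} r *\<^sub>R (r powr (a - 1) * exp (- l * r)))"
proof (rule Bochner_Integration.integrable_bound)
  show "integrable lborel (\<lambda>r. indicator {0<..<t} r *\<^sub>R (r powr (a - 1)))"
    using has_bochner_integral_powr[OF a, of t] t by (auto simp: has_bochner_integral_iff)
  show "AE r in lborel. norm (indicator {0<..<t} r *\<^sub>R (r powr (a - 1) * exp (- l * r))) \<le> norm (indicator {0<..<t} r *\<^sub>R (r powr (a - 1)))"
    using l by (intro AE_I2) (auto simp: indicator_def abs_mult intro!: mult_left_le)
qed measurable

text \<open>On \<open>(0, min t 1 / \<lambda>)\<close>, an interval inside \<open>(0, t)\<close>, the exponential is at least \<open>1 / e\<close>.\<close>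

lemma incomplete_gamma_lower:
  assumes a: "a > 0" and t: "t > 0" and l: "l \<ge> 1"
  shows "exp (- 1) * (min t 1) powr a / a * l powr (- a) \<le> incomplete_gamma_integral a t l"
proof -
  define u where "u = min t 1 / l"
  have u: "0 < u" "u \<le> t" "l * u \<le> 1"
  proof -
    show "0 < u" using t l by (simp add: u_def)
    have "min t 1 / l \<le> min t 1 / 1" using t l by (intro divide_left_mono) auto
    then have "u \<le> min t 1" by (simp add: u_def)
    then show "u \<le> t" by simp
    show "l * u \<le> 1" using l by (simp add: u_def)
  qed
  have J: "has_bochner_integral lborel (\<lambda>r. indicator {0<..<u} r *\<^sub>R (r powr (a - 1))) (u powr a / a)"
    using u by (intro has_bochner_integral_powr a) auto
  have "exp (- 1) * (u powr a / a) = (LINT r|lborel. exp (- 1) * (indicator {0<..<u} r *\<^sub>R (r powr (a - 1))))"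
    using J by (simp add: has_bochner_integral_iff)
  also have "\<dots> \<le> incomplete_gamma_integral a t l"
    unfolding incomplete_gamma_integral_def
  proof (rule integral_mono)
    show "integrable lborel (\<lambda>r. exp (- 1) * (indicator {0<..<u} r *\<^sub>R (r powr (a - 1))))"
      using J by (auto simp: has_bochner_integral_iff)
    show "integrable lborel (\<lambda>r. indicator {0<..<t} r *\<^sub>R (r powr (a - 1) * exp (- l * r)))"
      using l by (intro integrable_incomplete_gamma a t) auto
    fix r :: real
    show "exp (- 1) * (indicator {0<..<u} r *\<^sub>R (r powr (a - 1))) \<le> indicator {0<..<t} r *\<^sub>R (r powr (a - 1) * exp (- l * r))"
    proof (cases "r \<in> {0<..<u}")
      case True
      have "l * r \<le> l * u" using True l by simp
      then have "exp (- 1) \<le> exp (- l * r)" using u(3) by simp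
      then show ?thesis using True u(2) by (simp add: mult.commute[of "exp _"] mult_left_mono)
    next
      case False
      then show ?thesis by (auto simp: indicator_def)
    qed
  qed
  also have "u powr a = (min t 1) powr a * l powr (- a)"
    using t l by (simp add: u_def powr_divide powr_minus_divide)
  finally show ?thesis by simp
qed

text \<open>Below \<open>1 / \<lambda>\<close> drop the exponential; above it replace the power by its value at \<open>1 / \<lambda>\<close>, which is not smaller
  because the exponent \<open>a - 1\<close> is not positive.\<close>

lemma incomplete_gamma_upper:
  assumes a: "a > 0" "a \<le> 1" and t: "t > 0" and l: "l \<ge> 1"
  shows "incomplete_gamma_integral a t l \<le> (1 / a + 1) * l powr (- a)"
proof -
  have J: "has_bochner_integral lborel (\<lambda>r. indicator {0<..<1/l} r *\<^sub>R (r powr (a - 1))) ((1/l) powr a / a)"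
    using l by (intro has_bochner_integral_powr a) auto
  have "((\<lambda>r. exp (- l * r)) has_integral (- exp (- l * t) / l) - (- exp (- l * 0) / l)) {0..t}"
    using t l by (intro fundamental_theorem_of_calculus)
      (auto intro!: derivative_eq_intros simp: has_real_derivative_iff_has_vector_derivative[symmetric])
  from has_bochner_integral_Ioo[OF _ _ this]
  have E: "has_bochner_integral lborel (\<lambda>r. indicator {0<..<t} r *\<^sub>R exp (- l * r)) ((1 - exp (- l * t)) / l)"
    by (simp add: diff_divide_distrib)
  have "incomplete_gamma_integral a t l \<le>
      (LINT r|lborel. indicator {0<..<1/l} r *\<^sub>R (r powr (a - 1)) + l powr (1 - a) * (indicator {0<..<t} r *\<^sub>R exp (- l * r)))"
    unfolding incomplete_gamma_integral_def
  proof (rule integral_mono)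
    show "integrable lborel (\<lambda>r. indicator {0<..<t} r *\<^sub>R (r powr (a - 1) * exp (- l * r)))"
      using l by (intro integrable_incomplete_gamma a t) auto
    show "integrable lborel (\<lambda>r. indicator {0<..<1/l} r *\<^sub>R (r powr (a - 1)) + l powr (1 - a) * (indicator {0<..<t} r *\<^sub>R exp (- l * r)))"
      using J E by (auto simp: has_bochner_integral_iff)
    fix r :: real
    show "indicator {0<..<t} r *\<^sub>R (r powr (a - 1) * exp (- l * r)) \<le>
        indicator {0<..<1/l} r *\<^sub>R (r powr (a - 1)) + l powr (1 - a) * (indicator {0<..<t} r *\<^sub>R exp (- l * r))"
    proof (cases "r \<in> {0<..<t}")
      case True
      then have r: "r > 0" by simp
      show ?thesis
      proof (cases "r < 1 / l")
        case True
        have "r powr (a - 1) * exp (- l * r) \<le> r powr (a - 1) * 1"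
          using r l by (intro mult_left_mono) auto
        then show ?thesis using True r \<open>r \<in> {0<..<t}\<close> by (simp add: add_increasing2)
      next
        case False
        then have "r powr (a - 1) \<le> (1 / l) powr (a - 1)"
          using a l by (intro powr_mono2') auto
        also have "\<dots> = l powr (1 - a)"
          using l powr_minus_divide[of l "a - 1"] by (simp add: powr_divide)
        finally have "r powr (a - 1) * exp (- l * r) \<le> l powr (1 - a) * exp (- l * r)"
          by (intro mult_right_mono) auto
        then show ?thesis using \<open>r \<in> {0<..<t}\<close> False by simp
      qed
    qed (auto simp: indicator_def)
  qed
  also have "\<dots> = (1/l) powr a / a + l powr (1 - a) * ((1 - exp (- l * t)) / l)"
    using J E by (simp add: has_bochner_integral_iff)
  also have "\<dots> \<le> (1/l) powr a / a + l powr (1 - a) * (1 / l)"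
    using l by (intro add_left_mono mult_left_mono divide_right_mono) auto
  also have "(1/l) powr a = l powr (- a)"
    using l by (simp add: powr_divide powr_minus_divide)
  also have "l powr (1 - a) * (1 / l) = l powr (- a)"
  proof -
    have "l powr (1 - a) = l * l powr (- a)" using powr_add[of l 1 "- a"] l by simp
    then show ?thesis using l by simp
  qed
  also have "l powr (- a) / a + l powr (- a) = (1 / a + 1) * l powr (- a)"
    by (simp add: distrib_right)
  finally show ?thesis .
qed

text \<open>The eigenvalue of the transform on an eigenfunction of the Hermite operator with eigenvalue \<open>l\<close>, up
  to the sign \<open>(- 1)^m\<close> and the factor \<open>e^(- l t)\<close>.\<close>

definition heat_multiplier :: "real \<Rightarrow> real \<Rightarrow> real \<Rightarrow> real" where
  "heat_multiplier t s l = (let m = transform_order s; a = real m - s / 2 in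
     l ^ m * incomplete_gamma_integral a t l / Gamma a)"

lemma transform_order_bounds:
  assumes "s > 0"
  shows "0 < real (transform_order s) - s / 2" "real (transform_order s) - s / 2 \<le> 1"
  using transform_order_unique[OF assms, of "transform_order s"] by auto

text \<open>The exponents add up: \<open>m - a = s / 2\<close>.\<close>

lemma heat_multiplier_bounds:
  assumes t: "t > 0" and s: "s > 0"
  obtains c C where "c > 0" "C > 0"
    "\<And>l. l \<ge> 1 \<Longrightarrow> c * l powr (s / 2) \<le> heat_multiplier t s l"
    "\<And>l. l \<ge> 1 \<Longrightarrow> heat_multiplier t s l \<le> C * l powr (s / 2)"
proof -
  define m where "m = transform_order s"
  define a where "a = real m - s / 2"
  have a: "0 < a" "a \<le> 1" using transform_order_bounds[OF s] by (auto simp: a_def m_def)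
  have G: "Gamma a > 0" using a by (rule_tac Gamma_real_pos)
  have hm: "heat_multiplier t s l = l ^ m / Gamma a * incomplete_gamma_integral a t l" for l
    by (simp add: heat_multiplier_def Let_def a_def m_def)
  have pw: "l ^ m * l powr (- a) = l powr (s / 2)" if "l \<ge> 1" for l
    using that by (simp add: powr_realpow[symmetric] powr_add[symmetric] a_def)
  show ?thesis
  proof (rule that)
    show "exp (- 1) * (min t 1) powr a / a / Gamma a > 0" "(1 / a + 1) / Gamma a > 0"
      using a G t by (auto intro!: divide_pos_pos add_pos_pos)
    fix l :: real assume l: "l \<ge> 1"
    have "l ^ m / Gamma a * (exp (- 1) * (min t 1) powr a / a * l powr (- a)) \<le> heat_multiplier t s l"
      unfolding hm using l G incomplete_gamma_lower[OF a(1) t l] by (intro mult_left_mono) auto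
    also have "l ^ m / Gamma a * (exp (- 1) * (min t 1) powr a / a * l powr (- a)) = exp (- 1) * (min t 1) powr a / a / Gamma a * l powr (s / 2)"
      unfolding pw[OF l, symmetric] by (simp add: mult_ac)
    finally show "exp (- 1) * (min t 1) powr a / a / Gamma a * l powr (s / 2) \<le> heat_multiplier t s l" .
    have "heat_multiplier t s l \<le> l ^ m / Gamma a * ((1 / a + 1) * l powr (- a))"
      unfolding hm using l G incomplete_gamma_upper[OF a t l] by (intro mult_left_mono) auto
    also have "\<dots> = (1 / a + 1) / Gamma a * l powr (s / 2)"
      unfolding pw[OF l, symmetric] by simp
    finally show "heat_multiplier t s l \<le> (1 / a + 1) / Gamma a * l powr (s / 2)" .
  qed
qed

section \<open>The semigroup and the transform as Hermite expansions\<close>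

lemma L2_iff: "f \<in> L2 \<longleftrightarrow> sq_int lborel f"
  by (simp add: L2_def sq_int_def)

lemma L2_norm_eq: "L2_norm f = sqrt (norm_sq lborel f)"
  by (simp add: L2_norm_def norm_sq_def)

abbreviation hermite_coeff :: "(real^'n \<Rightarrow> complex) \<Rightarrow> ('n \<Rightarrow> nat) \<Rightarrow> complex" where
  "hermite_coeff f \<alpha> \<equiv> inner_prod lborel f (multi_hermite_fun \<alpha>)"

lemma hermite_proj_eq: "hermite_proj k f x = (\<Sum>\<alpha> | total_deg \<alpha> = k. hermite_coeff f \<alpha> * multi_hermite_fun \<alpha> x)"
  by (simp add: hermite_proj_def total_deg_def L2_inner_def inner_prod_def)

lemma norm_sq_hermite_proj: "(L2_norm (hermite_proj k f))\<^sup>2 = shell total_deg (hermite_coeff f) k"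
proof -
  interpret R: graded_ons "lborel :: (real^'n) measure" multi_hermite_fun total_deg by (rule hermite_ons)
  show ?thesis
    unfolding L2_norm_eq hermite_proj_eq[abs_def] by (simp add: R.norm_sq_comb finite_total_deg shell_def sum_nonneg)
qed

lemma subexp_coeff_bounded:
  assumes "\<And>\<alpha>. cmod (a \<alpha>) \<le> C" shows "subexp_coeff a"
  unfolding subexp_coeff_def by (rule subexp_on_bounded) (rule assms)

lemma subexp_coeff_shell:
  fixes a :: "('n::finite \<Rightarrow> nat) \<Rightarrow> complex"
  assumes a: "summable (shell total_deg a)" shows "subexp_coeff a"
proof (rule subexp_coeff_bounded)
  fix \<alpha> :: "'n \<Rightarrow> nat"
  have "(cmod (a \<alpha>))\<^sup>2 \<le> shell total_deg a (total_deg \<alpha>)"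
    unfolding shell_def by (rule member_le_sum) (auto simp: finite_total_deg)
  also have "\<dots> = (\<Sum>k\<in>{total_deg \<alpha>}. shell total_deg a k)" by simp
  also have "\<dots> \<le> suminf (shell total_deg a)" by (rule sum_le_suminf[OF a]) auto
  finally show "cmod (a \<alpha>) \<le> sqrt (suminf (shell total_deg a))" by (rule real_le_rsqrt)
qed

lemma subexp_coeff_hermite:
  fixes f :: "real^'n \<Rightarrow> complex"
  assumes "sq_int lborel f" shows "summable (shell total_deg (hermite_coeff f))" "subexp_coeff (hermite_coeff f)"
proof -
  interpret R: graded_ons "lborel :: (real^'n) measure" multi_hermite_fun total_deg by (rule hermite_ons)
  show "summable (shell total_deg (hermite_coeff f))" by (rule R.bessel[OF assms])
  then show "subexp_coeff (hermite_coeff f)" by (rule subexp_coeff_shell)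
qed

lemma entire_diff: "entire F \<Longrightarrow> entire G \<Longrightarrow> entire (\<lambda>z. F z - G z)"
  unfolding entire_def
proof
  fix z assume "\<forall>z. \<exists>D. (F has_derivative D) (at z) \<and> (\<forall>c v. D (c *s v) = c * D v)"
    "\<forall>z. \<exists>D. (G has_derivative D) (at z) \<and> (\<forall>c v. D (c *s v) = c * D v)"
  then obtain D E where "(F has_derivative D) (at z)" "\<And>c v. D (c *s v) = c * D v"
    "(G has_derivative E) (at z)" "\<And>c v. E (c *s v) = c * E v"
    by metis
  then show "\<exists>D. ((\<lambda>z. F z - G z) has_derivative D) (at z) \<and> (\<forall>c v. D (c *s v) = c * D v)"
    by (intro exI[of _ "\<lambda>v. D v - E v"]) (auto intro: has_derivative_diff simp: right_diff_distrib)
qed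

lemma expansion_upto_tendsto:
  fixes a :: "('n::finite \<Rightarrow> nat) \<Rightarrow> complex"
  assumes e: "\<And>\<alpha> x. b \<alpha> * e \<alpha> x = of_real (exp (- eigenval TYPE('n) (total_deg \<alpha>) * \<rho>)) * (a \<alpha> * multi_hermite_ext \<alpha> (\<phi> x))"
    and a: "subexp_coeff a" "\<rho> > 0"
  shows "(\<lambda>N. expansion_upto total_deg e b N x) \<longlonglongrightarrow> hermite_series \<rho> a (\<phi> x)"
proof -
  have "expansion_upto total_deg e b N x = (\<Sum>k<N. of_real (exp (- eigenval TYPE('n) k * \<rho>)) * (\<Sum>\<alpha> | total_deg \<alpha> = k. a \<alpha> * multi_hermite_ext \<alpha> (\<phi> x)))" for N
    unfolding expansion_upto_def sum_distrib_left by (intro sum.cong refl) (auto simp: e)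
  then show ?thesis
    using summable_LIMSEQ[OF summable_hermite_series[OF a]] by (simp add: hermite_series_def)
qed

text \<open>The partial sums converge pointwise to the Hermite series, and Fatou's lemma gives convergence in
  norm, so the series is the semigroup; it is the only entire candidate because two candidates agree
  almost everywhere on \<open>\<real>\<^sup>n\<close>.\<close>

lemma hermite_semigroup_eq:
  fixes f :: "real^'n \<Rightarrow> complex"
  assumes f: "sq_int lborel f" and \<rho>: "\<rho> > 0"
  shows "hermite_semigroup \<rho> f = hermite_series \<rho> (hermite_coeff f)"
proof -
  interpret R: graded_ons "lborel :: (real^'n) measure" multi_hermite_fun total_deg by (rule hermite_ons)
  define c where "c = hermite_coeff f"
  define b where "b \<alpha> = of_real (exp (- eigenval TYPE('n) (total_deg \<alpha>) * \<rho>)) * c \<alpha>" for \<alpha>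
  have c: "summable (shell total_deg c)" "subexp_coeff c"
    using subexp_coeff_hermite[OF f] by (auto simp: c_def)
  have b: "summable (shell total_deg b)"
  proof (rule summable_comparison_test'[OF c(1), of 0])
    fix k
    have "cmod (b \<alpha>) \<le> cmod (c \<alpha>)" for \<alpha>
    proof -
      have "0 \<le> eigenval TYPE('n) (total_deg \<alpha>) * \<rho>" using eigenval_ge_1[where ?'n='n, of "total_deg \<alpha>"] \<rho> by simp
      then show ?thesis by (simp add: b_def norm_mult mult_left_le_one_le)
    qed
    then have "shell total_deg b k \<le> shell total_deg c k"
      unfolding shell_def by (intro sum_mono power_mono) auto
    then show "norm (shell total_deg b k) \<le> shell total_deg c k" by simp
  qed
  have partial: "(\<Sum>k<N. of_real (exp (- (2 * real k + real CARD('n)) * \<rho>)) * hermite_proj k f x) = expansion_upto total_deg multi_hermite_fun b N x" for N x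
    unfolding hermite_proj_eq expansion_upto_def sum_distrib_left
    by (intro sum.cong refl) (auto simp: b_def c_def eigenval_def mult.assoc)
  have is_sg: "is_hermite_semigroup \<rho> f g \<longleftrightarrow> sq_int lborel g \<and> (\<lambda>N. norm_sq lborel (\<lambda>x. g x - expansion_upto total_deg multi_hermite_fun b N x)) \<longlonglongrightarrow> 0" for g
  proof -
    have "(\<lambda>N. sqrt (h N)) \<longlonglongrightarrow> 0 \<longleftrightarrow> h \<longlonglongrightarrow> 0" if "\<And>N. h N \<ge> 0" for h :: "nat \<Rightarrow> real"
    proof
      assume "(\<lambda>N. sqrt (h N)) \<longlonglongrightarrow> 0"
      from tendsto_power[OF this, of 2] show "h \<longlonglongrightarrow> 0" using that by simp
    next
      assume "h \<longlonglongrightarrow> 0"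
      from tendsto_real_sqrt[OF this] show "(\<lambda>N. sqrt (h N)) \<longlonglongrightarrow> 0" by simp
    qed
    then show ?thesis
      unfolding is_hermite_semigroup_def partial L2_iff L2_norm_eq by simp
  qed
  let ?F = "hermite_series \<rho> c"
  have F: "entire ?F" by (rule entire_hermite_series[OF c(2) \<rho>])
  have lim: "(\<lambda>N. expansion_upto total_deg multi_hermite_fun b N x) \<longlonglongrightarrow> ?F (complex_vec x)" for x
    by (rule expansion_upto_tendsto[OF _ c(2) \<rho>]) (simp add: b_def multi_hermite_fun_eq)
  have meas: "(\<lambda>x. ?F (complex_vec x)) \<in> borel_measurable lborel"
    using borel_measurable_continuous_onI[OF continuous_on_compose2[OF entire_continuous[OF F, of UNIV] continuous_on_complex_vec]]
    by simp
  note fat = R.fatou_limit[OF b strict_mono_id meas, unfolded id_apply, OF AE_I2[OF lim]]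
  show ?thesis
    unfolding hermite_semigroup_def c_def[symmetric]
  proof (rule the_equality)
    show "entire ?F \<and> is_hermite_semigroup \<rho> f (\<lambda>x. ?F (complex_vec x))"
      using F fat by (simp add: is_sg)
  next
    fix G assume "entire G \<and> is_hermite_semigroup \<rho> f (\<lambda>x. G (complex_vec x))"
    then have G: "entire G" "sq_int lborel (\<lambda>x. G (complex_vec x))"
      "(\<lambda>N. norm_sq lborel (\<lambda>x. G (complex_vec x) - expansion_upto total_deg multi_hermite_fun b N x)) \<longlonglongrightarrow> 0"
      by (auto simp: is_sg)
    have "AE x in lborel. G (complex_vec x) - ?F (complex_vec x) = 0"
    proof -
      have "norm_sq lborel (\<lambda>x. G (complex_vec x) - ?F (complex_vec x)) \<le>
         2 * norm_sq lborel (\<lambda>x. G (complex_vec x) - expansion_upto total_deg multi_hermite_fun b N x) + 2 * norm_sq lborel (\<lambda>x. ?F (complex_vec x) - expansion_upto total_deg multi_hermite_fun b N x)" for N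
      proof -
        have "norm_sq lborel (\<lambda>x. (G (complex_vec x) - expansion_upto total_deg multi_hermite_fun b N x) + (- 1) * (?F (complex_vec x) - expansion_upto total_deg multi_hermite_fun b N x)) \<le>
         2 * norm_sq lborel (\<lambda>x. G (complex_vec x) - expansion_upto total_deg multi_hermite_fun b N x) + 2 * norm_sq lborel (\<lambda>x. (- 1) * (?F (complex_vec x) - expansion_upto total_deg multi_hermite_fun b N x))"
          by (intro norm_sq_add_le R.sq_int_minus_expansion_upto sq_int_cmult G fat)
        then show ?thesis unfolding norm_sq_cmult by simp
      qed
      moreover have "(\<lambda>N. 2 * norm_sq lborel (\<lambda>x. G (complex_vec x) - expansion_upto total_deg multi_hermite_fun b N x) + 2 * norm_sq lborel (\<lambda>x. ?F (complex_vec x) - expansion_upto total_deg multi_hermite_fun b N x)) \<longlonglongrightarrow> 2 * 0 + 2 * 0"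
        by (intro tendsto_intros G fat)
      ultimately have "norm_sq lborel (\<lambda>x. G (complex_vec x) - ?F (complex_vec x)) \<le> 0"
        by (intro LIMSEQ_le_const[of _ "0::real"]) auto
      then have "norm_sq lborel (\<lambda>x. G (complex_vec x) - ?F (complex_vec x)) = 0"
        using norm_sq_nonneg[of lborel "\<lambda>x. G (complex_vec x) - ?F (complex_vec x)"] by linarith
      then show ?thesis
        by (subst (asm) norm_sq_eq_0_iff) (intro sq_int_diff G fat)
    qed
    from entire_eq_0_if_AE_real[OF entire_diff[OF G(1) F] this]
    show "G = ?F" by (simp add: fun_eq_iff)
  qed
qed

definition transform_coeff :: "real \<Rightarrow> real \<Rightarrow> ('n::finite \<Rightarrow> nat) \<Rightarrow> real" where
  "transform_coeff t s \<alpha> = (- 1) ^ transform_order s * heat_multiplier t s (eigenval TYPE('n) (total_deg \<alpha>))"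

text \<open>Differentiate the series \<open>m\<close> times and integrate it term by term. The function \<open>r^(a - 1)\<close> is integrable
  on \<open>(0, t)\<close>, and \<open>e^(- \<lambda> (r + t)) \<le> e^(- \<lambda> t)\<close> gives a summable majorant that is independent of \<open>r\<close>.\<close>

lemma gen_heat_transform_eq:
  fixes f :: "real^'n \<Rightarrow> complex"
  assumes f: "sq_int lborel f" and t: "t > 0" and s: "s > 0"
  shows "gen_heat_transform t s f = hermite_series t (\<lambda>\<alpha>. of_real (transform_coeff t s \<alpha>) * hermite_coeff f \<alpha>)"
proof
  fix z :: "complex^'n"
  let ?L = "eigenval TYPE('n)"
  define m where "m = transform_order s"
  define a where "a = real m - s / 2"
  have a: "0 < a" "a \<le> 1" using transform_order_bounds[OF s] by (auto simp: a_def m_def)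
  define p where "p k = (\<Sum>\<alpha> | total_deg \<alpha> = k. hermite_coeff f \<alpha> * multi_hermite_ext \<alpha> z)" for k
  have c: "subexp_coeff (hermite_coeff f)" by (rule subexp_coeff_hermite[OF f])
  have p: "subexp_on (UNIV :: unit set) (\<lambda>k. k) (\<lambda>k _. p k)"
    unfolding subexp_on_def
  proof (intro allI impI)
    fix \<delta> :: real assume \<delta>: "\<delta> > 0"
    show "\<exists>C. \<forall>k. \<forall>_\<in>(UNIV :: unit set). cmod (p k) \<le> C * exp (\<delta> * real k)"
    proof (rule subexp_onE[OF subexp_on_shell_sum[OF c, of "norm z"] \<delta>])
      fix C
      assume C: "\<And>k y. y \<in> cball 0 (norm z) \<Longrightarrow>
        cmod (\<Sum>\<alpha> | total_deg \<alpha> = k. hermite_coeff f \<alpha> * multi_hermite_ext \<alpha> y) \<le> C * exp (\<delta> * real k)"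
      show ?thesis using C[of z] by (auto simp: p_def)
    qed
  qed
  define v where "v k = of_real (exp (- ?L k * t)) * (of_real ((- ?L k) ^ m) * p k)" for k
  define w where "w r = indicator {0<..<t} r *\<^sub>R (r powr (a - 1))" for r :: real
  define F where "F k r = complex_of_real (w r * exp (- ?L k * r)) * v k" for k r
  have vsum: "summable (\<lambda>k. norm (v k))"
    unfolding v_def by (rule summable_hermite_series_deriv[OF p t])
  have w0: "w r \<ge> 0" for r by (simp add: w_def)
  have wint: "integrable lborel w"
    using has_bochner_integral_powr[OF a(1), of t] t by (auto simp: has_bochner_integral_iff w_def[abs_def])
  have wexp: "w r * exp (- ?L k * r) \<le> w r" for r k
  proof (cases "r > 0")
    case True
    then show ?thesis using w0[of r] eigenval_ge_1[where ?'n='n, of k] by (intro mult_left_le) auto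
  qed (simp add: w_def)
  have gint: "integrable lborel (\<lambda>r. w r * exp (- ?L k * r))" for k
    using integrable_incomplete_gamma[OF a(1) t, of "?L k"] eigenval_ge_1[where ?'n='n, of k] by (simp add: w_def mult.assoc)
  have Fint: "integrable lborel (F k)" for k
    unfolding F_def by (intro integrable_mult_left integrable_of_real gint)
  have Fnorm: "norm (F k r) \<le> w r * norm (v k)" for k r
    unfolding F_def norm_mult norm_of_real using wexp[of r k] w0[of r] by (intro mult_right_mono) auto
  have inner: "indicator {0<..<t} r *\<^sub>R (of_real (r powr (real m - s / 2 - 1)) *
      ((\<lambda>g \<rho>. vector_derivative g (at \<rho>)) ^^ m) (\<lambda>\<rho>. hermite_semigroup (\<rho> + t) f z) r) = (\<Sum>k. F k r)" for r
  proof (cases "r \<in> {0<..<t}")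
    case True
    have "((\<lambda>g \<rho>. vector_derivative g (at \<rho>)) ^^ m) (\<lambda>\<rho>. hermite_semigroup (\<rho> + t) f z) r = hermite_series_deriv TYPE('n) p m (r + t)"
    proof (rule iterated_vector_derivative_hermite_series_deriv[OF p])
      fix r assume "r > - t"
      then show "hermite_semigroup (r + t) f z = hermite_series_deriv TYPE('n) p 0 (r + t)"
        by (simp add: hermite_semigroup_eq[OF f] hermite_series_def hermite_series_deriv_def p_def)
    qed (use True t in auto)
    also have "\<dots> = (\<Sum>k. of_real (exp (- ?L k * r)) * v k)"
    proof -
      have "exp (- ?L k * (r + t)) = exp (- ?L k * r) * exp (- ?L k * t)" for k
        by (simp add: exp_add[symmetric] algebra_simps)
      then show ?thesis unfolding hermite_series_deriv_def v_def by (simp only: of_real_mult mult.assoc)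
    qed
    finally have "indicator {0<..<t} r *\<^sub>R (of_real (r powr (real m - s / 2 - 1)) *
      ((\<lambda>g \<rho>. vector_derivative g (at \<rho>)) ^^ m) (\<lambda>\<rho>. hermite_semigroup (\<rho> + t) f z) r) = of_real (w r) * (\<Sum>k. of_real (exp (- ?L k * r)) * v k)"
      using True by (simp add: w_def a_def)
    also have "\<dots> = (\<Sum>k. of_real (w r) * (of_real (exp (- ?L k * r)) * v k))"
    proof (rule suminf_mult[symmetric])
      show "summable (\<lambda>k. of_real (exp (- ?L k * r)) * v k)"
      proof (rule summable_comparison_test'[OF vsum, of 0])
        fix k
        have "0 \<le> ?L k * r" using True eigenval_ge_1[where ?'n='n, of k] by simp
        then show "norm (of_real (exp (- ?L k * r)) * v k) \<le> norm (v k)"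
          by (simp add: norm_mult mult_left_le_one_le)
      qed
    qed
    finally show ?thesis by (simp add: F_def mult.assoc)
  next
    case False
    then show ?thesis by (simp add: F_def w_def)
  qed
  have "(LINT r:{0<..<t}|lborel. of_real (r powr (real m - s / 2 - 1)) *
        ((\<lambda>g \<rho>. vector_derivative g (at \<rho>)) ^^ m) (\<lambda>\<rho>. hermite_semigroup (\<rho> + t) f z) r) = (LINT r|lborel. (\<Sum>k. F k r))"
    unfolding set_lebesgue_integral_def inner ..
  also have "\<dots> = (\<Sum>k. LINT r|lborel. F k r)"
  proof (rule integral_suminf[OF Fint])
    show "AE r in lborel. summable (\<lambda>k. norm (F k r))"
    proof (rule AE_I2)
      fix r show "summable (\<lambda>k. norm (F k r))"
        by (rule summable_comparison_test'[OF summable_mult[OF vsum, of "w r"], of 0]) (simp add: Fnorm)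
    qed
    show "summable (\<lambda>k. LINT r|lborel. norm (F k r))"
    proof (rule summable_comparison_test'[OF summable_mult[OF vsum, of "LINT r|lborel. w r"], of 0])
      fix k
      have "(LINT r|lborel. norm (F k r)) \<le> (LINT r|lborel. w r * norm (v k))"
        using Fnorm by (intro integral_mono integrable_norm Fint integrable_mult_left wint) auto
      then show "norm (LINT r|lborel. norm (F k r)) \<le> (LINT r|lborel. w r) * norm (v k)"
        by simp
    qed
  qed
  also have "(\<Sum>k. LINT r|lborel. F k r) = (\<Sum>k. of_real (incomplete_gamma_integral a t (?L k)) * v k)"
    unfolding F_def incomplete_gamma_integral_def w_def
    by (simp add: integral_complex_of_real mult.assoc del: of_real_mult)
  finally have I: "(LINT r:{0<..<t}|lborel. of_real (r powr (real m - s / 2 - 1)) *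
        ((\<lambda>g \<rho>. vector_derivative g (at \<rho>)) ^^ m) (\<lambda>\<rho>. hermite_semigroup (\<rho> + t) f z) r) = (\<Sum>k. of_real (incomplete_gamma_integral a t (?L k)) * v k)" .
  have gsum: "summable (\<lambda>k. of_real (incomplete_gamma_integral a t (?L k)) * v k)"
  proof (rule summable_comparison_test'[OF summable_mult[OF vsum, of "LINT r|lborel. w r"], of 0])
    fix k
    have "incomplete_gamma_integral a t (?L k) = (LINT r|lborel. w r * exp (- ?L k * r))"
      by (simp add: incomplete_gamma_integral_def w_def mult.assoc)
    also have "\<dots> \<le> (LINT r|lborel. w r)" by (intro integral_mono gint wint wexp)
    finally have "incomplete_gamma_integral a t (?L k) \<le> (LINT r|lborel. w r)" .
    moreover have "incomplete_gamma_integral a t (?L k) \<ge> 0"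
      unfolding incomplete_gamma_integral_def by (intro integral_nonneg_AE) auto
    ultimately show "norm (of_real (incomplete_gamma_integral a t (?L k)) * v k) \<le> (LINT r|lborel. w r) * norm (v k)"
      by (simp add: norm_mult mult_right_mono)
  qed
  have "gen_heat_transform t s f z = of_real (1 / Gamma a) * (\<Sum>k. of_real (incomplete_gamma_integral a t (?L k)) * v k)"
    unfolding gen_heat_transform_def Let_def m_def[symmetric] I a_def ..
  also have "\<dots> = (\<Sum>k. of_real (1 / Gamma a) * (of_real (incomplete_gamma_integral a t (?L k)) * v k))"
    by (rule suminf_mult[OF gsum, symmetric])
  also have "\<dots> = hermite_series t (\<lambda>\<alpha>. of_real (transform_coeff t s \<alpha>) * hermite_coeff f \<alpha>) z"
    unfolding hermite_series_def
  proof (rule suminf_cong)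
    fix k
    have "(\<Sum>\<alpha> | total_deg \<alpha> = k. of_real (transform_coeff t s \<alpha>) * hermite_coeff f \<alpha> * multi_hermite_ext \<alpha> z) = of_real ((- 1) ^ m * heat_multiplier t s (?L k)) * p k"
      unfolding p_def sum_distrib_left by (intro sum.cong) (auto simp: transform_coeff_def m_def)
    moreover have "(- 1) ^ m * heat_multiplier t s (?L k) = 1 / Gamma a * incomplete_gamma_integral a t (?L k) * (- ?L k) ^ m"
      by (simp add: heat_multiplier_def Let_def m_def[symmetric] a_def[symmetric] power_minus[of "?L k"])
    ultimately show "of_real (1 / Gamma a) * (of_real (incomplete_gamma_integral a t (?L k)) * v k) =
        of_real (exp (- ?L k * t)) * (\<Sum>\<alpha> | total_deg \<alpha> = k. of_real (transform_coeff t s \<alpha>) * hermite_coeff f \<alpha> * multi_hermite_ext \<alpha> z)"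
      by (simp add: v_def mult_ac)
  qed
  finally show "gen_heat_transform t s f z = hermite_series t (\<lambda>\<alpha>. of_real (transform_coeff t s \<alpha>) * hermite_coeff f \<alpha>) z" .
qed

lemma hermite_series_linear:
  fixes a b :: "('n::finite \<Rightarrow> nat) \<Rightarrow> complex"
  assumes "subexp_coeff a" "subexp_coeff b" "\<rho> > 0"
  shows "hermite_series \<rho> (\<lambda>\<alpha>. x * a \<alpha> + y * b \<alpha>) z = x * hermite_series \<rho> a z + y * hermite_series \<rho> b z"
proof -
  let ?t = "\<lambda>a k. of_real (exp (- eigenval TYPE('n) k * \<rho>)) * (\<Sum>\<alpha> | total_deg \<alpha> = k. a \<alpha> * multi_hermite_ext \<alpha> z)"
  have "?t (\<lambda>\<alpha>. x * a \<alpha> + y * b \<alpha>) k = x * ?t a k + y * ?t b k" for k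
    by (simp add: sum.distrib sum_distrib_left distrib_left distrib_right mult_ac)
  moreover have "(\<lambda>k. x * ?t a k + y * ?t b k) sums (x * hermite_series \<rho> a z + y * hermite_series \<rho> b z)"
    unfolding hermite_series_def by (intro sums_add sums_mult summable_sums summable_hermite_series assms)
  ultimately have "?t (\<lambda>\<alpha>. x * a \<alpha> + y * b \<alpha>) sums (x * hermite_series \<rho> a z + y * hermite_series \<rho> b z)"
    by presburger
  then show ?thesis unfolding hermite_series_def by (rule sums_unique[symmetric])
qed

section \<open>The Hilbert space of entire functions\<close>

lemma HL2_iff:
  fixes F :: "complex^'n \<Rightarrow> complex"
  assumes t: "t > 0"
  shows "F \<in> HL2 t \<longleftrightarrow> entire F \<and> sq_int (U_measure t) F"
    and "entire F \<Longrightarrow> HL2_norm t F = sqrt (norm_sq (U_measure t) F)"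
proof -
  have m: "F \<in> borel_measurable borel \<and> (\<lambda>z. (cmod (F z))\<^sup>2) \<in> borel_measurable borel" if "entire F"
  proof
    show "F \<in> borel_measurable borel" by (rule borel_measurable_continuous_onI[OF entire_continuous[OF that]])
    then show "(\<lambda>z. (cmod (F z))\<^sup>2) \<in> borel_measurable borel" by measurable
  qed
  have MUm: "borel_measurable (U_measure t) = borel_measurable (borel :: (complex^'n) measure)"
    unfolding U_measure_def by (intro measurable_cong_sets) auto
  show "F \<in> HL2 t \<longleftrightarrow> entire F \<and> sq_int (U_measure t) F"
  proof (cases "entire F")
    case True
    then show ?thesis
      using m[OF True] integrable_U_measure[OF t, of "\<lambda>z. (cmod (F z))\<^sup>2"] by (simp add: HL2_def sq_int_def MUm mult.commute)
  qed (simp add: HL2_def)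
  show "HL2_norm t F = sqrt (norm_sq (U_measure t) F)" if "entire F"
    using m[OF that] integral_U_measure[OF t, of "\<lambda>z. (cmod (F z))\<^sup>2"] by (simp add: HL2_norm_def norm_sq_def mult.commute)
qed

text \<open>The factor \<open>e^(- \<lambda>\<^sub>k t)\<close> cancels the growth \<open>e^(4 t k)\<close> of the squared norms, so that a Hermite series at
  time \<open>t\<close> is, up to one constant \<open>\<kappa>\<close>, the orthonormal expansion with the same coefficients. Completeness of
  the Hermite functions among entire functions gives the last part.\<close>

lemma HL2_expansion:
  assumes t: "t > 0"
  shows "\<exists>\<kappa>>0.
    (\<forall>a :: ('n::finite \<Rightarrow> nat) \<Rightarrow> complex. summable (shell total_deg a) \<longrightarrow>
       hermite_series t a \<in> HL2 t \<and> norm_sq (U_measure t) (hermite_series t a) = \<kappa>\<^sup>2 * suminf (shell total_deg a)) \<and>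
    (\<forall>a b :: ('n \<Rightarrow> nat) \<Rightarrow> complex.
       summable (shell total_deg a) \<and> summable (shell total_deg b) \<and> hermite_series t a = hermite_series t b \<longrightarrow> a = b) \<and>
    (\<forall>F :: complex^'n \<Rightarrow> complex. F \<in> HL2 t \<longrightarrow> (\<exists>a. summable (shell total_deg a) \<and> F = hermite_series t a))"
proof -
  obtain K where K: "K > 0" "graded_ons (U_measure t :: (complex^'n) measure) (multi_hermite_U K t) total_deg"
    using hermite_ons_U_measure[OF t] by blast
  interpret U: graded_ons "U_measure t :: (complex^'n) measure" "multi_hermite_U K t" total_deg by (rule K(2))
  define \<kappa> where "\<kappa> = sqrt K * exp (- real CARD('n) * t)"
  have \<kappa>: "\<kappa> > 0" using K by (simp add: \<kappa>_def)
  have coeff: "of_real \<kappa> * a \<alpha> * multi_hermite_U K t \<alpha> z = of_real (exp (- eigenval TYPE('n) (total_deg \<alpha>) * t)) * (a \<alpha> * multi_hermite_ext \<alpha> z)"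
    for a and \<alpha> :: "'n \<Rightarrow> nat" and z
  proof -
    have "exp (4 * t) ^ total_deg \<alpha> = (exp (2 * t) ^ total_deg \<alpha>)\<^sup>2"
      by (simp add: exp_of_nat_mult[symmetric] power2_eq_square exp_add[symmetric])
    then have "sqrt (K * exp (4 * t) ^ total_deg \<alpha>) = sqrt K * exp (2 * t) ^ total_deg \<alpha>"
      by (simp add: real_sqrt_mult)
    then have "\<kappa> * (1 / sqrt (K * exp (4 * t) ^ total_deg \<alpha>)) = exp (- real CARD('n) * t) / exp (2 * t) ^ total_deg \<alpha>"
      using K by (simp add: \<kappa>_def)
    also have "\<dots> = exp (- eigenval TYPE('n) (total_deg \<alpha>) * t)"
      by (simp add: exp_of_nat_mult[symmetric] exp_diff[symmetric] eigenval_def algebra_simps)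
    finally have "complex_of_real \<kappa> * of_real (1 / sqrt (K * exp (4 * t) ^ total_deg \<alpha>)) = of_real (exp (- eigenval TYPE('n) (total_deg \<alpha>) * t))"
      by (simp only: of_real_mult[symmetric])
    moreover have "of_real \<kappa> * a \<alpha> * multi_hermite_U K t \<alpha> z = (complex_of_real \<kappa> * of_real (1 / sqrt (K * exp (4 * t) ^ total_deg \<alpha>))) * (a \<alpha> * multi_hermite_ext \<alpha> z)"
      unfolding multi_hermite_U_def by (simp only: mult_ac)
    ultimately show ?thesis by (simp only:)
  qed
  have shell\<kappa>: "shell total_deg (\<lambda>\<alpha>. of_real \<kappa> * a \<alpha>) k = \<kappa>\<^sup>2 * shell total_deg a k" for a :: "('n \<Rightarrow> nat) \<Rightarrow> complex" and k
    using \<kappa> by (simp add: shell_def norm_mult power_mult_distrib sum_distrib_left)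
  have MUm: "borel_measurable (U_measure t) = borel_measurable (borel :: (complex^'n) measure)"
    unfolding U_measure_def by (intro measurable_cong_sets) auto
  have lim: "sq_int (U_measure t) (hermite_series t a)" "(\<lambda>N. norm_sq (U_measure t) (\<lambda>z. hermite_series t a z - expansion_upto total_deg (multi_hermite_U K t) (\<lambda>\<alpha>. of_real \<kappa> * a \<alpha>) N z)) \<longlonglongrightarrow> 0"
    if a: "summable (shell total_deg a)" for a :: "('n \<Rightarrow> nat) \<Rightarrow> complex"
  proof -
    have s: "summable (shell total_deg (\<lambda>\<alpha>. of_real \<kappa> * a \<alpha>))"
      unfolding shell\<kappa>[abs_def] by (intro summable_mult a)
    have m: "hermite_series t a \<in> borel_measurable (U_measure t)"
      unfolding MUm by (rule borel_measurable_continuous_onI[OF entire_continuous[OF entire_hermite_series[OF subexp_coeff_shell[OF a] t]]])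
    have l: "(\<lambda>N. expansion_upto total_deg (multi_hermite_U K t) (\<lambda>\<alpha>. of_real \<kappa> * a \<alpha>) N z) \<longlonglongrightarrow> hermite_series t a z" for z
      by (rule expansion_upto_tendsto[where \<phi> = "\<lambda>z. z" and e = "multi_hermite_U K t" and b = "\<lambda>\<alpha>. of_real \<kappa> * a \<alpha>" and a = a and \<rho> = t])
         (rule coeff subexp_coeff_shell[OF a] t)+
    show "sq_int (U_measure t) (hermite_series t a)" "(\<lambda>N. norm_sq (U_measure t) (\<lambda>z. hermite_series t a z - expansion_upto total_deg (multi_hermite_U K t) (\<lambda>\<alpha>. of_real \<kappa> * a \<alpha>) N z)) \<longlonglongrightarrow> 0"
      using U.fatou_limit[OF s strict_mono_id m, unfolded id_apply, OF AE_I2[OF l]] by auto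
  qed
  have coeffs: "inner_prod (U_measure t) (hermite_series t a) (multi_hermite_U K t \<alpha>) = of_real \<kappa> * a \<alpha>" if "summable (shell total_deg a)" for a and \<alpha> :: "'n \<Rightarrow> nat"
    by (rule U.coeff_of_limit[OF lim[OF that]])
  have part1: "hermite_series t a \<in> HL2 t \<and> norm_sq (U_measure t) (hermite_series t a) = \<kappa>\<^sup>2 * suminf (shell total_deg a)"
    if a: "summable (shell total_deg a)" for a :: "('n \<Rightarrow> nat) \<Rightarrow> complex"
  proof -
    have "shell total_deg (\<lambda>\<alpha>. of_real \<kappa> * a \<alpha>) sums norm_sq (U_measure t) (hermite_series t a)"
      by (rule U.norm_sq_of_limit[OF lim[OF a]])
    moreover have "shell total_deg (\<lambda>\<alpha>. of_real \<kappa> * a \<alpha>) sums (\<kappa>\<^sup>2 * suminf (shell total_deg a))"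
      unfolding shell\<kappa>[abs_def] by (intro sums_mult summable_sums a)
    ultimately have "norm_sq (U_measure t) (hermite_series t a) = \<kappa>\<^sup>2 * suminf (shell total_deg a)" by (rule sums_unique2)
    then show "hermite_series t a \<in> HL2 t \<and> norm_sq (U_measure t) (hermite_series t a) = \<kappa>\<^sup>2 * suminf (shell total_deg a)"
      using lim(1)[OF a] entire_hermite_series[OF subexp_coeff_shell[OF a] t] by (simp add: HL2_iff[OF t])
  qed
  have part2: "a = b" if "summable (shell total_deg a)" "summable (shell total_deg b)" "hermite_series t a = hermite_series t b"
    for a b :: "('n \<Rightarrow> nat) \<Rightarrow> complex"
  proof
    fix \<alpha>
    have "of_real \<kappa> * a \<alpha> = of_real \<kappa> * b \<alpha>"
      unfolding coeffs[OF that(1), symmetric] coeffs[OF that(2), symmetric] that(3) ..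
    then show "a \<alpha> = b \<alpha>" using \<kappa> by simp
  qed
  have part3: "\<exists>a. summable (shell total_deg a) \<and> F = hermite_series t a" if "F \<in> HL2 t" for F :: "complex^'n \<Rightarrow> complex"
  proof -
    from that have F: "entire F" "sq_int (U_measure t) F" by (auto simp: HL2_iff[OF t])
    define a where "a \<alpha> = inner_prod (U_measure t) F (multi_hermite_U K t \<alpha>) / of_real \<kappa>" for \<alpha>
    have da: "inner_prod (U_measure t) F (multi_hermite_U K t \<alpha>) = of_real \<kappa> * a \<alpha>" for \<alpha> using \<kappa> by (simp add: a_def)
    have "summable (shell total_deg (\<lambda>\<alpha>. of_real \<kappa> * a \<alpha>))"
      using U.bessel[OF F(2)] unfolding da .
    then have a: "summable (shell total_deg a)"
      unfolding shell\<kappa>[abs_def] using \<kappa> by (subst (asm) summable_cmult_iff) auto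
    have "F z - hermite_series t a z = 0" for z
    proof (rule hermite_complete_entire[OF t])
      show "entire (\<lambda>z. F z - hermite_series t a z)" by (intro entire_diff F entire_hermite_series subexp_coeff_shell a t)
      show "sq_int (U_measure t) (\<lambda>z. F z - hermite_series t a z)" by (intro sq_int_diff F lim a)
      fix \<alpha> :: "'n \<Rightarrow> nat"
      have "inner_prod (U_measure t) (\<lambda>z. F z - hermite_series t a z) (multi_hermite_U K t \<alpha>) = 0"
        by (subst inner_prod_diff_left) (auto intro: F lim a U.sq simp: coeffs[OF a] da)
      then show "inner_prod (U_measure t) (\<lambda>z. F z - hermite_series t a z) (multi_hermite_ext \<alpha>) = 0"
        unfolding multi_hermite_U_def[abs_def] inner_prod_cmult_right using K by simp
    qed
    then show "\<exists>a. summable (shell total_deg a) \<and> F = hermite_series t a" using a by (auto simp: fun_eq_iff)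
  qed
  show ?thesis
    by (rule exI[of _ \<kappa>]) (simp add: \<kappa> part1 part2 part3)
qed

section \<open>The transform is an isomorphism\<close>

theorem theorem1p6:
  fixes t s :: real
  assumes "t > 0" and "s > 0"
  defines "W \<equiv> hermite_sobolev s :: (real^'n \<Rightarrow> complex) set"
  shows "ae_linear_bij W (HL2 t) (gen_heat_transform t s) \<and>
    (\<exists>C. \<forall>f\<in>W. HL2_norm t (gen_heat_transform t s f) \<le> C * hermite_sobolev_norm s f) \<and>
    (\<exists>C. \<forall>f\<in>W. hermite_sobolev_norm s f \<le> C * HL2_norm t (gen_heat_transform t s f)) \<and>
    (\<exists>N. ae_norm_on W N \<and> equivalent_norms_on W (hermite_sobolev_norm s) N \<and>
      (\<forall>f\<in>W. HL2_norm t (gen_heat_transform t s f) = N f))"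
proof -
  note t = \<open>t > 0\<close> and s = \<open>s > 0\<close>
  interpret R: graded_ons "lborel :: (real^'n) measure" multi_hermite_fun total_deg by (rule hermite_ons)
  let ?L = "eigenval TYPE('n)"
  let ?T = "gen_heat_transform t s :: (real^'n \<Rightarrow> complex) \<Rightarrow> _"
  let ?c = "hermite_coeff :: (real^'n \<Rightarrow> complex) \<Rightarrow> _"
  define \<mu> where "\<mu> k = heat_multiplier t s (?L k)" for k
  define A where "A f \<alpha> = of_real (transform_coeff t s \<alpha>) * ?c f \<alpha>" for f \<alpha>
  obtain c0 C0 where c0: "c0 > 0" and C0: "C0 > 0"
    and lower: "\<And>k. c0 * ?L k powr (s / 2) \<le> \<mu> k" and upper: "\<And>k. \<mu> k \<le> C0 * ?L k powr (s / 2)"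
    using heat_multiplier_bounds[OF t s] eigenval_ge_1 unfolding \<mu>_def by metis
  have L0: "?L k > 0" for k using eigenval_ge_1[where ?'n='n, of k] by linarith
  have \<mu>0: "\<mu> k > 0" for k
  proof -
    have "0 < c0 * ?L k powr (s / 2)" using c0 L0[of k] by (intro mult_pos_pos) simp_all
    then show ?thesis using lower[of k] by linarith
  qed
  have Ls: "(?L k powr (s / 2))\<^sup>2 = ?L k powr s" for k
    by (simp add: power2_eq_square powr_add[symmetric])
  have \<mu>2_lower: "c0\<^sup>2 * ?L k powr s \<le> (\<mu> k)\<^sup>2" for k
    using power_mono[OF lower[of k], of 2] c0 by (simp add: power_mult_distrib Ls)
  have \<mu>2_upper: "(\<mu> k)\<^sup>2 \<le> C0\<^sup>2 * ?L k powr s" for k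
    using power_mono[OF upper[of k], of 2] \<mu>0[of k] by (simp add: power_mult_distrib Ls)
  have shellA: "shell total_deg (A f) k = (\<mu> k)\<^sup>2 * shell total_deg (?c f) k" for f k
    unfolding shell_def sum_distrib_left A_def
    by (intro sum.cong refl) (auto simp: norm_mult norm_power power_mult_distrib transform_coeff_def \<mu>_def abs_mult power_abs)
  have W: "f \<in> W \<longleftrightarrow> sq_int lborel f \<and> summable (\<lambda>k. ?L k powr s * shell total_deg (?c f) k)" for f
    by (simp add: W_def hermite_sobolev_def L2_iff norm_sq_hermite_proj eigenval_def)
  have Wsq: "sq_int lborel f" if "f \<in> W" for f using that by (simp add: W)
  have Wsum: "summable (\<lambda>k. ?L k powr s * shell total_deg (?c f) k)" if "f \<in> W" for f using that by (simp add: W)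
  have norm_W: "hermite_sobolev_norm s f = sqrt (\<Sum>k. ?L k powr s * shell total_deg (?c f) k)" for f
    by (simp add: hermite_sobolev_norm_def norm_sq_hermite_proj eigenval_def)
  have sumA: "summable (shell total_deg (A f))" if "f \<in> W" for f
    by (rule summable_comparison_test'[OF summable_mult[OF Wsum[OF that], of "C0\<^sup>2"], of 0])
       (use \<mu>2_upper in \<open>auto simp: shellA mult.assoc[symmetric] intro!: mult_right_mono\<close>)
  have T: "?T f = hermite_series t (A f)" if "sq_int lborel f" for f
    unfolding A_def by (rule gen_heat_transform_eq[OF that t s])
  obtain \<kappa> where \<kappa>: "\<kappa> > 0"
    and \<kappa>_prop: "(\<forall>a :: ('n \<Rightarrow> nat) \<Rightarrow> complex. summable (shell total_deg a) \<longrightarrow>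
       hermite_series t a \<in> HL2 t \<and> norm_sq (U_measure t) (hermite_series t a) = \<kappa>\<^sup>2 * suminf (shell total_deg a)) \<and>
    (\<forall>a b :: ('n \<Rightarrow> nat) \<Rightarrow> complex.
       summable (shell total_deg a) \<and> summable (shell total_deg b) \<and> hermite_series t a = hermite_series t b \<longrightarrow> a = b) \<and>
    (\<forall>F :: complex^'n \<Rightarrow> complex. F \<in> HL2 t \<longrightarrow> (\<exists>a. summable (shell total_deg a) \<and> F = hermite_series t a))"
    using HL2_expansion[OF t, where ?'n = 'n] by (elim exE conjE) (rule that, assumption, intro conjI)
  have fwd: "hermite_series t a \<in> HL2 t \<and> norm_sq (U_measure t) (hermite_series t a) = \<kappa>\<^sup>2 * suminf (shell total_deg a)"
    if "summable (shell total_deg a)" for a :: "('n \<Rightarrow> nat) \<Rightarrow> complex"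
    using conjunct1[OF \<kappa>_prop] that by simp
  have inj: "a = b" if "summable (shell total_deg a)" "summable (shell total_deg b)" "hermite_series t a = hermite_series t b"
    for a b :: "('n \<Rightarrow> nat) \<Rightarrow> complex"
    using conjunct1[OF conjunct2[OF \<kappa>_prop], rule_format, of a b] that by simp
  have surj: "\<exists>a. summable (shell total_deg a) \<and> F = hermite_series t a" if "F \<in> HL2 t" for F :: "complex^'n \<Rightarrow> complex"
    using conjunct2[OF conjunct2[OF \<kappa>_prop], rule_format, OF that] .
  have THL2: "?T f \<in> HL2 t" if "f \<in> W" for f
    using fwd[OF sumA[OF that]] T[OF Wsq[OF that]] by simp
  have Tnorm: "HL2_norm t (?T f) = \<kappa> * sqrt (suminf (shell total_deg (A f)))" if "f \<in> W" for f
    using fwd[OF sumA[OF that]] THL2[OF that] \<kappa> T[OF Wsq[OF that]]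
    by (simp add: HL2_iff[OF t] real_sqrt_mult)
  have c_linear: "?c (\<lambda>x. a * f x + b * g x) \<alpha> = a * ?c f \<alpha> + b * ?c g \<alpha>" if "sq_int lborel f" "sq_int lborel g" for f g a b \<alpha>
    by (subst inner_prod_add_left) (auto simp: inner_prod_cmult_left intro: sq_int_cmult that R.sq)
  have T_linear: "?T (\<lambda>x. a * f x + b * g x) = (\<lambda>z. a * ?T f z + b * ?T g z)" if "f \<in> W" "g \<in> W" for f g a b
  proof -
    have sq: "sq_int lborel (\<lambda>x. a * f x + b * g x)" by (intro sq_int_add sq_int_cmult Wsq that)
    have A_eq: "A (\<lambda>x. a * f x + b * g x) = (\<lambda>\<alpha>. a * A f \<alpha> + b * A g \<alpha>)"
      by (simp add: A_def fun_eq_iff c_linear Wsq that algebra_simps)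
    show ?thesis
      unfolding T[OF sq] T[OF Wsq[OF that(1)]] T[OF Wsq[OF that(2)]] A_eq
      by (rule ext) (rule hermite_series_linear[OF subexp_coeff_shell[OF sumA[OF that(1)]] subexp_coeff_shell[OF sumA[OF that(2)]] t])
  qed
  have transform_nz: "transform_coeff t s \<alpha> \<noteq> 0" for \<alpha> :: "'n \<Rightarrow> nat"
    using \<mu>0[of "total_deg \<alpha>"] by (simp add: transform_coeff_def \<mu>_def)
  have AE_iff: "?c f = ?c g \<longleftrightarrow> (AE x in lborel. f x = g x)" if f: "sq_int lborel f" and g: "sq_int lborel g" for f g
  proof
    assume eq: "?c f = ?c g"
    have "AE x in lborel. f x - g x = 0"
      by (rule hermite_complete_real[OF sq_int_diff[OF f g]])
         (use fun_cong[OF eq] in \<open>simp add: inner_prod_diff_left f g R.sq\<close>)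
    then show "AE x in lborel. f x = g x" by simp
  next
    assume ae: "AE x in lborel. f x = g x"
    show "?c f = ?c g"
    proof
      fix \<alpha>
      show "?c f \<alpha> = ?c g \<alpha>"
        unfolding inner_prod_def
        by (rule integral_cong_AE) (use ae f g R.sq[of \<alpha>] in \<open>auto simp: sq_int_def intro!: borel_measurable_times borel_measurable_cnj\<close>)
    qed
  qed
  have T_inj: "?T f = ?T g \<longleftrightarrow> (AE x in lborel. f x = g x)" if "f \<in> W" "g \<in> W" for f g
  proof -
    have "?T f = ?T g \<longleftrightarrow> A f = A g"
      unfolding T[OF Wsq[OF that(1)]] T[OF Wsq[OF that(2)]]
      using inj[OF sumA[OF that(1)] sumA[OF that(2)]] by auto
    also have "\<dots> \<longleftrightarrow> ?c f = ?c g"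
      using transform_nz by (auto simp: A_def fun_eq_iff)
    also have "\<dots> \<longleftrightarrow> (AE x in lborel. f x = g x)"
      by (intro AE_iff Wsq that)
    finally show ?thesis .
  qed
  have T_surj: "\<exists>f\<in>W. ?T f = F" if F: "F \<in> HL2 t" for F
  proof -
    obtain a where a: "summable (shell total_deg a)" "F = hermite_series t a" using surj[OF F] by blast
    define b where "b \<alpha> = a \<alpha> / of_real (transform_coeff t s \<alpha>)" for \<alpha>
    have shell_b: "shell total_deg a k = (\<mu> k)\<^sup>2 * shell total_deg b k" for k
      unfolding shell_def sum_distrib_left b_def
      by (intro sum.cong refl)
         (use \<mu>0 in \<open>auto simp: norm_divide norm_mult norm_power power_divide transform_coeff_def \<mu>_def abs_mult power_abs power_mult_distrib less_imp_neq[symmetric]\<close>)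
    \<comment> \<open>The lower bound for the multiplier puts the preimage into the Sobolev space.\<close>
    have Lb: "summable (\<lambda>k. ?L k powr s * shell total_deg b k)"
    proof (rule summable_comparison_test'[OF summable_mult[OF a(1), of "1 / c0\<^sup>2"], of 0])
      fix k
      have "c0\<^sup>2 * ?L k powr s * shell total_deg b k \<le> shell total_deg a k"
        unfolding shell_b by (intro mult_right_mono \<mu>2_lower) simp
      then show "norm (?L k powr s * shell total_deg b k) \<le> 1 / c0\<^sup>2 * shell total_deg a k"
        using c0 by (simp add: field_simps)
    qed
    have sb: "summable (shell total_deg b)"
    proof (rule summable_comparison_test'[OF Lb, of 0])
      fix k
      have "1 \<le> ?L k powr s" using eigenval_ge_1[where ?'n='n, of k] s by (intro ge_one_powr_ge_zero) auto
      then show "norm (shell total_deg b k) \<le> ?L k powr s * shell total_deg b k"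
        using mult_right_mono[of 1 "?L k powr s" "shell total_deg b k"] by simp
    qed
    obtain f where f: "sq_int lborel f" "(\<lambda>N. norm_sq lborel (\<lambda>x. f x - expansion_upto total_deg multi_hermite_fun b N x)) \<longlonglongrightarrow> 0"
      using R.riesz_fischer[OF sb] by blast
    have cf: "?c f = b" using R.coeff_of_limit[OF f] by (simp add: fun_eq_iff)
    have "f \<in> W" using f(1) Lb by (simp add: W cf)
    moreover have "A f = a"
      using transform_nz by (simp add: A_def R.coeff_of_limit[OF f] b_def fun_eq_iff)
    then have "?T f = F" using T[OF f(1)] a(2) by simp
    ultimately show ?thesis by blast
  qed
  have bij: "ae_linear_bij W (HL2 t) ?T"
    unfolding ae_linear_bij_def using THL2 T_linear T_inj T_surj by blast
  have le_upper: "HL2_norm t (?T f) \<le> (\<kappa> * C0) * hermite_sobolev_norm s f" if f: "f \<in> W" for f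
  proof -
    have "suminf (shell total_deg (A f)) \<le> (\<Sum>k. C0\<^sup>2 * (?L k powr s * shell total_deg (?c f) k))"
      by (rule suminf_le[OF _ sumA[OF f] summable_mult[OF Wsum[OF f]]])
         (use \<mu>2_upper in \<open>auto simp: shellA mult.assoc[symmetric] intro!: mult_right_mono\<close>)
    also have "\<dots> = C0\<^sup>2 * (\<Sum>k. ?L k powr s * shell total_deg (?c f) k)"
      by (rule suminf_mult[OF Wsum[OF f]])
    finally have "sqrt (suminf (shell total_deg (A f))) \<le> C0 * hermite_sobolev_norm s f"
      unfolding norm_W using C0 real_sqrt_le_mono by (fastforce simp: real_sqrt_mult)
    then show ?thesis unfolding Tnorm[OF f] using \<kappa> by (simp add: mult.assoc)
  qed
  have le_lower: "hermite_sobolev_norm s f \<le> (1 / (\<kappa> * c0)) * HL2_norm t (?T f)" if f: "f \<in> W" for f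
  proof -
    have "c0\<^sup>2 * (\<Sum>k. ?L k powr s * shell total_deg (?c f) k) = (\<Sum>k. c0\<^sup>2 * (?L k powr s * shell total_deg (?c f) k))"
      by (rule suminf_mult[OF Wsum[OF f], symmetric])
    also have "\<dots> \<le> suminf (shell total_deg (A f))"
      by (rule suminf_le[OF _ summable_mult[OF Wsum[OF f]] sumA[OF f]])
         (use \<mu>2_lower in \<open>auto simp: shellA mult.assoc[symmetric] intro!: mult_right_mono\<close>)
    finally have "c0 * hermite_sobolev_norm s f \<le> sqrt (suminf (shell total_deg (A f)))"
      unfolding norm_W using c0 real_sqrt_le_mono by (fastforce simp: real_sqrt_mult)
    then show ?thesis unfolding Tnorm[OF f] using \<kappa> c0 by (simp add: field_simps)
  qed
  define N where "N f = HL2_norm t (?T f)" for f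
  have Nsq: "N f = sqrt (norm_sq (U_measure t) (?T f))" if "f \<in> W" for f
    using THL2[OF that] by (simp add: N_def HL2_iff[OF t])
  have sqT: "sq_int (U_measure t) (?T f)" if "f \<in> W" for f
    using THL2[OF that] by (simp add: HL2_iff[OF t])
  have W_scale: "(\<lambda>x. c * f x) \<in> W" if f: "f \<in> W" for f c
  proof -
    have "shell total_deg (?c (\<lambda>x. c * f x)) k = (cmod c)\<^sup>2 * shell total_deg (?c f) k" for k
      by (simp add: shell_def inner_prod_cmult_left norm_mult power_mult_distrib sum_distrib_left)
    then show ?thesis
      using sq_int_cmult[OF Wsq[OF f], of c] summable_mult[OF Wsum[OF f], of "(cmod c)\<^sup>2"]
      by (simp add: W mult_ac)
  qed
  have W_add: "(\<lambda>x. f x + g x) \<in> W" if f: "f \<in> W" and g: "g \<in> W" for f g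
  proof -
    have "shell total_deg (?c (\<lambda>x. f x + g x)) k \<le> 2 * shell total_deg (?c f) k + 2 * shell total_deg (?c g) k" for k
      unfolding shell_def sum_distrib_left sum.distrib[symmetric]
      by (intro sum_mono) (simp add: inner_prod_add_left Wsq f g R.sq cmod_add_sq_le)
    then have le: "?L k powr s * shell total_deg (?c (\<lambda>x. f x + g x)) k \<le> 2 * (?L k powr s * shell total_deg (?c f) k) + 2 * (?L k powr s * shell total_deg (?c g) k)" for k
      using mult_left_mono[of _ _ "?L k powr s"] by (fastforce simp: algebra_simps)
    have "summable (\<lambda>k. ?L k powr s * shell total_deg (?c (\<lambda>x. f x + g x)) k)"
      by (rule summable_comparison_test'[OF summable_add[OF summable_mult[OF Wsum[OF f], of 2] summable_mult[OF Wsum[OF g], of 2]], of 0])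
         (simp add: le)
    then show ?thesis using sq_int_add[OF Wsq[OF f] Wsq[OF g]] by (simp add: W)
  qed
  have N_norm: "ae_norm_on W N"
    unfolding ae_norm_on_def
  proof (intro conjI ballI allI)
    fix f assume f: "f \<in> W"
    show "0 \<le> N f" by (simp add: Nsq[OF f])
    have zero: "(\<lambda>x. 0) \<in> W" using W_scale[OF f, of 0] by simp
    have "N f = 0 \<longleftrightarrow> (\<forall>k. shell total_deg (A f) k = 0)"
      using Tnorm[OF f] \<kappa> by (simp add: N_def suminf_eq_zero_iff[OF sumA[OF f]])
    also have "\<dots> \<longleftrightarrow> ?c f = ?c (\<lambda>x. 0)"
    proof -
      have "(\<forall>k. shell total_deg (A f) k = 0) \<longleftrightarrow> (\<forall>\<alpha>. ?c f \<alpha> = 0)"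
      proof
        assume 0: "\<forall>k. shell total_deg (A f) k = 0"
        show "\<forall>\<alpha>. ?c f \<alpha> = 0"
        proof
          fix \<alpha> :: "'n \<Rightarrow> nat"
          have "shell total_deg (?c f) (total_deg \<alpha>) = 0" using spec[OF 0, of "total_deg \<alpha>"] \<mu>0[of "total_deg \<alpha>"] by (auto simp: shellA)
          then show "?c f \<alpha> = 0"
            unfolding shell_def by (subst (asm) sum_nonneg_eq_0_iff) (auto simp: finite_total_deg)
        qed
      qed (simp add: shell_def A_def)
      then show ?thesis by (simp add: fun_eq_iff inner_prod_def)
    qed
    also have "\<dots> \<longleftrightarrow> (AE x in lborel. f x = 0)"
      by (rule AE_iff[OF Wsq[OF f] Wsq[OF zero]])
    finally show "N f = 0 \<longleftrightarrow> (AE x in lborel. f x = 0)" .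
    fix c
    have "?T (\<lambda>x. c * f x) = (\<lambda>z. c * ?T f z)" using T_linear[OF f f, of c 0] by simp
    then show "N (\<lambda>x. c * f x) = cmod c * N f"
      unfolding Nsq[OF W_scale[OF f]] Nsq[OF f] by (simp add: norm_sq_cmult real_sqrt_mult)
  next
    fix f g assume f: "f \<in> W" and g: "g \<in> W"
    have "?T (\<lambda>x. f x + g x) = (\<lambda>z. ?T f z + ?T g z)" using T_linear[OF f g, of 1 1] by simp
    then show "N (\<lambda>x. f x + g x) \<le> N f + N g"
      unfolding Nsq[OF W_add[OF f g]] Nsq[OF f] Nsq[OF g] by (simp add: minkowski sqT f g)
  qed
  have "equivalent_norms_on W (hermite_sobolev_norm s) N"
    unfolding equivalent_norms_on_def N_def
  proof (intro exI conjI ballI)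
    show "\<kappa> * c0 > 0" "\<kappa> * C0 > 0" using \<kappa> c0 C0 by auto
    fix f assume f: "f \<in> W"
    show "\<kappa> * c0 * hermite_sobolev_norm s f \<le> HL2_norm t (?T f)"
      using le_lower[OF f] \<kappa> c0 by (simp add: field_simps)
    show "HL2_norm t (?T f) \<le> \<kappa> * C0 * hermite_sobolev_norm s f" by (rule le_upper[OF f])
  qed
  with bij N_norm le_upper le_lower show ?thesis
    unfolding N_def[symmetric] by blast
qed

end
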